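(* Let $k_1,\dots,k_r\ge 1$ be integers and let $$M = S^{k_1}\times S^{k_2}\times\cdots\times S^{k_r}$$ be the product of $k_i$-dimensional spheres. Then the (co)homological length of $M$ equals the number $r$ of factors: $$\mathrm{long}\, M = r.$$
   Context: **Length.** For a compact connected orientable manifold $M$ without boundary, let $H^*(M;A)$ be the cohomology ring with $A=\mathbb{Z}$ or $\mathbb{R}$. The (cohomological) length $\mathrm{long}\,M$ is the largest integer $q$ such that there exist elements $a_1,\dots,a_q\in H^*(M;A)$ with $\dim a_i>0$ for all $i$ and $a_1\cdots a_q\ne 0$. Dually (by Poincaré duality), it is the largest number of cycles of $M$ of dimension less than $\dim M$ whose intersection (in general position) is a cycle not homologous to zero. *)

theory Defs
  imports
    "HOL-Homology.Homology"
    "HOL-Algebra.QuotRing"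
    "HOL-Library.Extended_Nat"
begin

text \<open>
  Singular cohomology with coefficients in a commutative ring \<open>'r\<close>, as a ring under the
  cup product, built on the singular simplices and chains of HOL-Homology.  A homomorphism from
  the free abelian group of singular \<open>p\<close>-chains to \<open>'r\<close> is represented by its values on the
  singular \<open>p\<close>-simplices, extended by 0 to all other functions.
\<close>

definition singular_cochain ::
    "nat \<Rightarrow> 'a topology \<Rightarrow> (((nat \<Rightarrow> real) \<Rightarrow> 'a) \<Rightarrow> 'r::comm_ring_1) \<Rightarrow> bool"
  where "singular_cochain p X f \<longleftrightarrow> (\<forall>\<sigma>. \<not> singular_simplex p X \<sigma> \<longrightarrow> f \<sigma> = 0)"

definition cochain_eval ::
    "(((nat \<Rightarrow> real) \<Rightarrow> 'a) \<Rightarrow> 'r::comm_ring_1) \<Rightarrow> 'a chain \<Rightarrow> 'r"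
  where "cochain_eval f c =
    (\<Sum>\<sigma>\<in>Poly_Mapping.keys c. of_int (Poly_Mapping.lookup c \<sigma>) * f \<sigma>)"

text \<open>
  The faces of an \<open>n\<close>-simplex \<open>[v\<^sub>0, \<dots>, v\<^sub>n]\<close> spanned by its first \<open>p + 1\<close> vertices and, for
  \<open>n = p + q\<close>, by its last \<open>q + 1\<close> vertices.  The first inclusion of standard simplices is the
  identity because points of \<^term>\<open>standard_simplex p\<close> are padded with zeros.
\<close>

definition front_face :: "nat \<Rightarrow> ((nat \<Rightarrow> real) \<Rightarrow> 'a) \<Rightarrow> (nat \<Rightarrow> real) \<Rightarrow> 'a"
  where "front_face p \<sigma> = restrict \<sigma> (standard_simplex p)"

definition back_face :: "nat \<Rightarrow> nat \<Rightarrow> ((nat \<Rightarrow> real) \<Rightarrow> 'a) \<Rightarrow> (nat \<Rightarrow> real) \<Rightarrow> 'a"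
  where "back_face p q \<sigma> =
    restrict (\<lambda>x. \<sigma> (\<lambda>i. if i < p then 0 else x (i - p))) (standard_simplex q)"

text \<open>
  Elements of the direct sum of the cochain groups are families \<open>F\<close>, with \<open>F p\<close> the
  component of degree \<open>p\<close>.
\<close>

type_synonym ('a, 'r) graded_cochain = "nat \<Rightarrow> ((nat \<Rightarrow> real) \<Rightarrow> 'a) \<Rightarrow> 'r"

definition cochain_ring :: "'a topology \<Rightarrow> ('a, 'r::comm_ring_1) graded_cochain ring"
  where "cochain_ring X =
    \<lparr>carrier = {F. (\<forall>p. singular_cochain p X (F p)) \<and> finite {p. F p \<noteq> (\<lambda>\<sigma>. 0)}},
     mult = (\<lambda>F G n \<sigma>. if singular_simplex n X \<sigma>
                then \<Sum>p\<le>n. F p (front_face p \<sigma>) * G (n - p) (back_face p (n - p) \<sigma>)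
                else 0),
     one = (\<lambda>n \<sigma>. if n = 0 \<and> singular_simplex 0 X \<sigma> then 1 else 0),
     zero = (\<lambda>n \<sigma>. 0),
     add = (\<lambda>F G n \<sigma>. F n \<sigma> + G n \<sigma>)\<rparr>"

text \<open>
  \<open>(\<delta> F) \<sigma> = F (\<partial> \<sigma>)\<close>.  In degree 0 this is 0, since \<^term>\<open>chain_boundary 0\<close> vanishes.
\<close>

definition cochain_diff ::
    "'a topology \<Rightarrow> ('a, 'r::comm_ring_1) graded_cochain \<Rightarrow> ('a, 'r) graded_cochain"
  where "cochain_diff X F n \<sigma> =
    (if singular_simplex n X \<sigma>
     then cochain_eval (F (n - 1)) (chain_boundary n (frag_of \<sigma>)) else 0)"

definition cocycle_ring :: "'a topology \<Rightarrow> ('a, 'r::comm_ring_1) graded_cochain ring"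
  where "cocycle_ring X = (cochain_ring X)
    \<lparr>carrier := {F \<in> carrier (cochain_ring X). cochain_diff X F = (\<lambda>n \<sigma>. 0)}\<rparr>"

definition coboundaries :: "'a topology \<Rightarrow> ('a, 'r::comm_ring_1) graded_cochain set"
  where "coboundaries X = cochain_diff X ` carrier (cochain_ring X)"

definition cohomology_ring :: "'a topology \<Rightarrow> ('a, 'r::comm_ring_1) graded_cochain set ring"
  where "cohomology_ring X = cocycle_ring X Quot coboundaries X"

text \<open>The degree \<open>p\<close> summand of the graded ring \<^term>\<open>cohomology_ring X\<close>.\<close>

definition cohomology_part ::
    "nat \<Rightarrow> 'a topology \<Rightarrow> ('a, 'r::comm_ring_1) graded_cochain set set"
  where "cohomology_part p X =
    {coboundaries X +>\<^bsub>cocycle_ring X\<^esub> F | F.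
       F \<in> carrier (cocycle_ring X) \<and> (\<forall>n. n \<noteq> p \<longrightarrow> F n = (\<lambda>\<sigma>. 0))}"

text \<open>
  The coefficient ring is passed as a type.  The supremum is taken in \<^typ>\<open>enat\<close> so that the
  length makes sense for every space: if it is finite and the space is nonempty, it is the largest
  number of homogeneous classes of positive degree with nonzero product (the empty product being
  \<open>1\<close>), and it is \<open>\<infinity>\<close> if there is no largest such number.
\<close>

definition cohomological_length :: "'r::comm_ring_1 itself \<Rightarrow> 'a topology \<Rightarrow> enat"
  where "cohomological_length TYPE('r) X =
    Sup {enat (length as) | as :: ('a, 'r) graded_cochain set list.
           (\<forall>a\<in>set as. \<exists>p>0. a \<in> cohomology_part p X) \<and>
           foldr (mult (cohomology_ring X)) as (one (cohomology_ring X))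
             \<noteq> zero (cohomology_ring X)}"

end

(*
  Lower bound: multiplication by a suitable class s of degree k of the sphere of dimension k injects
  the cohomology of X into that of the product of X with the sphere.  The class s is built by
  induction on k from the cover of the sphere by the complements of the two poles, and injectivity
  follows by a Mayer-Vietoris argument on cochains.  Multiplying r such classes gives a nonzero
  product on M.

  Upper bound: M has a cover by r + 1 open sets on which every class of positive degree vanishes, so
  in a product of more than r such classes the factors can be represented by cocycles that vanish on
  the respective open sets.  Their product vanishes on all simplices that lie in one of the sets, and
  a cocycle with this property is a coboundary.
*)

theory Submission
  imports Defs
begin

text \<open>The recurring obstacle is that a primitive of a cocycle must be additive in the chain.
  Knowing that every cycle of some kind bounds is not enough: the bounding chains have to be chosen
  linearly and compatibly with the boundary. The homotopy operator and the retraction onto small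
  chains are therefore fixed on single simplices, which form a basis of the chain group, and built
  degree by degree; acyclicity of contractible spaces and iterated subdivision supply each single
  value. Composing a cocycle with such an operator gives the primitive. The number r + 1 in the
  upper bound arises as follows. Covering each sphere by two punctured spheres covers M by 2^r
  contractible products, one for each set J of factors. Shrinking them by comparing coordinates
  across factors makes those with equally large J disjoint, so their unions can serve as single
  members of the cover, one for each size 0, ..., r. Every argument runs over an arbitrary
  commutative coefficient ring, which treats the integers and the reals at once.\<close>

section \<open>Evaluation of cochains\<close>

lemma cochain_eval_superset:
  assumes "finite S" "Poly_Mapping.keys c \<subseteq> S"
  shows "cochain_eval f c = (\<Sum>\<sigma>\<in>S. of_int (Poly_Mapping.lookup c \<sigma>) * f \<sigma>)"
  unfolding cochain_eval_def
  by (rule sum.mono_neutral_left) (use assms in \<open>auto simp: in_keys_iff\<close>)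

lemma cochain_eval_0 [simp]: "cochain_eval f 0 = 0"
  by (simp add: cochain_eval_def)

lemma cochain_eval_of [simp]: "cochain_eval f (frag_of \<sigma>) = f \<sigma>"
  by (simp add: cochain_eval_def)

lemma cochain_eval_add: "cochain_eval f (a + b) = cochain_eval f a + cochain_eval f b"
proof -
  let ?S = "Poly_Mapping.keys a \<union> Poly_Mapping.keys b"
  have "cochain_eval f c = (\<Sum>\<sigma>\<in>?S. of_int (Poly_Mapping.lookup c \<sigma>) * f \<sigma>)"
    if "c \<in> {a, b, a + b}" for c
    by (rule cochain_eval_superset) (use that keys_add[of a b] in auto)
  then show ?thesis
    by (simp add: lookup_add algebra_simps sum.distrib)
qed

lemma cochain_eval_cmul: "cochain_eval f (frag_cmul k a) = of_int k * cochain_eval f a"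
  using cochain_eval_superset[of "Poly_Mapping.keys a" "frag_cmul k a" f]
    keys_cmul[of k a]
  by (simp add: cochain_eval_def sum_distrib_left mult.assoc)

lemma cochain_eval_minus: "cochain_eval f (- a) = - cochain_eval f a"
  using cochain_eval_cmul[of f "-1" a] by simp

lemma cochain_eval_diff: "cochain_eval f (a - b) = cochain_eval f a - cochain_eval f b"
  using cochain_eval_add[of f a "- b"] by (simp add: cochain_eval_minus)

lemma cochain_eval_sum: "cochain_eval f (sum g I) = (\<Sum>i\<in>I. cochain_eval f (g i))"
  by (induction I rule: infinite_finite_induct) (simp_all add: cochain_eval_add)

lemma cochain_eval_frag_extend:
  "cochain_eval f (frag_extend h c) = cochain_eval (\<lambda>\<sigma>. cochain_eval f (h \<sigma>)) c"
  unfolding frag_extend_def cochain_eval_sum cochain_eval_cmul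
  by (simp add: cochain_eval_def)

lemma cochain_eval_fun_add:
  "cochain_eval (\<lambda>\<sigma>. f \<sigma> + g \<sigma>) c = cochain_eval f c + cochain_eval g c"
  by (simp add: cochain_eval_def algebra_simps sum.distrib)

lemma cochain_eval_fun_diff:
  "cochain_eval (\<lambda>\<sigma>. f \<sigma> - g \<sigma>) c = cochain_eval f c - cochain_eval g c"
  by (simp add: cochain_eval_def algebra_simps sum_subtractf)

lemma cochain_eval_fun_cmul: "cochain_eval (\<lambda>\<sigma>. k * f \<sigma>) c = k * cochain_eval f c"
  by (simp add: cochain_eval_def algebra_simps sum_distrib_left)

lemma cochain_eval_fun_zero [simp]: "cochain_eval (\<lambda>\<sigma>. 0) c = 0"
  by (simp add: cochain_eval_def)

lemma cochain_eval_cong: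
  assumes "singular_chain p X c" "\<And>\<sigma>. singular_simplex p X \<sigma> \<Longrightarrow> f \<sigma> = g \<sigma>"
  shows "cochain_eval f c = cochain_eval g c"
  unfolding cochain_eval_def
  by (rule sum.cong) (use assms in \<open>auto simp: singular_chain_def\<close>)

lemma cochain_eval_boundary_of:
  "n > 0 \<Longrightarrow> cochain_eval f (chain_boundary n (frag_of \<sigma>))
    = (\<Sum>k\<le>n. (- 1) ^ k * f (singular_face n k \<sigma>))"
  by (simp add: chain_boundary_of cochain_eval_sum cochain_eval_cmul)

lemma cochain_eval_boundary:
  "cochain_eval g (chain_boundary n c)
    = cochain_eval (\<lambda>\<sigma>. cochain_eval g (chain_boundary n (frag_of \<sigma>))) c"
  by (cases "n = 0") (simp_all add: chain_boundary_def cochain_eval_frag_extend)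

lemma cochain_eval_chain_map:
  "cochain_eval f (chain_map p \<phi> c) = cochain_eval (\<lambda>\<sigma>. f (simplex_map p \<phi> \<sigma>)) c"
  by (simp add: chain_map_def cochain_eval_frag_extend)

section \<open>Cocycles and coboundaries of a single degree\<close>

text \<open>The values of a cochain away from the singular simplices of the space are irrelevant here,
  so that a cochain restricts to a subspace without being changed.\<close>

definition cocycle_on :: "nat \<Rightarrow> 'a topology \<Rightarrow> (((nat \<Rightarrow> real) \<Rightarrow> 'a) \<Rightarrow> 'r::comm_ring_1) \<Rightarrow> bool"
  where "cocycle_on n X f \<longleftrightarrow>
    (\<forall>c. singular_chain (Suc n) X c \<longrightarrow> cochain_eval f (chain_boundary (Suc n) c) = 0)"

text \<open>The primitive is a parameter because the Mayer-Vietoris argument compares two primitives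
  of the same cochain. In degree 0 the boundary is zero, so the condition says that \<open>f\<close>
  vanishes on all 0-simplices.\<close>

definition coboundary_by ::
    "nat \<Rightarrow> 'a topology \<Rightarrow> (((nat \<Rightarrow> real) \<Rightarrow> 'a) \<Rightarrow> 'r::comm_ring_1) \<Rightarrow> (((nat \<Rightarrow> real) \<Rightarrow> 'a) \<Rightarrow> 'r) \<Rightarrow> bool"
  where "coboundary_by n X f g \<longleftrightarrow>
    (\<forall>c. singular_chain n X c \<longrightarrow> cochain_eval f c = cochain_eval g (chain_boundary n c))"

abbreviation coboundary_on :: "nat \<Rightarrow> 'a topology \<Rightarrow> (((nat \<Rightarrow> real) \<Rightarrow> 'a) \<Rightarrow> 'r::comm_ring_1) \<Rightarrow> bool"
  where "coboundary_on n X f \<equiv> \<exists>g. coboundary_by n X f g"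

lemma cocycle_onD:
  "cocycle_on n X f \<Longrightarrow> singular_chain (Suc n) X c \<Longrightarrow> cochain_eval f (chain_boundary (Suc n) c) = 0"
  by (simp add: cocycle_on_def)

lemma coboundary_byD:
  "coboundary_by n X f g \<Longrightarrow> singular_chain n X c \<Longrightarrow> cochain_eval f c = cochain_eval g (chain_boundary n c)"
  by (simp add: coboundary_by_def)

lemma cocycle_on_iff_simplex:
  "cocycle_on n X f \<longleftrightarrow> (\<forall>\<sigma>. singular_simplex (Suc n) X \<sigma> \<longrightarrow>
      cochain_eval f (chain_boundary (Suc n) (frag_of \<sigma>)) = 0)"
proof (intro iffI allI impI)
  assume *: "\<forall>\<sigma>. singular_simplex (Suc n) X \<sigma> \<longrightarrow>
      cochain_eval f (chain_boundary (Suc n) (frag_of \<sigma>)) = 0"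
  show "cocycle_on n X f"
    unfolding cocycle_on_def
  proof (intro allI impI)
    fix c assume "singular_chain (Suc n) X c"
    then have "cochain_eval (\<lambda>\<sigma>. cochain_eval f (chain_boundary (Suc n) (frag_of \<sigma>))) c
        = cochain_eval (\<lambda>\<sigma>. 0) c"
      by (rule cochain_eval_cong) (use * in blast)
    then show "cochain_eval f (chain_boundary (Suc n) c) = 0"
      by (subst cochain_eval_boundary) simp
  qed
qed (simp add: cocycle_on_def singular_chain_of)

lemma coboundary_by_iff_simplex:
  "coboundary_by n X f g \<longleftrightarrow> (\<forall>\<sigma>. singular_simplex n X \<sigma> \<longrightarrow>
      f \<sigma> = cochain_eval g (chain_boundary n (frag_of \<sigma>)))"
proof (intro iffI allI impI)
  assume *: "\<forall>\<sigma>. singular_simplex n X \<sigma> \<longrightarrow> f \<sigma> = cochain_eval g (chain_boundary n (frag_of \<sigma>))"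
  show "coboundary_by n X f g"
    unfolding coboundary_by_def
    by (subst cochain_eval_boundary) (use * in \<open>blast intro: cochain_eval_cong\<close>)
next
  fix \<sigma> assume "coboundary_by n X f g" "singular_simplex n X \<sigma>"
  then show "f \<sigma> = cochain_eval g (chain_boundary n (frag_of \<sigma>))"
    using coboundary_byD[of n X f g "frag_of \<sigma>"] by (simp add: singular_chain_of)
qed

lemma cocycle_on_cong:
  assumes "\<And>\<sigma>. singular_simplex n X \<sigma> \<Longrightarrow> f \<sigma> = g \<sigma>"
  shows "cocycle_on n X f \<longleftrightarrow> cocycle_on n X g"
  unfolding cocycle_on_def using cochain_eval_cong[OF singular_chain_boundary_alt] assms by metis

lemma coboundary_by_cong:
  assumes "\<And>\<sigma>. singular_simplex n X \<sigma> \<Longrightarrow> f \<sigma> = g \<sigma>"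
  shows "coboundary_by n X f h \<longleftrightarrow> coboundary_by n X g h"
  unfolding coboundary_by_def using cochain_eval_cong assms by metis

lemma cocycle_on_subtopology: "cocycle_on n X f \<Longrightarrow> cocycle_on n (subtopology X S) f"
  by (simp add: cocycle_on_def singular_chain_subtopology)

lemma coboundary_by_subtopology: "coboundary_by n X f g \<Longrightarrow> coboundary_by n (subtopology X S) f g"
  by (simp add: coboundary_by_def singular_chain_subtopology)

lemma cocycle_on_diff: "cocycle_on n X f \<Longrightarrow> cocycle_on n X g \<Longrightarrow> cocycle_on n X (\<lambda>\<sigma>. f \<sigma> - g \<sigma>)"
  by (simp add: cocycle_on_def cochain_eval_fun_diff)

lemma coboundary_by_add:
  "coboundary_by n X f a \<Longrightarrow> coboundary_by n X g b \<Longrightarrow> coboundary_by n X (\<lambda>\<sigma>. f \<sigma> + g \<sigma>) (\<lambda>\<sigma>. a \<sigma> + b \<sigma>)"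
  by (simp add: coboundary_by_def cochain_eval_fun_add)

lemma coboundary_by_diff:
  "coboundary_by n X f a \<Longrightarrow> coboundary_by n X g b \<Longrightarrow> coboundary_by n X (\<lambda>\<sigma>. f \<sigma> - g \<sigma>) (\<lambda>\<sigma>. a \<sigma> - b \<sigma>)"
  by (simp add: coboundary_by_def cochain_eval_fun_diff)

lemma coboundary_by_zero: "coboundary_by n X (\<lambda>\<sigma>. 0) (\<lambda>\<sigma>. 0)"
  by (simp add: coboundary_by_def)

lemma coboundary_imp_cocycle: "coboundary_by n X f g \<Longrightarrow> cocycle_on n X f"
  unfolding coboundary_by_def cocycle_on_def
  using singular_chain_boundary_alt chain_boundary_boundary_alt by (metis cochain_eval_0)

lemma coboundary_by_zero_iff: "coboundary_by 0 X f g \<longleftrightarrow> (\<forall>\<sigma>. singular_simplex 0 X \<sigma> \<longrightarrow> f \<sigma> = 0)"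
  by (simp add: coboundary_by_iff_simplex chain_boundary_of)

lemma cocycle_on_pullback:
  assumes "continuous_map X Y \<phi>" "cocycle_on n Y f"
  shows "cocycle_on n X (\<lambda>\<sigma>. f (simplex_map n \<phi> \<sigma>))"
  unfolding cocycle_on_def
proof (intro allI impI)
  fix c assume c: "singular_chain (Suc n) X c"
  then show "cochain_eval (\<lambda>\<sigma>. f (simplex_map n \<phi> \<sigma>)) (chain_boundary (Suc n) c) = 0"
    using cocycle_onD[OF assms(2) singular_chain_chain_map[OF c assms(1)]] chain_boundary_chain_map[OF c, of \<phi>]
    by (simp flip: cochain_eval_chain_map)
qed

lemma coboundary_by_pullback:
  assumes "continuous_map X Y \<phi>" "coboundary_by n Y f g"
  shows "coboundary_by n X (\<lambda>\<sigma>. f (simplex_map n \<phi> \<sigma>)) (\<lambda>\<sigma>. g (simplex_map (n - 1) \<phi> \<sigma>))"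
  unfolding coboundary_by_def
proof (intro allI impI)
  fix c assume c: "singular_chain n X c"
  then show "cochain_eval (\<lambda>\<sigma>. f (simplex_map n \<phi> \<sigma>)) c
      = cochain_eval (\<lambda>\<sigma>. g (simplex_map (n - 1) \<phi> \<sigma>)) (chain_boundary n c)"
    using assms chain_boundary_chain_map[OF c, of \<phi>] singular_chain_chain_map[OF c assms(1)]
    by (simp add: coboundary_by_def flip: cochain_eval_chain_map)
qed

lemma cocycle_modify_coboundary:
  assumes "cocycle_on n X f"
  shows "cocycle_on n X (\<lambda>\<sigma>. f \<sigma> - cochain_eval g (chain_boundary n (frag_of \<sigma>)))"
  by (intro cocycle_on_diff assms coboundary_imp_cocycle[where g = g])
     (simp add: coboundary_by_iff_simplex)

section \<open>The cup product\<close>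

text \<open>One summand of the multiplication of \<open>cochain_ring\<close>. The degrees are
  arguments because a cochain is here a bare function on simplices that carries no degree.\<close>

definition cup :: "nat \<Rightarrow> nat \<Rightarrow> (((nat \<Rightarrow> real) \<Rightarrow> 'a) \<Rightarrow> 'r::comm_ring_1) \<Rightarrow> (((nat \<Rightarrow> real) \<Rightarrow> 'a) \<Rightarrow> 'r)
    \<Rightarrow> ((nat \<Rightarrow> real) \<Rightarrow> 'a) \<Rightarrow> 'r"
  where "cup p q f g \<sigma> = f (front_face p \<sigma>) * g (back_face p q \<sigma>)"

section \<open>Front and back faces, and how they meet face maps and induced maps\<close>

lemma shift_in_standard_simplex:
  assumes "x \<in> standard_simplex q"
  shows "(\<lambda>i. if i < p then 0 else x (i - p)) \<in> standard_simplex (p + q)"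
proof -
  have "(\<Sum>i\<le>p + q. if i < p then 0 else x (i - p)) = (\<Sum>i\<in>{p..p + q}. x (i - p))"
    by (rule sum.mono_neutral_cong_right) auto
  also have "\<dots> = (\<Sum>i\<le>q. x i)"
    by (rule sum.reindex_bij_witness[of _ "\<lambda>i. i + p" "\<lambda>i. i - p"]) auto
  finally show ?thesis
    using assms by (auto simp: standard_simplex_def)
qed

lemma singular_simplex_front_face:
  assumes "singular_simplex n X \<sigma>" "p \<le> n"
  shows "singular_simplex p X (front_face p \<sigma>)"
  using assms standard_simplex_mono[OF assms(2)]
  unfolding singular_simplex_def front_face_def
  by (auto intro: continuous_map_eq[OF continuous_map_from_subtopology_mono])

lemma singular_simplex_back_face:
  assumes "singular_simplex (p + q) X \<sigma>"
  shows "singular_simplex q X (back_face p q \<sigma>)"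
proof -
  let ?s = "\<lambda>x::nat \<Rightarrow> real. \<lambda>i. if i < p then 0 else x (i - p)"
  let ?PT = "powertop_real (UNIV :: nat set)"
  have "continuous_map (subtopology ?PT (standard_simplex q)) ?PT ?s"
    unfolding continuous_map_componentwise_UNIV
    by (intro allI continuous_map_from_subtopology) (auto intro: continuous_map_product_projection)
  then have "continuous_map (subtopology ?PT (standard_simplex q)) (subtopology ?PT (standard_simplex (p + q))) ?s"
    by (auto simp: continuous_map_in_subtopology shift_in_standard_simplex)
  moreover have "continuous_map (subtopology ?PT (standard_simplex (p + q))) X \<sigma>"
    using assms by (simp add: singular_simplex_def)
  ultimately have "continuous_map (subtopology ?PT (standard_simplex q)) X (\<sigma> \<circ> ?s)"
    by (rule continuous_map_compose)
  then show ?thesis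
    unfolding singular_simplex_def back_face_def
    by (simp add: o_def)
qed

lemma front_face_simplex_map:
  "p \<le> n \<Longrightarrow> front_face p (simplex_map n \<phi> \<sigma>) = simplex_map p \<phi> (front_face p \<sigma>)"
  using standard_simplex_mono[of p n] by (auto simp: front_face_def simplex_map_def fun_eq_iff)

lemma back_face_simplex_map:
  "back_face p q (simplex_map (p + q) \<phi> \<sigma>) = simplex_map q \<phi> (back_face p q \<sigma>)"
  by (auto simp: back_face_def simplex_map_def fun_eq_iff shift_in_standard_simplex)

lemma cup_pullback:
  "cup p q (\<lambda>\<sigma>. f (simplex_map p \<phi> \<sigma>)) (\<lambda>\<sigma>. g (simplex_map q \<phi> \<sigma>)) \<sigma> = cup p q f g (simplex_map (p + q) \<phi> \<sigma>)"
  by (simp add: cup_def front_face_simplex_map back_face_simplex_map)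

text \<open>If vertex k is deleted and k is at most p, the first p + 1 remaining vertices are the
  first p + 2 old ones without vertex k.\<close>

lemma front_face_singular_face_low:
  assumes "k \<le> p" "p < n"
  shows "front_face p (singular_face n k \<sigma>) = singular_face (Suc p) k (front_face (Suc p) \<sigma>)"
proof
  fix x :: "nat \<Rightarrow> real"
  show "front_face p (singular_face n k \<sigma>) x = singular_face (Suc p) k (front_face (Suc p) \<sigma>) x"
    using assms simplical_face_in_standard_simplex[of "Suc p" k x] subsetD[OF standard_simplex_mono[of p "n - Suc 0"], of x]
    by (auto simp: front_face_def singular_face_def)
qed

lemma front_face_singular_face_high:
  assumes "p < k" "p < n"
  shows "front_face p (singular_face n k \<sigma>) = front_face p \<sigma>"
proof
  fix x :: "nat \<Rightarrow> real"
  have "simplical_face k x = x" if "x \<in> standard_simplex p"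
    using that assms by (auto simp: simplical_face_def standard_simplex_def fun_eq_iff)
  then show "front_face p (singular_face n k \<sigma>) x = front_face p \<sigma> x"
    using assms subsetD[OF standard_simplex_mono[of p "n - Suc 0"], of x]
    by (auto simp: front_face_def singular_face_def)
qed

text \<open>A vertex of index at most p does not occur among the last q + 1 of the p + q + 2
  vertices; those start at index p + 1.\<close>

lemma back_face_singular_face_low:
  assumes "k \<le> p"
  shows "back_face p q (singular_face (Suc (p + q)) k \<sigma>) = back_face (Suc p) q \<sigma>"
proof
  fix x :: "nat \<Rightarrow> real"
  have "simplical_face k (\<lambda>i. if i < p then 0 else x (i - p)) = (\<lambda>i. if i < Suc p then 0 else x (i - Suc p))"
    using assms by (auto simp: simplical_face_def fun_eq_iff)
  then show "back_face p q (singular_face (Suc (p + q)) k \<sigma>) x = back_face (Suc p) q \<sigma> x"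
    by (auto simp: back_face_def singular_face_def shift_in_standard_simplex)
qed

text \<open>The case j = 0 deletes vertex p and overlaps with
  \<open>back_face_singular_face_low\<close> at k = p. This overlap identifies the middle terms that
  cancel in the Leibniz rule.\<close>

lemma back_face_singular_face_high:
  assumes "j \<le> Suc q"
  shows "back_face p q (singular_face (Suc (p + q)) (p + j) \<sigma>) = singular_face (Suc q) j (back_face p (Suc q) \<sigma>)"
proof
  fix x :: "nat \<Rightarrow> real"
  have "simplical_face (p + j) (\<lambda>i. if i < p then 0 else x (i - p)) = (\<lambda>i. if i < p then 0 else simplical_face j x (i - p))"
  proof
    fix i
    show "simplical_face (p + j) (\<lambda>i. if i < p then 0 else x (i - p)) i = (if i < p then 0 else simplical_face j x (i - p))"
    proof (cases "i < p")
      case False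
      then obtain m where "i = p + m"
        using le_Suc_ex not_less by blast
      then show ?thesis
        by (cases m) (simp_all add: simplical_face_def)
    qed (simp add: simplical_face_def)
  qed
  then show "back_face p q (singular_face (Suc (p + q)) (p + j) \<sigma>) x = singular_face (Suc q) j (back_face p (Suc q) \<sigma>) x"
    using assms simplical_face_in_standard_simplex[of "Suc q" j x] shift_in_standard_simplex[of x q p]
    by (cases "x \<in> standard_simplex q") (simp_all add: back_face_def singular_face_def)
qed

lemma singular_face_last_front_face:
  "singular_face (Suc p) (Suc p) (front_face (Suc p) \<sigma>) = front_face p \<sigma>"
proof
  fix x :: "nat \<Rightarrow> real"
  show "singular_face (Suc p) (Suc p) (front_face (Suc p) \<sigma>) x = front_face p \<sigma> x"
  proof (cases "x \<in> standard_simplex p")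
    case True
    then have "simplical_face (Suc p) x = x"
      by (auto simp: simplical_face_def standard_simplex_def fun_eq_iff)
    then show ?thesis
      using True subsetD[OF standard_simplex_mono[of p "Suc p"], of x]
      by (simp add: front_face_def singular_face_def)
  qed (simp add: front_face_def singular_face_def)
qed

text \<open>Faces of index at most p act on the front factor (\<open>F\<close>), the later ones on
  the back factor (\<open>G\<close>). The right-hand side has two further terms: the last face of
  the front part and face 0 of the back part. Both are the product of the front p-face and the back
  q-face, and their signs are opposite.\<close>

lemma cup_Leibniz:
  "cochain_eval (cup p q f g) (chain_boundary (Suc (p + q)) (frag_of \<sigma>))
   = cochain_eval f (chain_boundary (Suc p) (frag_of (front_face (Suc p) \<sigma>))) * g (back_face (Suc p) q \<sigma>)
     + (- 1) ^ p * (f (front_face p \<sigma>) * cochain_eval g (chain_boundary (Suc q) (frag_of (back_face p (Suc q) \<sigma>))))"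
proof -
  let ?n = "Suc (p + q)"
  define F where "F k = f (singular_face (Suc p) k (front_face (Suc p) \<sigma>)) * g (back_face (Suc p) q \<sigma>)" for k
  define G where "G j = f (front_face p \<sigma>) * g (singular_face (Suc q) j (back_face p (Suc q) \<sigma>))" for j
  have low: "cup p q f g (singular_face ?n k \<sigma>) = F k" if "k \<le> p" for k
    using that by (simp add: cup_def F_def front_face_singular_face_low back_face_singular_face_low)
  have high: "cup p q f g (singular_face ?n (p + Suc j) \<sigma>) = G (Suc j)" if "j \<le> q" for j
    using that back_face_singular_face_high[of "Suc j" q p \<sigma>] front_face_singular_face_high[of p "p + Suc j" ?n \<sigma>]
    by (simp add: cup_def G_def)
  have "singular_face (Suc p) (Suc p) (front_face (Suc p) \<sigma>) = front_face p \<sigma>"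
    by (rule singular_face_last_front_face)
  moreover have "singular_face (Suc q) 0 (back_face p (Suc q) \<sigma>) = back_face (Suc p) q \<sigma>"
    using back_face_singular_face_high[of 0 q p \<sigma>] back_face_singular_face_low[of p p q \<sigma>] by simp
  ultimately have meet: "F (Suc p) = G 0"
    by (simp only: F_def G_def)
  have "cochain_eval (cup p q f g) (chain_boundary ?n (frag_of \<sigma>))
      = (\<Sum>k\<le>?n. (- 1) ^ k * cup p q f g (singular_face ?n k \<sigma>))"
    by (simp add: cochain_eval_boundary_of)
  also have "{..?n} = {..p} \<union> {Suc p..?n}" by auto
  also have "(\<Sum>k\<in>{..p} \<union> {Suc p..?n}. (- 1) ^ k * cup p q f g (singular_face ?n k \<sigma>))
     = (\<Sum>k\<le>p. (- 1) ^ k * cup p q f g (singular_face ?n k \<sigma>)) + (\<Sum>k\<in>{Suc p..?n}. (- 1) ^ k * cup p q f g (singular_face ?n k \<sigma>))"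
    by (rule sum.union_disjoint) auto
  also have "(\<Sum>k\<le>p. (- 1) ^ k * cup p q f g (singular_face ?n k \<sigma>)) = (\<Sum>k\<le>p. (- 1) ^ k * F k)"
    by (simp add: low)
  also have "(\<Sum>k\<in>{Suc p..?n}. (- 1) ^ k * cup p q f g (singular_face ?n k \<sigma>))
     = (\<Sum>j\<le>q. (- 1) ^ (p + Suc j) * cup p q f g (singular_face ?n (p + Suc j) \<sigma>))"
    by (rule sum.reindex_bij_witness[of _ "\<lambda>j. p + Suc j" "\<lambda>k. k - Suc p"]) auto
  also have "\<dots> = (\<Sum>j\<le>q. (- 1) ^ (p + Suc j) * G (Suc j))"
    by (intro sum.cong refl) (use high in auto)
  finally have lhs: "cochain_eval (cup p q f g) (chain_boundary ?n (frag_of \<sigma>))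
     = (\<Sum>k\<le>p. (- 1) ^ k * F k) + (\<Sum>j\<le>q. (- 1) ^ (p + Suc j) * G (Suc j))" .
  have 1: "cochain_eval f (chain_boundary (Suc p) (frag_of (front_face (Suc p) \<sigma>))) * g (back_face (Suc p) q \<sigma>)
     = (\<Sum>k\<le>Suc p. (- 1) ^ k * F k)"
    unfolding cochain_eval_boundary_of[OF zero_less_Suc] sum_distrib_right F_def
    by (simp only: mult.assoc)
  have 2: "(- 1) ^ p * (f (front_face p \<sigma>) * cochain_eval g (chain_boundary (Suc q) (frag_of (back_face p (Suc q) \<sigma>))))
     = (\<Sum>j\<le>Suc q. (- 1) ^ (p + j) * G j)"
    unfolding cochain_eval_boundary_of[OF zero_less_Suc] sum_distrib_left G_def
    by (rule sum.cong) (simp_all only: power_add mult.assoc mult.left_commute)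
  have 3: "(\<Sum>j\<le>Suc q. (- 1) ^ (p + j) * G j) = (- 1) ^ p * G 0 + (\<Sum>j\<le>q. (- 1) ^ (p + Suc j) * G (Suc j))"
    by (simp add: sum.atMost_Suc_shift del: sum.atMost_Suc)
  have 4: "(\<Sum>k\<le>Suc p. (- 1) ^ k * F k) = (\<Sum>k\<le>p. (- 1) ^ k * F k) - (- 1) ^ p * G 0"
    by (simp add: meet)
  have 5: "a + b = (a - x) + (x + b)" for a b x :: "'x::comm_ring_1"
    by simp
  show ?thesis
    unfolding lhs 1 2 3 4 by (rule 5)
qed

section \<open>Cup products of cocycles with cocycles and with coboundaries\<close>

lemma cocycle_on_simplex:
  "cocycle_on n X f \<Longrightarrow> singular_simplex (Suc n) X \<sigma> \<Longrightarrow> cochain_eval f (chain_boundary (Suc n) (frag_of \<sigma>)) = 0"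
  unfolding cocycle_on_iff_simplex by blast

lemma coboundary_by_simplex:
  "coboundary_by n X f g \<Longrightarrow> singular_simplex n X \<sigma> \<Longrightarrow> f \<sigma> = cochain_eval g (chain_boundary n (frag_of \<sigma>))"
  unfolding coboundary_by_iff_simplex by blast

lemma cup_Leibniz_right_cocycle:
  assumes "cocycle_on q X g" "coboundary_by (Suc p) X f f'"
  shows "coboundary_by (Suc (p + q)) X (cup (Suc p) q f g) (cup p q f' g)"
  unfolding coboundary_by_iff_simplex
proof (intro allI impI)
  fix \<sigma> assume \<sigma>: "singular_simplex (Suc (p + q)) X \<sigma>"
  have "cochain_eval g (chain_boundary (Suc q) (frag_of (back_face p (Suc q) \<sigma>))) = 0"
    using assms(1) singular_simplex_back_face[of p "Suc q" X \<sigma>] \<sigma> by (simp add: cocycle_on_simplex)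
  moreover have "f (front_face (Suc p) \<sigma>) = cochain_eval f' (chain_boundary (Suc p) (frag_of (front_face (Suc p) \<sigma>)))"
    by (rule coboundary_by_simplex[OF assms(2)]) (rule singular_simplex_front_face[OF \<sigma>], simp)
  ultimately show "cup (Suc p) q f g \<sigma> = cochain_eval (cup p q f' g) (chain_boundary (Suc (p + q)) (frag_of \<sigma>))"
    unfolding cup_Leibniz by (simp only: cup_def mult_zero_right add_0_right)
qed

lemma cup_Leibniz_left_cocycle:
  fixes f :: "((nat \<Rightarrow> real) \<Rightarrow> 'a) \<Rightarrow> 'r::comm_ring_1"
  assumes "cocycle_on p X f" "coboundary_by (Suc q) X g g'"
  shows "coboundary_by (Suc (p + q)) X (cup p (Suc q) f g) (\<lambda>\<sigma>. (- 1) ^ p * cup p q f g' \<sigma>)"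
  unfolding coboundary_by_iff_simplex
proof (intro allI impI)
  fix \<sigma> assume \<sigma>: "singular_simplex (Suc (p + q)) X \<sigma>"
  have "cochain_eval f (chain_boundary (Suc p) (frag_of (front_face (Suc p) \<sigma>))) = 0"
    using assms(1) singular_simplex_front_face[OF \<sigma>, of "Suc p"] by (simp add: cocycle_on_simplex)
  moreover have "singular_simplex (Suc q) X (back_face p (Suc q) \<sigma>)"
    using singular_simplex_back_face[of p "Suc q" X \<sigma>] \<sigma> by simp
  then have "g (back_face p (Suc q) \<sigma>) = cochain_eval g' (chain_boundary (Suc q) (frag_of (back_face p (Suc q) \<sigma>)))"
    by (rule coboundary_by_simplex[OF assms(2)])
  moreover have "(- 1) ^ p * ((- 1) ^ p * x) = x" for x :: 'r
    by (simp flip: mult.assoc power_add)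
  ultimately show "cup p (Suc q) f g \<sigma>
      = cochain_eval (\<lambda>\<sigma>. (- 1) ^ p * cup p q f g' \<sigma>) (chain_boundary (Suc (p + q)) (frag_of \<sigma>))"
    unfolding cochain_eval_fun_cmul cup_Leibniz by (simp only: cup_def mult_zero_left add_0_left)
qed

lemma cocycle_on_cup:
  assumes "cocycle_on p X f" "cocycle_on q X g"
  shows "cocycle_on (p + q) X (cup p q f g)"
  unfolding cocycle_on_iff_simplex
proof (intro allI impI)
  fix \<sigma> assume \<sigma>: "singular_simplex (Suc (p + q)) X \<sigma>"
  have "cochain_eval f (chain_boundary (Suc p) (frag_of (front_face (Suc p) \<sigma>))) = 0"
    using assms(1) singular_simplex_front_face[OF \<sigma>, of "Suc p"] by (simp add: cocycle_on_simplex)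
  moreover have "cochain_eval g (chain_boundary (Suc q) (frag_of (back_face p (Suc q) \<sigma>))) = 0"
    using assms(2) singular_simplex_back_face[of p "Suc q" X \<sigma>] \<sigma> by (simp add: cocycle_on_simplex)
  ultimately show "cochain_eval (cup p q f g) (chain_boundary (Suc (p + q)) (frag_of \<sigma>)) = 0"
    unfolding cup_Leibniz by simp
qed

lemma coboundary_on_cup_left:
  assumes "coboundary_on p X f" "cocycle_on q X g"
  shows "coboundary_on (p + q) X (cup p q f g)"
proof (cases p)
  case 0
  have "cup p q f g \<sigma> = 0" if "singular_simplex (p + q) X \<sigma>" for \<sigma>
    using assms(1) singular_simplex_front_face[OF that, of p] by (auto simp: cup_def 0 coboundary_by_zero_iff)
  then show ?thesis
    using coboundary_by_zero coboundary_by_cong by metis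
next
  case (Suc m)
  then show ?thesis using assms cup_Leibniz_right_cocycle by fastforce
qed

lemma coboundary_on_cup_right:
  assumes "cocycle_on p X f" "coboundary_on q X g"
  shows "coboundary_on (p + q) X (cup p q f g)"
proof (cases q)
  case 0
  have "cup p q f g \<sigma> = 0" if "singular_simplex (p + q) X \<sigma>" for \<sigma>
    using assms(2) singular_simplex_back_face[OF that] by (auto simp: cup_def 0 coboundary_by_zero_iff)
  then show ?thesis
    using coboundary_by_zero coboundary_by_cong by metis
next
  case (Suc m)
  then show ?thesis using assms cup_Leibniz_left_cocycle by fastforce
qed

section \<open>Homotopy invariance\<close>

text \<open>A contraction makes \<open>z\<close> homologous to its image in a point, where every
  cycle of positive degree bounds. The empty space is treated apart because it offers no point to
  contract to.\<close>

lemma contractible_space_cycle_bounds: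
  assumes Y: "contractible_space Y" and z: "singular_chain q Y z" "chain_boundary q z = 0" and "q > 0"
  obtains y where "singular_chain (Suc q) Y y" "chain_boundary (Suc q) y = z"
proof (cases "topspace Y = {}")
  case True
  then have "z = 0"
    using z singular_chain_empty by blast
  then show ?thesis
    using that[of 0] by simp
next
  case False
  then obtain a where a: "a \<in> topspace Y" "homotopic_with (\<lambda>_. True) Y Y id (\<lambda>_. a)"
    using Y unfolding contractible_space_alt by fastforce
  have rel: "singular_relcycle q Y {} z"
    using z by (simp add: singular_cycle)
  have "homotopic_with (\<lambda>h. h \<in> {} \<rightarrow> {}) Y Y id (\<lambda>_. a)"
    using homotopic_with_mono[OF a(2)] by simp
  from homotopic_imp_homologous_rel_chain_maps[OF this rel]
  have 1: "singular_relboundary q Y {} (z - chain_map q (\<lambda>_. a) z)"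
    using z by (simp add: homologous_rel_def chain_map_ident)
  have const: "continuous_map Y (subtopology Y {a}) (\<lambda>_. a)"
    using a by (simp add: continuous_map_in_subtopology)
  have "singular_relcycle q (subtopology Y {a}) {} (chain_map q (\<lambda>_. a) z)"
    using singular_relcycle_chain_map[OF rel const, of "{}"] by simp
  then have "singular_relboundary q (subtopology Y {a}) {} (chain_map q (\<lambda>_. a) z)"
    using singular_boundary_eq_cycle_singleton[of "subtopology Y {a}" a q] a \<open>q > 0\<close> by simp
  then have "singular_relboundary q Y {} (chain_map q (\<lambda>_. a) z)"
    unfolding singular_boundary by (auto simp: singular_chain_subtopology)
  then have "singular_relboundary q Y {} (z - chain_map q (\<lambda>_. a) z + chain_map q (\<lambda>_. a) z)"
    by (rule singular_relboundary_add[OF 1])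
  then show ?thesis
    using that by (auto simp: singular_boundary)
qed

section \<open>The prism operator\<close>

abbreviation simplex_space :: "nat \<Rightarrow> (nat \<Rightarrow> real) topology"
  where "simplex_space q \<equiv> subtopology (powertop_real UNIV) (standard_simplex q)"

abbreviation cylinder :: "'a topology \<Rightarrow> (real \<times> 'a) topology"
  where "cylinder X \<equiv> prod_topology (top_of_set {0..1}) X"

abbreviation fundamental_simplex :: "nat \<Rightarrow> (nat \<Rightarrow> real) chain"
  where "fundamental_simplex q \<equiv> frag_of (restrict id (standard_simplex q))"

lemma singular_chain_fundamental_simplex: "singular_chain q (simplex_space q) (fundamental_simplex q)"
  by (auto simp: singular_chain_of singular_simplex_def continuous_map_in_subtopology
      intro: continuous_map_eq[of _ _ id])

lemma contractible_simplex_space: "contractible_space (simplex_space q)"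
proof -
  let ?e = "\<lambda>j::nat. if j = 0 then 1 else (0::real)"
  let ?h = "\<lambda>(t::real, x::nat \<Rightarrow> real) i. (1 - t) * x i + t * ?e i"
  have "continuous_map (cylinder (simplex_space q)) euclideanreal (\<lambda>z. ?h z i)" for i
  proof -
    have 1: "continuous_map (cylinder (simplex_space q)) euclideanreal fst"
      by (metis continuous_map_fst continuous_map_in_subtopology)
    have "continuous_map (simplex_space q) euclideanreal (\<lambda>x. x i)"
      by (intro continuous_map_from_subtopology continuous_map_product_projection) simp
    then have 2: "continuous_map (cylinder (simplex_space q)) euclideanreal (\<lambda>z. snd z i)"
      using continuous_map_compose[OF continuous_map_snd] by (fastforce simp: o_def)
    show ?thesis
      unfolding case_prod_unfold
      by (intro continuous_map_add continuous_map_real_mult continuous_map_diff 1 2 continuous_map_const[THEN iffD2]) simp_all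
  qed
  moreover have "?h z \<in> standard_simplex q" if "z \<in> {0..1} \<times> standard_simplex q" for z
    using that convex_standard_simplex[of "snd z" q ?e "fst z"] by (auto simp: case_prod_unfold)
  ultimately have "continuous_map (cylinder (simplex_space q)) (simplex_space q) ?h"
    by (auto simp: continuous_map_in_subtopology continuous_map_componentwise_UNIV)
  then show ?thesis
    unfolding contractible_space_def homotopic_with_def
    by (intro exI[of _ ?e] exI[of _ ?h]) auto
qed

lemma contractible_cylinder_simplex: "contractible_space (cylinder (simplex_space q))"
proof -
  have "contractible_space (top_of_set {0..1::real})"
    by (simp add: convex_imp_contractible is_interval_1)
  then show ?thesis
    unfolding contractible_space_prod_topology using contractible_simplex_space[of q] by blast
qed

lemma continuous_map_cylinder:
  assumes "continuous_map X Y f"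
  shows "continuous_map (cylinder X) (cylinder Y) (map_prod id f)"
  using assms unfolding map_prod_def
  by (auto simp: continuous_map_prod_top)

lemma continuous_map_cylinder_end: "t \<in> {0..1} \<Longrightarrow> continuous_map X (cylinder X) (Pair t)"
  by (simp add: continuous_map_pairwise o_def)

text \<open>A natural operator is determined by its value on the identity simplex. That value is
  \<open>P\<close>, and every other simplex pushes it forward.\<close>

definition prism :: "nat \<Rightarrow> (real \<times> (nat \<Rightarrow> real)) chain \<Rightarrow> 'a chain \<Rightarrow> (real \<times> 'a) chain"
  where "prism q P c = frag_extend (\<lambda>\<sigma>. chain_map (Suc q) (map_prod id \<sigma>) P) c"

lemma prism_diff: "prism q P (a - b) = prism q P a - prism q P b"
  by (simp add: prism_def frag_extend_diff)

lemma prism_0 [simp]: "prism q P 0 = 0"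
  by (simp add: prism_def)

lemma prism_of: "prism q P (frag_of \<sigma>) = chain_map (Suc q) (map_prod id \<sigma>) P"
  by (simp add: prism_def)

lemma singular_chain_prism:
  assumes P: "singular_chain (Suc q) (cylinder (simplex_space q)) P" and c: "singular_chain q X c"
  shows "singular_chain (Suc q) (cylinder X) (prism q P c)"
  unfolding prism_def
proof (rule singular_chain_extend)
  fix \<sigma> assume "\<sigma> \<in> Poly_Mapping.keys c"
  then have "continuous_map (simplex_space q) X \<sigma>"
    using c by (auto simp: singular_chain_def singular_simplex_def)
  then show "singular_chain (Suc q) (cylinder X) (chain_map (Suc q) (map_prod id \<sigma>) P)"
    by (intro singular_chain_chain_map[OF P] continuous_map_cylinder)
qed

lemma chain_map_prism:
  assumes P: "singular_chain (Suc q) (cylinder (simplex_space q)) P"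
  shows "chain_map (Suc q) (map_prod id f) (prism q P c) = prism q P (chain_map q f c)"
  using subset_UNIV[of "Poly_Mapping.keys c"]
proof (induction c rule: frag_induction)
  case (one \<tau>)
  have "chain_map (Suc q) (map_prod id f) (chain_map (Suc q) (map_prod id \<tau>) P)
      = chain_map (Suc q) (map_prod id f \<circ> map_prod id \<tau>) P"
    by (simp add: chain_map_compose)
  \<comment> \<open>\<open>simplex_map\<close> restricts its result to the standard simplex, so the
    two maps agree only over that simplex, which is where \<open>P\<close> lives.\<close>
  also have "\<dots> = chain_map (Suc q) (map_prod id (simplex_map q f \<tau>)) P"
    by (rule chain_map_eq[OF P]) (auto simp: simplex_map_def)
  finally show ?case
    by (simp only: prism_of chain_map_of)
qed (simp_all add: prism_diff chain_map_diff)

text \<open>\<open>P\<close> plays the role of a triangulated prism over the standard simplex.  Instead of a formula, it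
  is obtained one degree at a time from the contractibility of the cylinder (acyclic models).\<close>

definition prism_step :: "nat \<Rightarrow> (real \<times> (nat \<Rightarrow> real)) chain \<Rightarrow> (real \<times> (nat \<Rightarrow> real)) chain \<Rightarrow> bool"
  where "prism_step q P' P \<longleftrightarrow>
    (q > 0 \<longrightarrow> singular_chain q (cylinder (simplex_space (q - 1))) P') \<and>
    singular_chain (Suc q) (cylinder (simplex_space q)) P \<and>
    chain_boundary (Suc q) P = chain_map q (Pair 1) (fundamental_simplex q)
      - chain_map q (Pair 0) (fundamental_simplex q) - prism (q - 1) P' (chain_boundary q (fundamental_simplex q))"

text \<open>\<open>prism_step\<close> is this formula for the identity simplex. Pushing it forward
  along the map induced by a simplex and using naturality of every term gives the formula for that
  simplex, and linearity does the rest.\<close>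

lemma chain_boundary_prism:
  assumes P: "prism_step q P' P" and c: "singular_chain q X c"
  shows "chain_boundary (Suc q) (prism q P c)
    = chain_map q (Pair 1) c - chain_map q (Pair 0) c - prism (q - 1) P' (chain_boundary q c)"
  using c unfolding singular_chain_def
proof (induction c rule: frag_induction)
  case (one \<sigma>)
  then have \<sigma>: "singular_simplex q X \<sigma>" by simp
  let ?m = "map_prod id \<sigma> :: real \<times> (nat \<Rightarrow> real) \<Rightarrow> real \<times> _"
  let ?\<iota> = "fundamental_simplex q"
  have P0: "singular_chain (Suc q) (cylinder (simplex_space q)) P"
    using P by (simp add: prism_step_def)
  have ends: "chain_map q ?m (chain_map q (Pair t) ?\<iota>) = chain_map q (Pair t) (frag_of \<sigma>)" for t
  proof -
    have "restrict (?m \<circ> restrict (Pair t \<circ> restrict id (standard_simplex q)) (standard_simplex q)) (standard_simplex q)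
        = restrict (Pair t \<circ> \<sigma>) (standard_simplex q)"
      by (auto simp: fun_eq_iff restrict_def)
    then show ?thesis
      by (simp add: simplex_map_def)
  qed
  have faces: "chain_map q ?m (prism (q - 1) P' (chain_boundary q ?\<iota>)) = prism (q - 1) P' (chain_boundary q (frag_of \<sigma>))"
  proof (cases q)
    case (Suc m)
    have "chain_map (q - 1) \<sigma> (chain_boundary q ?\<iota>) = chain_boundary q (chain_map q \<sigma> ?\<iota>)"
      using chain_boundary_chain_map[OF singular_chain_fundamental_simplex, of q \<sigma>] by simp
    also have "\<dots> = chain_boundary q (frag_of \<sigma>)"
      by (simp only: singular_simplex_chain_map_id[OF \<sigma>])
    finally show ?thesis
      using P Suc chain_map_prism[of "q - 1" P' \<sigma> "chain_boundary q ?\<iota>"] by (simp add: prism_step_def)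
  qed (simp add: chain_boundary_of)
  have "chain_boundary (Suc q) (prism q P (frag_of \<sigma>)) = chain_map q ?m (chain_boundary (Suc q) P)"
    using chain_boundary_chain_map[OF P0] by (simp add: prism_of)
  also have "\<dots> = chain_map q (Pair 1) (frag_of \<sigma>) - chain_map q (Pair 0) (frag_of \<sigma>)
      - prism (q - 1) P' (chain_boundary q (frag_of \<sigma>))"
    using P ends faces by (simp add: prism_step_def chain_map_diff)
  finally show ?case .
next
  case (diff a b)
  then show ?case
    by (simp add: prism_diff chain_map_diff chain_boundary_diff)
qed simp

text \<open>The required boundary \<open>z\<close> is a cycle by the formula one degree lower, so in
  positive degree it bounds in the contractible cylinder. In degree 0 being a cycle is no
  information, and the two ends have to be joined by a homotopy.\<close>

lemma prism_step_exists:
  assumes "q > 0 \<Longrightarrow> prism_step (q - 1) P'' P'"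
  obtains P where "prism_step q P' P"
proof -
  let ?\<iota> = "fundamental_simplex q"
  let ?C = "cylinder (simplex_space q)"
  define z where "z = chain_map q (Pair 1) ?\<iota> - chain_map q (Pair 0) ?\<iota> - prism (q - 1) P' (chain_boundary q ?\<iota>)"
  note \<iota> = singular_chain_fundamental_simplex[of q]
  have ends: "singular_chain q ?C (chain_map q (Pair t) ?\<iota>)" if "t \<in> {0..1}" for t
    by (rule singular_chain_chain_map[OF \<iota> continuous_map_cylinder_end[OF that]])
  have "\<exists>y. singular_chain (Suc q) ?C y \<and> chain_boundary (Suc q) y = z"
  proof (cases q)
    case 0
    \<comment> \<open>The identity of the cylinder is itself a homotopy from one end to the
      other.\<close>
    have "homotopic_with (\<lambda>h. h \<in> {} \<rightarrow> {}) (simplex_space q) ?C (Pair 0) (Pair 1)"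
      unfolding homotopic_with_def by (intro exI[of _ id]) auto
    from homotopic_imp_homologous_rel_chain_maps[OF homotopic_with_symD[OF this], of q ?\<iota>] \<iota>
    have "singular_relboundary q ?C {} (chain_map q (Pair 1) ?\<iota> - chain_map q (Pair 0) ?\<iota>)"
      by (simp add: homologous_rel_def singular_cycle 0 chain_boundary_def)
    then show ?thesis
      by (simp add: singular_boundary z_def 0 chain_boundary_of) 
  next
    case (Suc m)
    let ?d = "chain_boundary q ?\<iota>"
    have step: "prism_step m P'' P'"
      using assms Suc by simp
    have d: "singular_chain m (simplex_space q) ?d"
      using singular_chain_boundary[OF \<iota>] Suc by simp
    have "chain_boundary q (prism m P' ?d) = chain_map m (Pair 1) ?d - chain_map m (Pair 0) ?d"
      using chain_boundary_prism[OF step d] chain_boundary_boundary[OF \<iota>] Suc by simp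
    moreover have "chain_boundary q (chain_map q (Pair t) ?\<iota>) = chain_map m (Pair t) ?d" for t :: real
      using chain_boundary_chain_map[OF \<iota>, of "Pair t"] Suc by simp
    ultimately have "chain_boundary q z = 0"
      by (simp add: z_def chain_boundary_diff Suc)
    moreover have "singular_chain q ?C z"
      unfolding z_def using step d singular_chain_prism[of m P' "simplex_space q" ?d] Suc
      by (intro singular_chain_diff ends) (auto simp: prism_step_def)
    ultimately show ?thesis
      using contractible_space_cycle_bounds[OF contractible_cylinder_simplex, of q q z] Suc by blast
  qed
  moreover have "q > 0 \<longrightarrow> singular_chain q (cylinder (simplex_space (q - 1))) P'"
    using assms by (auto simp: prism_step_def)
  ultimately show ?thesis
    using that by (auto simp: prism_step_def z_def)
qed

lemma prism_exists:
  obtains P where "\<And>q. prism_step q (P (q - 1)) (P q)"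
proof -
  \<comment> \<open>The invariant keeps the equation satisfied by \<open>P n\<close>, for some
    predecessor, because the next degree is built from that equation.\<close>
  have "\<exists>P. \<forall>n. (\<exists>P'. prism_step n P' (P n)) \<and> prism_step (Suc n) (P n) (P (Suc n))"
  proof (rule dependent_nat_choice)
    show "\<exists>x P'. prism_step 0 P' x"
      \<comment> \<open>The boundary of a 0-simplex is zero, so any value can stand for the prism
        below degree 0.\<close>
      using prism_step_exists[of 0 undefined undefined] by blast
    show "\<exists>y. (\<exists>P'. prism_step (Suc n) P' y) \<and> prism_step (Suc n) x y" if "\<exists>P'. prism_step n P' x" for x n
      using that prism_step_exists[of "Suc n" _ x] by (metis diff_Suc_1)
  qed
  then obtain P where P: "\<And>n. (\<exists>P'. prism_step n P' (P n))" "\<And>n. prism_step (Suc n) (P n) (P (Suc n))"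
    by blast
  have "prism_step q (P (q - 1)) (P q)" for q
  proof (cases q)
    case 0
    then show ?thesis
      using P(1)[of 0] by (auto simp: prism_step_def chain_boundary_of)
  next
    case (Suc m)
    then show ?thesis using P(2)[of m] by simp
  qed
  then show ?thesis by (rule that)
qed

text \<open>Pushing the prism forward along the homotopy gives a chain homotopy \<open>D\<close>
  between the two induced chain maps. A cocycle kills the boundary of \<open>D c\<close>, so
  evaluating it on the homotopy formula leaves only its value on \<open>D\<close> of the boundary of
  \<open>c\<close>. The primitive is therefore \<open>F\<close> composed with
  \<open>D\<close>.\<close>

theorem homotopic_imp_cohomologous:
  fixes F :: "((nat \<Rightarrow> real) \<Rightarrow> 'b) \<Rightarrow> 'r::comm_ring_1"
  assumes "homotopic_with (\<lambda>_. True) X Y f g" and F: "cocycle_on n Y F"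
  shows "coboundary_on n X (\<lambda>\<sigma>. F (simplex_map n g \<sigma>) - F (simplex_map n f \<sigma>))"
proof -
  obtain h where h: "continuous_map (cylinder X) Y h" and h01: "\<And>x. h (0, x) = f x" "\<And>x. h (1, x) = g x"
    using assms(1) by (auto simp: homotopic_with_def)
  obtain P where P: "\<And>q. prism_step q (P (q - 1)) (P q)"
    using prism_exists by blast
  have ends: "h \<circ> Pair 0 = f" "h \<circ> Pair 1 = g"
    using h01 by auto
  define D where "D q c = chain_map (Suc q) h (prism q (P q) c)" for q c
  have D: "singular_chain (Suc q) Y (D q c)" 
    "chain_boundary (Suc q) (D q c) = chain_map q g c - chain_map q f c - (if q = 0 then 0 else D (q - 1) (chain_boundary q c))"
    if "singular_chain q X c" for q c
  proof -
    have *: "singular_chain (Suc q) (cylinder X) (prism q (P q) c)"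
      using P[of q] by (intro singular_chain_prism that) (simp add: prism_step_def)
    then show "singular_chain (Suc q) Y (D q c)"
      unfolding D_def by (rule singular_chain_chain_map[OF _ h])
    have "chain_boundary (Suc q) (D q c) = chain_map q h (chain_boundary (Suc q) (prism q (P q) c))"
      using chain_boundary_chain_map[OF *] by (simp add: D_def)
    also have "\<dots> = chain_map q g c - chain_map q f c - chain_map q h (prism (q - 1) (P (q - 1)) (chain_boundary q c))"
      unfolding chain_boundary_prism[OF P that] chain_map_diff
      by (simp add: chain_map_compose flip: ends)
    finally show "chain_boundary (Suc q) (D q c) = chain_map q g c - chain_map q f c - (if q = 0 then 0 else D (q - 1) (chain_boundary q c))"
      by (cases "q = 0") (simp_all add: D_def chain_boundary_def)
  qed
  have D_extend: "D q c = frag_extend (\<lambda>\<sigma>. D q (frag_of \<sigma>)) c" for q c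
    unfolding D_def prism_def chain_map_def frag_extend_def[of _ c]
    by (simp add: frag_extend_sum frag_extend_cmul o_def)
  define G where "G \<tau> = cochain_eval F (D (n - 1) (frag_of \<tau>))" for \<tau>
  have "cochain_eval (\<lambda>\<sigma>. F (simplex_map n g \<sigma>) - F (simplex_map n f \<sigma>)) c = cochain_eval G (chain_boundary n c)"
    if c: "singular_chain n X c" for c
  proof -
    have "cochain_eval F (chain_boundary (Suc n) (D n c)) = 0"
      by (rule cocycle_onD[OF F D(1)[OF c]])
    then have "cochain_eval F (chain_map n g c) - cochain_eval F (chain_map n f c)
        = (if n = 0 then 0 else cochain_eval F (D (n - 1) (chain_boundary n c)))"
      unfolding D(2)[OF c] by (auto simp: cochain_eval_diff split: if_splits)
    also have "cochain_eval F (D (n - 1) (chain_boundary n c)) = cochain_eval G (chain_boundary n c)"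
      by (subst D_extend) (simp add: cochain_eval_frag_extend G_def[abs_def])
    finally show ?thesis
      by (cases "n = 0") (simp_all add: cochain_eval_fun_diff cochain_eval_chain_map chain_boundary_def)
  qed
  then show ?thesis
    by (auto simp: coboundary_by_def)
qed

section \<open>Small simplices\<close>

definition small_simplex :: "'a set set \<Rightarrow> nat \<Rightarrow> 'a topology \<Rightarrow> ((nat \<Rightarrow> real) \<Rightarrow> 'a) \<Rightarrow> bool"
  where "small_simplex \<C> p X \<sigma> \<longleftrightarrow> (\<exists>V\<in>\<C>. singular_simplex p (subtopology X V) \<sigma>)"

definition small_chain :: "'a set set \<Rightarrow> nat \<Rightarrow> 'a topology \<Rightarrow> 'a chain \<Rightarrow> bool"
  where "small_chain \<C> p X c \<longleftrightarrow> Poly_Mapping.keys c \<subseteq> Collect (small_simplex \<C> p X)"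

lemma small_simplex_imp_singular: "small_simplex \<C> p X \<sigma> \<Longrightarrow> singular_simplex p X \<sigma>"
  by (auto simp: small_simplex_def singular_simplex_subtopology)

lemma small_chain_0 [simp]: "small_chain \<C> p X 0"
  by (simp add: small_chain_def)

lemma small_chain_of [simp]: "small_chain \<C> p X (frag_of \<sigma>) \<longleftrightarrow> small_simplex \<C> p X \<sigma>"
  by (simp add: small_chain_def)

lemma small_chain_diff: "small_chain \<C> p X a \<Longrightarrow> small_chain \<C> p X b \<Longrightarrow> small_chain \<C> p X (a - b)"
  unfolding small_chain_def using keys_diff[of a b] by blast

lemma singular_chain_imp_small: "V \<in> \<C> \<Longrightarrow> singular_chain p (subtopology X V) c \<Longrightarrow> small_chain \<C> p X c"
  unfolding small_chain_def singular_chain_def small_simplex_def by blast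

lemma small_chain_induct [consumes 1, case_names zero one diff]:
  assumes "small_chain \<C> p X c" and "P 0" and "\<And>\<sigma>. small_simplex \<C> p X \<sigma> \<Longrightarrow> P (frag_of \<sigma>)"
    and "\<And>a b. P a \<Longrightarrow> P b \<Longrightarrow> P (a - b)"
  shows "P c"
  using assms(1) unfolding small_chain_def
  by (induction c rule: frag_induction) (use assms(2-) in auto)

lemma small_chain_boundary:
  assumes "small_chain \<C> p X c"
  shows "small_chain \<C> (p - 1) X (chain_boundary p c)"
  using assms
proof (induction rule: small_chain_induct)
  case (one \<sigma>)
  then obtain V where "V \<in> \<C>" "singular_chain p (subtopology X V) (frag_of \<sigma>)"
    by (auto simp: small_simplex_def singular_chain_of)
  then show ?case
    using singular_chain_imp_small singular_chain_boundary by fastforce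
qed (simp_all add: chain_boundary_diff small_chain_diff)

text \<open>Enough subdivisions make \<open>z\<close> small. The subdivision homotopy
  \<open>h\<close> respects every space at once, in particular each member of the cover, so it
  preserves small chains. Hence the error term, \<open>h\<close> of the boundary of
  \<open>z\<close>, is small too.\<close>

lemma relative_cycle_homologous_small:
  fixes z :: "'a chain"
  assumes \<C>: "\<And>U. U \<in> \<C> \<Longrightarrow> openin X U" "topspace X \<subseteq> \<Union>\<C>"
    and z: "singular_chain p X z" "small_chain \<C> (p - 1) X (chain_boundary p z)"
  obtains y where "singular_chain (Suc p) X y" "small_chain \<C> p X (z - chain_boundary (Suc p) y)"
proof -
  obtain n where n: "\<And>m f. n \<le> m \<Longrightarrow> f \<in> Poly_Mapping.keys ((singular_subdivision p ^^ m) z)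
      \<Longrightarrow> \<exists>V \<in> \<C>. f \<in> standard_simplex p \<rightarrow> V"
    using sufficient_iterated_singular_subdivision_exists[OF \<C> z(1)] by blast
  let ?S = "(singular_subdivision p ^^ n) z"
  obtain h where h: "\<And>p. h p 0 = (0 :: 'a chain)" "\<And>p c1 c2. h p (c1 - c2) = h p c1 - h p c2"
      "\<And>p X c. singular_chain p X c \<Longrightarrow> singular_chain (Suc p) X (h p c)"
      "\<And>p X c. singular_chain p X c
          \<Longrightarrow> chain_boundary (Suc p) (h p c) + h (p - Suc 0) (chain_boundary p c) = (singular_subdivision p ^^ n) c - c"
    using chain_homotopic_iterated_singular_subdivision[of n] by blast
  have h_small: "small_chain \<C> (Suc q) X (h q c)" if "small_chain \<C> q X c" for q c
    using that
  proof (induction rule: small_chain_induct)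
    case (one \<sigma>)
    then obtain V where "V \<in> \<C>" "singular_chain q (subtopology X V) (frag_of \<sigma>)"
      by (auto simp: small_simplex_def singular_chain_of)
    then show ?case
      using singular_chain_imp_small h(3) by blast
  qed (simp_all add: h small_chain_diff)
  have "singular_chain p X ?S"
    by (induction n) (simp_all add: z(1) singular_chain_singular_subdivision)
  then have "small_simplex \<C> p X f" if "f \<in> Poly_Mapping.keys ?S" for f
    using n[OF order_refl that] that
    unfolding small_simplex_def singular_chain_def singular_simplex_subtopology by blast
  then have "small_chain \<C> p X ?S"
    by (auto simp: small_chain_def)
  moreover have "small_chain \<C> p X (h (p - Suc 0) (chain_boundary p z))"
  proof (cases p)
    case 0
    then show ?thesis by (simp add: chain_boundary_def h)
  next
    case (Suc m)
    then show ?thesis using h_small[OF z(2)] by simp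
  qed
  ultimately have "small_chain \<C> p X (?S - h (p - Suc 0) (chain_boundary p z))"
    by (rule small_chain_diff)
  also have "?S - h (p - Suc 0) (chain_boundary p z) = z - chain_boundary (Suc p) (- h p z)"
    using h(4)[OF z(1)] by (simp add: chain_boundary_minus algebra_simps)
  finally show ?thesis
    using that[of "- h p z"] h(3)[OF z(1)] by (simp add: singular_chain_minus)
qed

text \<open>\<open>\<lambda>c. c - \<partial> (D p c) - D (p - 1) (\<partial> c)\<close> is a chain map onto the small chains and fixes them.
  Only degrees \<open>p - 1\<close> and \<open>p\<close> occur, which allows \<open>D\<close> to be built one degree at a time.\<close>

definition small_step ::
    "'a set set \<Rightarrow> 'a topology \<Rightarrow> nat \<Rightarrow> (((nat \<Rightarrow> real) \<Rightarrow> 'a) \<Rightarrow> 'a chain) \<Rightarrow> (((nat \<Rightarrow> real) \<Rightarrow> 'a) \<Rightarrow> 'a chain) \<Rightarrow> bool"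
  where "small_step \<C> X p D' D \<longleftrightarrow>
    (\<forall>\<sigma>. singular_simplex p X \<sigma> \<longrightarrow> singular_chain (Suc p) X (D \<sigma>) \<and>
      (small_simplex \<C> p X \<sigma> \<longrightarrow> D \<sigma> = 0) \<and>
      small_chain \<C> p X (frag_of \<sigma> - chain_boundary (Suc p) (D \<sigma>) - frag_extend D' (chain_boundary p (frag_of \<sigma>))))"

lemma small_step_chain:
  assumes D: "small_step \<C> X p D' D" and c: "singular_chain p X c"
  shows "singular_chain (Suc p) X (frag_extend D c)"
    and "small_chain \<C> p X (c - chain_boundary (Suc p) (frag_extend D c) - frag_extend D' (chain_boundary p c))"
proof -
  show "singular_chain (Suc p) X (frag_extend D c)"
    using c D by (intro singular_chain_extend) (auto simp: small_step_def singular_chain_def)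
  show "small_chain \<C> p X (c - chain_boundary (Suc p) (frag_extend D c) - frag_extend D' (chain_boundary p c))"
    using c unfolding singular_chain_def
  proof (induction c rule: frag_induction)
    case (one \<sigma>)
    then show ?case using D by (simp add: small_step_def)
  next
    case (diff a b)
    have eq: "(a - b) - (a' - b') - (a'' - b'') = (a - a' - a'') - (b - b' - b'')" for a' b' a'' b''
      by simp
    show ?case
      unfolding frag_extend_diff chain_boundary_diff eq by (rule small_chain_diff) fact+
  qed simp
qed

lemma small_step_small:
  assumes D: "small_step \<C> X p D' D" and "small_chain \<C> p X c"
  shows "frag_extend D c = 0"
  using assms(2) D
  by (intro frag_extend_eq_0) (auto simp: small_chain_def small_step_def small_simplex_imp_singular)

text \<open>On a small simplex the value 0 is consistent, since the boundary is small and
  \<open>D'\<close> vanishes on it. For any other simplex, subtracting \<open>D'\<close> of its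
  boundary gives a chain \<open>z\<close> whose boundary is small, by the property of
  \<open>D'\<close>. Such a relative cycle is homologous to a small chain, and the homology is the
  value of \<open>D\<close>.\<close>

lemma small_step_exists:
  fixes X :: "'a topology"
  assumes \<C>: "\<And>U. U \<in> \<C> \<Longrightarrow> openin X U" "topspace X \<subseteq> \<Union>\<C>"
    and D': "p > 0 \<Longrightarrow> small_step \<C> X (p - 1) D'' D'"
  obtains D where "small_step \<C> X p D' D"
proof -
  have "\<exists>y. singular_chain (Suc p) X y \<and> (small_simplex \<C> p X \<sigma> \<longrightarrow> y = 0) \<and>
      small_chain \<C> p X (frag_of \<sigma> - chain_boundary (Suc p) y - frag_extend D' (chain_boundary p (frag_of \<sigma>)))"
    if \<sigma>: "singular_simplex p X \<sigma>" for \<sigma>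
  proof (cases "small_simplex \<C> p X \<sigma>")
    case True
    have "frag_extend D' (chain_boundary p (frag_of \<sigma>)) = 0"
    proof (cases p)
      case (Suc m)
      then show ?thesis
        using True D' small_chain_boundary[of \<C> p X "frag_of \<sigma>"] by (intro small_step_small) auto
    qed (simp add: chain_boundary_of)
    then show ?thesis
      using True by (intro exI[of _ 0]) simp
  next
    case False
    define d where "d = chain_boundary p (frag_of \<sigma>)"
    define z where "z = frag_of \<sigma> - frag_extend D' d"
    have d: "singular_chain (p - 1) X d"
      using singular_chain_boundary[of p X "frag_of \<sigma>"] \<sigma> by (simp add: d_def singular_chain_of)
    have "singular_chain p X z \<and> small_chain \<C> (p - 1) X (chain_boundary p z)"
    proof (cases p)
      case 0
      then show ?thesis
        using \<sigma> by (simp add: z_def d_def chain_boundary_def singular_chain_of)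
    next
      case (Suc m)
      then have step: "small_step \<C> X m D'' D'" using D' by simp
      have "chain_boundary m d = 0"
        using chain_boundary_boundary[of p X "frag_of \<sigma>"] \<sigma> Suc by (simp add: d_def singular_chain_of)
      then have "small_chain \<C> m X (chain_boundary p z)"
        using small_step_chain(2)[OF step, of d] d Suc by (simp add: z_def chain_boundary_diff d_def)
      moreover have "singular_chain p X z"
        using small_step_chain(1)[OF step, of d] d \<sigma> Suc
        by (simp add: z_def singular_chain_diff singular_chain_of)
      ultimately show ?thesis
        using Suc by simp
    qed
    then obtain y where "singular_chain (Suc p) X y" "small_chain \<C> p X (z - chain_boundary (Suc p) y)"
      using relative_cycle_homologous_small[OF \<C>] by blast
    moreover have "z - chain_boundary (Suc p) y = frag_of \<sigma> - chain_boundary (Suc p) y - frag_extend D' d"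
      by (simp add: z_def)
    ultimately show ?thesis
      using False by (auto simp: d_def)
  qed
  then obtain D where "\<And>\<sigma>. singular_simplex p X \<sigma> \<Longrightarrow> singular_chain (Suc p) X (D \<sigma>) \<and> (small_simplex \<C> p X \<sigma> \<longrightarrow> D \<sigma> = 0) \<and>
      small_chain \<C> p X (frag_of \<sigma> - chain_boundary (Suc p) (D \<sigma>) - frag_extend D' (chain_boundary p (frag_of \<sigma>)))"
    by metis
  then show ?thesis
    using that by (auto simp: small_step_def)
qed

lemma small_steps_exist:
  fixes X :: "'a topology"
  assumes \<C>: "\<And>U. U \<in> \<C> \<Longrightarrow> openin X U" "topspace X \<subseteq> \<Union>\<C>"
  obtains D where "\<And>p. small_step \<C> X p (D (p - 1)) (D p)"
proof -
  have "\<exists>D. \<forall>n. (\<exists>D'. small_step \<C> X n D' (D n)) \<and> small_step \<C> X (Suc n) (D n) (D (Suc n))"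
  proof (rule dependent_nat_choice)
    show "\<exists>x D'. small_step \<C> X 0 D' x"
      using small_step_exists[OF \<C>, of 0 undefined undefined] by blast
    show "\<exists>y. (\<exists>D'. small_step \<C> X (Suc n) D' y) \<and> small_step \<C> X (Suc n) x y" if "\<exists>D'. small_step \<C> X n D' x" for x n
      using that small_step_exists[OF \<C>, of "Suc n" _ x] by (metis diff_Suc_1)
  qed
  then obtain D where D: "\<And>n. (\<exists>D'. small_step \<C> X n D' (D n))" "\<And>n. small_step \<C> X (Suc n) (D n) (D (Suc n))"
    by blast
  have "small_step \<C> X p (D (p - 1)) (D p)" for p
  proof (cases p)
    case 0
    then show ?thesis
      using D(1)[of 0] by (auto simp: small_step_def chain_boundary_of)
  next
    case (Suc m)
    then show ?thesis using D(2)[of m] by simp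
  qed
  then show ?thesis by (rule that)
qed

lemma cochain_eval_small_chain:
  assumes "small_chain \<C> n X c" "\<And>\<sigma>. small_simplex \<C> n X \<sigma> \<Longrightarrow> f \<sigma> = g \<sigma>"
  shows "cochain_eval f c = cochain_eval g c"
  unfolding cochain_eval_def
  by (rule sum.cong) (use assms in \<open>auto simp: small_chain_def\<close>)

text \<open>Each chain is the sum of a small chain, the boundary of its image under
  \<open>D\<close>, and \<open>D\<close> of its boundary. The cocycle vanishes on the first two
  parts, so \<open>f\<close> composed with \<open>D\<close> is a primitive.\<close>

theorem cocycle_vanishing_on_small_simplices:
  assumes \<C>: "\<And>U. U \<in> \<C> \<Longrightarrow> openin X U" "topspace X \<subseteq> \<Union>\<C>"
    and f: "cocycle_on n X f" "\<And>\<sigma>. small_simplex \<C> n X \<sigma> \<Longrightarrow> f \<sigma> = 0"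
  shows "coboundary_on n X f"
proof -
  obtain D where D: "\<And>p. small_step \<C> X p (D (p - 1)) (D p)"
    using small_steps_exist[OF \<C>] by blast
  have "cochain_eval f c = cochain_eval (\<lambda>\<tau>. cochain_eval f (D (n - 1) \<tau>)) (chain_boundary n c)"
    if c: "singular_chain n X c" for c
  proof -
    have "cochain_eval f (c - chain_boundary (Suc n) (frag_extend (D n) c) - frag_extend (D (n - 1)) (chain_boundary n c)) = cochain_eval (\<lambda>\<sigma>. 0) (c - chain_boundary (Suc n) (frag_extend (D n) c) - frag_extend (D (n - 1)) (chain_boundary n c))"
      using small_step_chain(2)[OF D c] f(2) by (rule cochain_eval_small_chain)
    then show ?thesis
      using cocycle_onD[OF f(1) small_step_chain(1)[OF D c]]
      by (simp add: cochain_eval_diff cochain_eval_frag_extend)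
  qed
  then show ?thesis
    by (auto simp: coboundary_by_def)
qed

text \<open>The extension is \<open>f\<close> composed with the chain map \<rho> onto small chains.
  It is a cocycle because \<rho> commutes with the boundary and \<open>f\<close> kills boundaries of
  small chains; it extends \<open>f\<close> because \<rho> fixes small simplices.\<close>

theorem cocycle_extend_from_small_simplices:
  assumes \<C>: "\<And>U. U \<in> \<C> \<Longrightarrow> openin X U" "topspace X \<subseteq> \<Union>\<C>"
    and f: "\<And>\<sigma>. small_simplex \<C> (Suc n) X \<sigma> \<Longrightarrow> cochain_eval f (chain_boundary (Suc n) (frag_of \<sigma>)) = 0"
  obtains g where "cocycle_on n X g" "\<And>\<sigma>. small_simplex \<C> n X \<sigma> \<Longrightarrow> g \<sigma> = f \<sigma>"
proof -
  obtain D where D: "\<And>p. small_step \<C> X p (D (p - 1)) (D p)"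
    using small_steps_exist[OF \<C>] by blast
  define \<rho> where "\<rho> p c = c - chain_boundary (Suc p) (frag_extend (D p) c) - frag_extend (D (p - 1)) (chain_boundary p c)" for p c
  define g where "g \<sigma> = cochain_eval f (\<rho> n (frag_of \<sigma>))" for \<sigma>
  have \<rho>_diff: "\<rho> p (a - b) = \<rho> p a - \<rho> p b" for p a b
    by (simp add: \<rho>_def frag_extend_diff chain_boundary_diff)
  have \<rho>_0: "\<rho> p 0 = 0" for p
    by (simp add: \<rho>_def)
  have \<rho>_extend: "\<rho> p c = frag_extend (\<lambda>\<sigma>. \<rho> p (frag_of \<sigma>)) c" for p c
    using subset_UNIV[of "Poly_Mapping.keys c"]
    by (induction c rule: frag_induction) (simp_all add: \<rho>_0 \<rho>_diff frag_extend_diff)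
  have "cochain_eval g c = cochain_eval f (\<rho> n c)" for c
    by (subst \<rho>_extend) (simp add: cochain_eval_frag_extend g_def[abs_def])
  moreover have "\<rho> n (chain_boundary (Suc n) c) = chain_boundary (Suc n) (\<rho> (Suc n) c)" if c: "singular_chain (Suc n) X c" for c
  proof -
    have "chain_boundary n (chain_boundary (Suc n) c) = 0"
      "chain_boundary (Suc n) (chain_boundary (Suc (Suc n)) (frag_extend (D (Suc n)) c)) = 0"
      using chain_boundary_boundary[OF c] chain_boundary_boundary[OF small_step_chain(1)[OF D c]] by simp_all
    then show ?thesis
      by (simp add: \<rho>_def chain_boundary_diff)
  qed
  moreover have "cochain_eval f (chain_boundary (Suc n) c) = 0" if "small_chain \<C> (Suc n) X c" for c
    using that by (induction rule: small_chain_induct) (simp_all add: f chain_boundary_diff cochain_eval_diff)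
  moreover have "small_chain \<C> p X (\<rho> p c)" if "singular_chain p X c" for p c
    unfolding \<rho>_def by (rule small_step_chain(2)[OF D that])
  ultimately have "cocycle_on n X g"
    by (simp add: cocycle_on_def)
  moreover have "g \<sigma> = f \<sigma>" if \<sigma>: "small_simplex \<C> n X \<sigma>" for \<sigma>
  proof -
    have "frag_extend (D n) (frag_of \<sigma>) = 0"
      using small_step_small[OF D, of n "frag_of \<sigma>"] \<sigma> by simp
    moreover have "frag_extend (D (n - 1)) (chain_boundary n (frag_of \<sigma>)) = 0"
      using small_step_small[OF D small_chain_boundary[of \<C> n X "frag_of \<sigma>"]] \<sigma> by simp
    ultimately have "\<rho> n (frag_of \<sigma>) = frag_of \<sigma>"
      by (simp add: \<rho>_def)
    then show ?thesis
      by (simp add: g_def)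
  qed
  ultimately show ?thesis by (rule that)
qed

section \<open>Multiplication by the class of a sphere\<close>

lemma pullback_compose: "f (simplex_map n \<phi> (simplex_map n \<psi> \<sigma>)) = f (simplex_map n (\<phi> \<circ> \<psi>) \<sigma>)"
  by (simp add: simplex_map_compose)

lemma homotopic_prod_contractible:
  assumes "contractible_space Y" "y \<in> topspace Y"
  shows "homotopic_with (\<lambda>_. True) (prod_topology X Y) (prod_topology X Y) id (\<lambda>z. (fst z, y))"
proof -
  have "homotopic_with (\<lambda>_. True) Y Y id (\<lambda>_. y)"
    using assms by (auto simp: contractible_space_alt)
  then obtain h where h: "continuous_map (prod_topology (top_of_set {0..1::real}) Y) Y h"
      and h01: "\<And>x. h (0, x) = x" "\<And>x. h (1, x) = y"
    by (auto simp: homotopic_with_def)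
  let ?Z = "prod_topology (top_of_set {0..1::real}) (prod_topology X Y)"
  have 1: "continuous_map ?Z X (\<lambda>z. fst (snd z))"
    using continuous_map_compose[OF continuous_map_snd continuous_map_fst] by (simp add: o_def)
  have "continuous_map ?Z Y (\<lambda>z. snd (snd z))"
    using continuous_map_compose[OF continuous_map_snd continuous_map_snd] by (simp add: o_def)
  then have "continuous_map ?Z (prod_topology (top_of_set {0..1::real}) Y) (\<lambda>z. (fst z, snd (snd z)))"
    by (simp add: continuous_map_pairwise o_def continuous_map_fst)
  then have 2: "continuous_map ?Z Y (\<lambda>z. h (fst z, snd (snd z)))"
    using continuous_map_compose[OF _ h] by (fastforce simp: o_def)
  from 1 2 have "continuous_map ?Z (prod_topology X Y) (\<lambda>z. (fst (snd z), h (fst z, snd (snd z))))"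
    by (simp add: continuous_map_pairwise o_def)
  then show ?thesis
    unfolding homotopic_with_def
    by (intro exI[of _ "\<lambda>z. (fst (snd z), h (fst z, snd (snd z)))"]) (simp add: h01)
qed

text \<open>The cocycle \<open>u0\<close> is the restriction of \<open>u\<close> to the slice over
  \<open>y\<close>. Projection onto the slice is homotopic to the identity, so pulling
  \<open>u0\<close> back recovers the class of \<open>u\<close>.\<close>

lemma cocycle_on_prod_contractible:
  assumes "contractible_space Y" "y \<in> topspace Y" and u: "cocycle_on n (prod_topology X Y) u"
  obtains u0 where "cocycle_on n X u0" "coboundary_on n (prod_topology X Y) (\<lambda>\<sigma>. u0 (simplex_map n fst \<sigma>) - u \<sigma>)"
proof
  show "cocycle_on n X (\<lambda>\<tau>. u (simplex_map n (\<lambda>x. (x, y)) \<tau>))"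
    using assms(2) by (intro cocycle_on_pullback[OF _ u]) (simp add: continuous_map_pairwise o_def)
  have "\<exists>g. coboundary_by n (prod_topology X Y) (\<lambda>\<sigma>. u (simplex_map n (\<lambda>z. (fst z, y)) \<sigma>) - u (simplex_map n id \<sigma>)) g"
    by (rule homotopic_imp_cohomologous[OF homotopic_prod_contractible[OF assms(1,2)] u])
  moreover have "coboundary_by n (prod_topology X Y) (\<lambda>\<sigma>. u (simplex_map n (\<lambda>z. (fst z, y)) \<sigma>) - u (simplex_map n id \<sigma>)) g
    \<longleftrightarrow> coboundary_by n (prod_topology X Y) (\<lambda>\<sigma>. u (simplex_map n (\<lambda>x. (x, y)) (simplex_map n fst \<sigma>)) - u \<sigma>) g" for g
  proof (rule coboundary_by_cong)
    fix \<sigma> assume "singular_simplex n (prod_topology X Y) \<sigma>"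
    then have "simplex_map n id \<sigma> = \<sigma>"
      by (rule simplex_map_id_gen) simp
    then show "u (simplex_map n (\<lambda>z. (fst z, y)) \<sigma>) - u (simplex_map n id \<sigma>)
        = u (simplex_map n (\<lambda>x. (x, y)) (simplex_map n fst \<sigma>)) - u \<sigma>"
      by (simp add: pullback_compose o_def)
  qed
  ultimately show "coboundary_on n (prod_topology X Y) (\<lambda>\<sigma>. u (simplex_map n (\<lambda>x. (x, y)) (simplex_map n fst \<sigma>)) - u \<sigma>)"
    by simp
qed

lemma coboundary_by_unique:
  assumes "coboundary_by (Suc n) X f g" "coboundary_by (Suc n) X f h"
  shows "cocycle_on n X (\<lambda>\<sigma>. g \<sigma> - h \<sigma>)"
  using assms by (simp add: cocycle_on_def coboundary_by_def cochain_eval_fun_diff)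

text \<open>The class \<open>w\<close> is there for the induction, which starts at the disconnected space \<open>S\<^sup>0\<close>: a
  cocycle of degree 0 on \<open>S\<^sup>0\<close> matters only modulo constants.\<close>

definition mult_injective :: "'a topology \<Rightarrow> nat \<Rightarrow> 'b topology \<Rightarrow> (((nat \<Rightarrow> real) \<Rightarrow> 'b) \<Rightarrow> 'r::comm_ring_1) \<Rightarrow> bool"
  where "mult_injective X m Y s \<longleftrightarrow>
    (\<forall>n \<beta> w. cocycle_on n X \<beta> \<longrightarrow> cocycle_on (m + n) X w \<longrightarrow>
      coboundary_on (m + n) (prod_topology X Y)
        (\<lambda>\<sigma>. cup m n (\<lambda>\<sigma>. s (simplex_map m snd \<sigma>)) (\<lambda>\<sigma>. \<beta> (simplex_map n fst \<sigma>)) \<sigma> - w (simplex_map (m + n) fst \<sigma>)) \<longrightarrow>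
      coboundary_on n X \<beta>)"

lemma mult_injective_cong:
  fixes X :: "'a topology" and s s' :: "((nat \<Rightarrow> real) \<Rightarrow> 'b) \<Rightarrow> 'r::comm_ring_1"
  assumes "\<And>\<tau>. singular_simplex m Y \<tau> \<Longrightarrow> s \<tau> = s' \<tau>" and s': "mult_injective X m Y s'"
  shows "mult_injective X m Y s"
  unfolding mult_injective_def
proof (intro allI impI)
  fix n and \<beta> w :: "((nat \<Rightarrow> real) \<Rightarrow> 'a) \<Rightarrow> 'r"
  let ?c = "\<lambda>s \<sigma>. cup m n (\<lambda>\<sigma>. s (simplex_map m snd \<sigma>)) (\<lambda>\<sigma>. \<beta> (simplex_map n fst \<sigma>)) \<sigma> - w (simplex_map (m + n) fst \<sigma>)"
  assume \<beta>: "cocycle_on n X \<beta>" "cocycle_on (m + n) X w" and c: "coboundary_on (m + n) (prod_topology X Y) (?c s)"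
  have "?c s \<sigma> = ?c s' \<sigma>" if "singular_simplex (m + n) (prod_topology X Y) \<sigma>" for \<sigma>
    using assms(1)[OF singular_simplex_simplex_map[OF singular_simplex_front_face[OF that] continuous_map_snd]]
    by (simp add: cup_def)
  then have "coboundary_by (m + n) (prod_topology X Y) (?c s) g \<longleftrightarrow> coboundary_by (m + n) (prod_topology X Y) (?c s') g" for g
    by (rule coboundary_by_cong)
  with c have "coboundary_on (m + n) (prod_topology X Y) (?c s')"
    by simp
  with \<beta> s' show "coboundary_on n X \<beta>"
    unfolding mult_injective_def by blast
qed

text \<open>The Mayer-Vietoris argument. The product of \<open>s\<close> and \<beta> is the
  coboundary of the product of \<open>a\<close> and \<beta> over \<open>A\<close>, and zero over
  \<open>B\<close>. If it is cohomologous to \<open>w\<close> by a primitive \<gamma>, then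
  \<open>w\<close> gets one primitive over \<open>A\<close> and another over \<open>B\<close>. After
  correction by a primitive of \<open>w\<close> on \<open>X\<close> both become cocycles, hence
  cohomologous to cocycles \<open>u0\<close> and \<open>v0\<close> pulled back from
  \<open>X\<close>. On the overlap the product of \<open>a\<close> and \<beta> is thus cohomologous
  to a class from \<open>X\<close>, which is the situation of \<open>mult_injective\<close> one
  degree lower.\<close>

lemma mult_injective_suspension:
  fixes s a :: "((nat \<Rightarrow> real) \<Rightarrow> 'b) \<Rightarrow> 'r::comm_ring_1" and X :: "'a topology" and Y' :: "'c topology"
  assumes A: "contractible_space (subtopology Y A)" "yA \<in> topspace Y \<inter> A" "coboundary_by (Suc m) (subtopology Y A) s a"
    and B: "contractible_space (subtopology Y B)" "yB \<in> topspace Y \<inter> B" "\<And>\<sigma>. singular_simplex (Suc m) (subtopology Y B) \<sigma> \<Longrightarrow> s \<sigma> = 0"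
    and \<phi>: "continuous_map Y' (subtopology Y (A \<inter> B)) \<phi>" "mult_injective X m Y' (\<lambda>\<sigma>. a (simplex_map m \<phi> \<sigma>))"
  shows "mult_injective X (Suc m) Y s"
  unfolding mult_injective_def
proof (intro allI impI)
  fix n and \<beta> w :: "((nat \<Rightarrow> real) \<Rightarrow> 'a) \<Rightarrow> 'r"
  assume \<beta>: "cocycle_on n X \<beta>" and w: "cocycle_on (Suc m + n) X w"
  let ?Z = "\<lambda>S. prod_topology X (subtopology Y S)"
  let ?N = "Suc (m + n)"
  let ?s\<beta> = "cup (Suc m) n (\<lambda>\<sigma>. s (simplex_map (Suc m) snd \<sigma>)) (\<lambda>\<sigma>. \<beta> (simplex_map n fst \<sigma>))"
  let ?a\<beta> = "cup m n (\<lambda>\<sigma>. a (simplex_map m snd \<sigma>)) (\<lambda>\<sigma>. \<beta> (simplex_map n fst \<sigma>))"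
  let ?w = "\<lambda>\<sigma>. w (simplex_map ?N fst \<sigma>)"
  assume "coboundary_on (Suc m + n) (prod_topology X Y) (\<lambda>\<sigma>. ?s\<beta> \<sigma> - w (simplex_map (Suc m + n) fst \<sigma>))"
  then obtain \<gamma> where "coboundary_by ?N (prod_topology X Y) (\<lambda>\<sigma>. ?s\<beta> \<sigma> - ?w \<sigma>) \<gamma>"
    by auto
  then have \<gamma>: "coboundary_by ?N (?Z S) (\<lambda>\<sigma>. ?s\<beta> \<sigma> - ?w \<sigma>) \<gamma>" for S
    by (simp add: prod_topology_subtopology(2) coboundary_by_subtopology)
  have \<beta>': "cocycle_on n (?Z S) (\<lambda>\<sigma>. \<beta> (simplex_map n fst \<sigma>))" for S
    by (rule cocycle_on_pullback[OF continuous_map_fst \<beta>])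
  have "coboundary_by ?N (?Z A) ?s\<beta> ?a\<beta>"
    using cup_Leibniz_right_cocycle[OF \<beta>' coboundary_by_pullback[OF continuous_map_snd A(3)]] by simp
  from coboundary_by_diff[OF this \<gamma>]
  have wA: "coboundary_by ?N (?Z A) ?w (\<lambda>\<sigma>. ?a\<beta> \<sigma> - \<gamma> \<sigma>)"
    by simp
  have "?s\<beta> \<sigma> = 0" if "singular_simplex ?N (?Z B) \<sigma>" for \<sigma>
  proof -
    have "singular_simplex (Suc m) (subtopology Y B) (simplex_map (Suc m) snd (front_face (Suc m) \<sigma>))"
      by (intro singular_simplex_simplex_map[OF singular_simplex_front_face[OF that]] continuous_map_snd) simp
    then show ?thesis by (simp add: cup_def B(3))
  qed
  then have "coboundary_by ?N (?Z B) ?s\<beta> (\<lambda>_. 0)"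
    by (simp add: coboundary_by_iff_simplex)
  from coboundary_by_diff[OF this \<gamma>]
  have wB: "coboundary_by ?N (?Z B) ?w (\<lambda>\<sigma>. 0 - \<gamma> \<sigma>)"
    by simp
  \<comment> \<open>Restricting to the slice over \<open>yA\<close> shows that \<open>w\<close>
    already bounds on \<open>X\<close>. Its primitive \<open>w0\<close> pulls back to both pieces,
    whereas the primitives \<open>wA\<close> and \<open>wB\<close> are tied to one piece
    each.\<close>
  define w0 where "w0 = (\<lambda>\<tau>. ?a\<beta> (simplex_map (m + n) (\<lambda>x. (x, yA)) \<tau>) - \<gamma> (simplex_map (m + n) (\<lambda>x. (x, yA)) \<tau>))"
  have "continuous_map X (?Z A) (\<lambda>x. (x, yA))"
    using A(2) by (auto simp: continuous_map_pairwise o_def)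
  from coboundary_by_pullback[OF this wA]
  have w_section: "coboundary_by ?N X (\<lambda>\<sigma>. ?w (simplex_map ?N (\<lambda>x. (x, yA)) \<sigma>)) w0"
    by (simp add: w0_def)
  have "?w (simplex_map ?N (\<lambda>x. (x, yA)) \<sigma>) = w \<sigma>" if "singular_simplex ?N X \<sigma>" for \<sigma>
    using simplex_map_id_gen[OF that, of id] by (simp add: pullback_compose o_def id_def)
  then have "coboundary_by ?N X (\<lambda>\<sigma>. ?w (simplex_map ?N (\<lambda>x. (x, yA)) \<sigma>)) w0 \<longleftrightarrow> coboundary_by ?N X w w0"
    by (rule coboundary_by_cong)
  with w_section have "coboundary_by ?N X w w0"
    by simp
  from coboundary_by_pullback[OF continuous_map_fst this]
  have w0: "coboundary_by ?N (?Z S) ?w (\<lambda>\<sigma>. w0 (simplex_map (m + n) fst \<sigma>))" for S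
    by simp
  define u where "u = (\<lambda>\<sigma>. (?a\<beta> \<sigma> - \<gamma> \<sigma>) - w0 (simplex_map (m + n) fst \<sigma>))"
  define v where "v = (\<lambda>\<sigma>. (0 - \<gamma> \<sigma>) - w0 (simplex_map (m + n) fst \<sigma>))"
  have "yA \<in> topspace (subtopology Y A)" "cocycle_on (m + n) (?Z A) u"
    using A(2) coboundary_by_unique[OF wA w0] by (simp_all add: u_def)
  then obtain u0 where u0: "cocycle_on (m + n) X u0" "coboundary_on (m + n) (?Z A) (\<lambda>\<sigma>. u0 (simplex_map (m + n) fst \<sigma>) - u \<sigma>)"
    by (rule cocycle_on_prod_contractible[OF A(1)])
  have "yB \<in> topspace (subtopology Y B)" "cocycle_on (m + n) (?Z B) v"
    using B(2) coboundary_by_unique[OF wB w0] by (simp_all add: v_def)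
  then obtain v0 where v0: "cocycle_on (m + n) X v0" "coboundary_on (m + n) (?Z B) (\<lambda>\<sigma>. v0 (simplex_map (m + n) fst \<sigma>) - v \<sigma>)"
    by (rule cocycle_on_prod_contractible[OF B(1)])
  have restrict: "coboundary_on (m + n) (?Z (A \<inter> B)) f" if "coboundary_on (m + n) (?Z S) f" "A \<inter> B \<subseteq> S" for f S
  proof -
    have "?Z (A \<inter> B) = subtopology (?Z S) (topspace X \<times> (A \<inter> B))"
      using that(2) by (simp add: prod_topology_subtopology(2) subtopology_subtopology inf.absorb2 Times_Int_Times)
    then show ?thesis
      using that(1) coboundary_by_subtopology[of "m + n" "?Z S" f] by auto
  qed
  obtain p where p: "coboundary_by (m + n) (?Z (A \<inter> B)) (\<lambda>\<sigma>. u0 (simplex_map (m + n) fst \<sigma>) - u \<sigma>) p"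
    using restrict[OF u0(2)] by auto
  obtain q where q: "coboundary_by (m + n) (?Z (A \<inter> B)) (\<lambda>\<sigma>. v0 (simplex_map (m + n) fst \<sigma>) - v \<sigma>) q"
    using restrict[OF v0(2)] by auto
  \<comment> \<open>In u - v both \<gamma> and \<open>w0\<close> cancel, and exactly the product of
    \<open>a\<close> and \<beta> remains. The class u0 - v0 takes over the role of
    \<open>w\<close>.\<close>
  let ?d = "\<lambda>\<sigma>. ?a\<beta> \<sigma> - (u0 (simplex_map (m + n) fst \<sigma>) - v0 (simplex_map (m + n) fst \<sigma>))"
  have "(\<lambda>\<sigma>. (v0 (simplex_map (m + n) fst \<sigma>) - v \<sigma>) - (u0 (simplex_map (m + n) fst \<sigma>) - u \<sigma>)) = ?d"
    by (auto simp: u_def v_def)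
  then have d: "coboundary_by (m + n) (?Z (A \<inter> B)) ?d (\<lambda>\<sigma>. q \<sigma> - p \<sigma>)"
    using coboundary_by_diff[OF q p] by simp
  have "continuous_map (prod_topology X Y') (?Z (A \<inter> B)) (map_prod id \<phi>)"
    using \<phi>(1) unfolding map_prod_def by (auto simp: continuous_map_prod_top)
  from coboundary_by_pullback[OF this d]
  have "coboundary_on (m + n) (prod_topology X Y') (\<lambda>\<sigma>. ?d (simplex_map (m + n) (map_prod id \<phi>) \<sigma>))"
    by blast
  moreover have "?a\<beta> (simplex_map (m + n) (map_prod id \<phi>) \<sigma>)
      = cup m n (\<lambda>\<sigma>. a (simplex_map m \<phi> (simplex_map m snd \<sigma>))) (\<lambda>\<sigma>. \<beta> (simplex_map n fst \<sigma>)) \<sigma>" for \<sigma>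
    by (simp add: pullback_compose o_def flip: cup_pullback)
  moreover have "simplex_map (m + n) fst (simplex_map (m + n) (map_prod id \<phi>) \<sigma>) = simplex_map (m + n) fst \<sigma>" for \<sigma> :: "(nat \<Rightarrow> real) \<Rightarrow> 'a \<times> 'c"
    by (simp add: pullback_compose[of "\<lambda>x. x"] o_def)
  ultimately have "coboundary_on (m + n) (prod_topology X Y') (\<lambda>\<sigma>.
      cup m n (\<lambda>\<sigma>. a (simplex_map m \<phi> (simplex_map m snd \<sigma>))) (\<lambda>\<sigma>. \<beta> (simplex_map n fst \<sigma>)) \<sigma>
      - (\<lambda>\<sigma>. u0 \<sigma> - v0 \<sigma>) (simplex_map (m + n) fst \<sigma>))"
    by simp
  then show "coboundary_on n X \<beta>"
    using \<phi>(2)[unfolded mult_injective_def, rule_format, OF \<beta> cocycle_on_diff[OF u0(1) v0(1)]] by blast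
qed

section \<open>Spheres\<close>

lemma topspace_nsphere_iff: "x \<in> topspace (nsphere k) \<longleftrightarrow> (\<Sum>i\<le>k. (x i)\<^sup>2) = 1 \<and> (\<forall>i>k. x i = 0)"
  by (simp add: nsphere)

definition pole :: "nat \<Rightarrow> real \<Rightarrow> nat \<Rightarrow> real"
  where "pole k s i = (if i = k then s else 0)"

lemma pole_in_nsphere: "s\<^sup>2 = 1 \<Longrightarrow> pole k s \<in> topspace (nsphere k)"
  by (simp add: topspace_nsphere_iff pole_def if_distrib[of "\<lambda>x. x\<^sup>2"] cong: if_cong)

lemma sphere_coordinate_le_1:
  assumes "x \<in> topspace (nsphere k)" "i \<le> k"
  shows "(x i)\<^sup>2 \<le> 1"
  using assms member_le_sum[of i "{..k}" "\<lambda>i. (x i)\<^sup>2"] by (simp add: topspace_nsphere_iff)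

text \<open>The set is the sphere without the antipode of \<open>pole k s\<close>. The contraction
  moves along the segment to that pole and divides by the norm \<open>N\<close>. It must be checked
  that the norm is never zero and that the path avoids the antipode.\<close>

lemma contractible_punctured_sphere:
  assumes s: "s\<^sup>2 = (1::real)"
  shows "contractible_space (subtopology (nsphere k) {x. s * x k > -1})"
proof -
  define S where "S = subtopology (nsphere k) {x. s * x k > -1}"
  let ?T = "prod_topology (top_of_set {0..1::real}) S"
  define c where "c z i = (1 - fst z) * snd z i + fst z * pole k s i" for z :: "real \<times> (nat \<Rightarrow> real)" and i
  define N where "N z = sqrt (\<Sum>i\<le>k. (c z i)\<^sup>2)" for z
  define h where "h z i = c z i / N z" for z i
  have ss: "s * s = 1" using s by (simp add: power2_eq_square)
  have N2: "(\<Sum>i\<le>k. (c (t, x) i)\<^sup>2) = (1 - t)\<^sup>2 + 2 * t * (1 - t) * (s * x k) + t\<^sup>2"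
    if "x \<in> topspace (nsphere k)" for t x
  proof -
    have "(c (t, x) i)\<^sup>2 = (1 - t)\<^sup>2 * (x i)\<^sup>2 + (if i = k then 2 * t * (1 - t) * (s * x k) + t\<^sup>2 else 0)" for i
      using ss by (auto simp: c_def pole_def power2_eq_square algebra_simps)
    then have "(\<Sum>i\<le>k. (c (t, x) i)\<^sup>2) = (1 - t)\<^sup>2 * (\<Sum>i\<le>k. (x i)\<^sup>2) + (2 * t * (1 - t) * (s * x k) + t\<^sup>2)"
      by (simp add: sum.distrib sum_distrib_left)
    then show ?thesis
      using that by (simp add: topspace_nsphere_iff)
  qed
  have N_pos: "N z > 0" if z: "z \<in> topspace ?T" for z
  proof -
    obtain t x where tx: "z = (t, x)" "0 \<le> t" "t \<le> 1" "x \<in> topspace (nsphere k)" "s * x k > -1"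
      using z by (auto simp: S_def)
    \<comment> \<open>The squared norm is 1 - 2 t (1 - t) (1 - s x_k). The bound 1/4 for t (1 - t)
      leaves at least (1 + s x_k) / 2, which is positive.\<close>
    have "t * (1 - t) * (1 - s * x k) \<le> 1/4 * (1 - s * x k)" 
    proof (rule mult_right_mono)
      have "0 \<le> (t - 1/2)\<^sup>2" by simp
      then show "t * (1 - t) \<le> 1/4" by (simp add: power2_eq_square algebra_simps)
      have "(s * x k)\<^sup>2 \<le> 1"
        using sphere_coordinate_le_1[OF tx(4) order_refl] s by (simp add: power_mult_distrib)
      then show "0 \<le> 1 - s * x k"
        using abs_square_le_1[of "s * x k"] by simp
    qed
    moreover have "(\<Sum>i\<le>k. (c z i)\<^sup>2) = 1 - 2 * (t * (1 - t) * (1 - s * x k))"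
      unfolding tx(1) N2[OF tx(4)] by (simp add: power2_eq_square algebra_simps)
    ultimately show ?thesis
      using tx(5) by (simp add: N_def)
  qed
  have h_in: "h z \<in> topspace S" if z: "z \<in> topspace ?T" for z
  proof -
    obtain t x where tx: "z = (t, x)" "0 \<le> t" "t \<le> 1" "x \<in> topspace (nsphere k)" "s * x k > -1"
      using z by (auto simp: S_def)
    have "(\<Sum>i\<le>k. (h z i)\<^sup>2) = (\<Sum>i\<le>k. (c z i)\<^sup>2) / (N z)\<^sup>2"
      by (simp add: h_def power_divide sum_divide_distrib)
    also have "\<dots> = 1"
      using N_pos[OF z] by (simp add: N_def sum_nonneg)
    finally have "(\<Sum>i\<le>k. (h z i)\<^sup>2) = 1" .
    moreover have "h z i = 0" if "i > k" for i
      using that tx by (simp add: h_def c_def pole_def topspace_nsphere_iff)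
    ultimately have sphere: "h z \<in> topspace (nsphere k)"
      by (simp add: topspace_nsphere_iff)
    \<comment> \<open>The value \<open>w\<close> is \<open>s\<close> times the last coordinate
      before normalization. Only negative \<open>w\<close> could reach -N, and there N^2 - w^2 = (1
      - t)^2 (1 - (s x_k)^2) is positive.\<close>
    define w where "w = (1 - t) * (s * x k) + t"
    have "- N z < w"
    proof (cases "w \<ge> 0")
      case False
      have "t \<noteq> 1" using False by (auto simp: w_def)
      have "s * x k < 0"
        using False tx by (smt (verit) mult_nonneg_nonneg w_def)
      then have "(s * x k)\<^sup>2 < 1"
        using tx(5) abs_square_less_1[of "s * x k"] by simp
      moreover have "(\<Sum>i\<le>k. (c z i)\<^sup>2) - w\<^sup>2 = (1 - t)\<^sup>2 * (1 - (s * x k)\<^sup>2)"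
        unfolding tx(1) N2[OF tx(4)] w_def by (simp add: power2_eq_square algebra_simps)
      moreover have "(1 - t)\<^sup>2 > 0"
        using \<open>t \<noteq> 1\<close> by simp
      ultimately have "(\<Sum>i\<le>k. (c z i)\<^sup>2) - w\<^sup>2 > 0"
        by (metis diff_gt_0_iff_gt mult_pos_pos)
      then have "w\<^sup>2 < (N z)\<^sup>2"
        by (simp add: N_def sum_nonneg)
      then show ?thesis
        using N_pos[OF z] by (metis abs_less_iff abs_of_pos minus_less_iff real_sqrt_abs real_sqrt_less_iff)
    qed (use N_pos[OF z] in simp)
    moreover have "s * h z k = w / N z"
      using ss by (simp add: h_def c_def tx(1) pole_def w_def algebra_simps)
    ultimately have "s * h z k > -1"
      using N_pos[OF z] by (simp add: less_divide_eq)
    then show ?thesis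
      using sphere by (simp add: S_def)
  qed
  have c_cont: "continuous_map ?T euclideanreal (\<lambda>z. c z i)" for i
  proof -
    have 1: "continuous_map ?T euclideanreal fst"
      by (metis continuous_map_fst continuous_map_in_subtopology)
    have "continuous_map S euclideanreal (\<lambda>x. x i)"
      unfolding S_def by (intro continuous_map_from_subtopology continuous_map_nsphere_projection)
    then have 2: "continuous_map ?T euclideanreal (\<lambda>z. snd z i)"
      using continuous_map_compose[OF continuous_map_snd] by (fastforce simp: o_def)
    show ?thesis
      unfolding c_def
      by (intro continuous_map_add continuous_map_real_mult continuous_map_diff 1 2 continuous_map_const[THEN iffD2]) simp_all
  qed
  have "continuous_map ?T euclideanreal (\<lambda>z. h z i)" for i
    unfolding h_def
  proof (intro continuous_map_real_divide c_cont)
    show "continuous_map ?T euclideanreal N"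
      unfolding N_def by (intro continuous_map_sqrt continuous_map_sum continuous_map_real_pow c_cont) simp
  qed (use N_pos in force)
  then have "continuous_map ?T (powertop_real UNIV) h"
    by (simp add: continuous_map_componentwise_UNIV)
  then have "continuous_map ?T S h"
    using h_in unfolding S_def nsphere subtopology_subtopology
    by (auto simp: continuous_map_in_subtopology)
  moreover have "h (0, x) = x" if "x \<in> topspace S" for x
    using N2[of x 0] that by (auto simp: h_def c_def N_def S_def)
  moreover have "h (1, x) = pole k s" if "x \<in> topspace S" for x
    using N2[of x 1] that by (auto simp: h_def c_def N_def S_def)
  ultimately have "homotopic_with (\<lambda>_. True) S S id (\<lambda>_. pole k s)"
    by (subst homotopic_with) auto
  then show ?thesis
    unfolding contractible_space_def S_def by blast
qed

lemma singular_simplex_disjoint_open: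
  assumes \<sigma>: "singular_simplex p X \<sigma>" and U: "openin X U" "openin X V" "U \<inter> V = {}"
    and im: "\<sigma> ` standard_simplex p \<subseteq> U \<union> V"
  shows "\<sigma> ` standard_simplex p \<subseteq> U \<or> \<sigma> ` standard_simplex p \<subseteq> V"
proof -
  have "connectedin (simplex_space p) (standard_simplex p)"
    using connectedin_standard_simplex by (simp add: connectedin_subtopology)
  then have "connectedin X (\<sigma> ` standard_simplex p)"
    using \<sigma> connectedin_continuous_map_image unfolding singular_simplex_def by blast
  then have "U \<inter> \<sigma> ` standard_simplex p = {} \<or> V \<inter> \<sigma> ` standard_simplex p = {}"
    using connectedinD[of X "\<sigma> ` standard_simplex p" U V] U im by auto
  then show ?thesis
    using im by fast
qed

text \<open>The class is the indicator of the positive point of S^0. Restricting to the slices over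
  the two points makes \<beta> - w and -w coboundaries, and their difference is \<beta>. On a
  1-simplex the indicator is constant by connectedness, so it is a cocycle.\<close>

lemma mult_injective_sphere_0:
  obtains s :: "((nat \<Rightarrow> real) \<Rightarrow> (nat \<Rightarrow> real)) \<Rightarrow> 'r::comm_ring_1"
  where "cocycle_on 0 (nsphere 0) s" "mult_injective X 0 (nsphere 0) s"
proof -
  \<comment> \<open>This is the only point of \<open>standard_simplex 0\<close>, so a 0-simplex is
    given by its value there.\<close>
  define e where "e = (\<lambda>j::nat. if j = 0 then 1 else (0::real))"
  have e: "e \<in> standard_simplex 0"
    by (simp add: e_def)
  define s :: "((nat \<Rightarrow> real) \<Rightarrow> (nat \<Rightarrow> real)) \<Rightarrow> 'r" where "s \<sigma> = (if \<sigma> e 0 > 0 then 1 else 0)" for \<sigma>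
  have "cochain_eval s (chain_boundary (Suc 0) (frag_of \<sigma>)) = 0" if \<sigma>: "singular_simplex (Suc 0) (nsphere 0) \<sigma>" for \<sigma>
  proof -
    let ?U = "{x \<in> topspace (nsphere 0). x 0 \<in> {0<..}}" and ?V = "{x \<in> topspace (nsphere 0). x 0 \<in> {..<0}}"
    have "\<sigma> ` standard_simplex (Suc 0) \<subseteq> topspace (nsphere 0)"
      using \<sigma> continuous_map_image_subset_topspace unfolding singular_simplex_def by fastforce
    also have "\<dots> \<subseteq> ?U \<union> ?V"
      by (auto simp: topspace_nsphere_iff power2_eq_1_iff)
    finally have "\<sigma> ` standard_simplex (Suc 0) \<subseteq> ?U \<or> \<sigma> ` standard_simplex (Suc 0) \<subseteq> ?V"
      by (intro singular_simplex_disjoint_open[OF \<sigma>] openin_continuous_map_preimage[OF continuous_map_nsphere_projection]) auto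
    moreover have "simplical_face j e \<in> standard_simplex (Suc 0)" if "j \<le> 1" for j
      using simplical_face_in_standard_simplex[of "Suc 0" j e] e that by simp
    ultimately have "\<sigma> (simplical_face 0 e) 0 > 0 \<longleftrightarrow> \<sigma> (simplical_face (Suc 0) e) 0 > 0"
      by (fastforce simp: image_subset_iff)
    then show ?thesis
      using e by (simp add: cochain_eval_boundary_of s_def singular_face_def)
  qed
  then have "cocycle_on 0 (nsphere 0) s"
    unfolding cocycle_on_iff_simplex by blast
  moreover have "mult_injective X 0 (nsphere 0) s"
    unfolding mult_injective_def
  proof (intro allI impI)
    fix n and \<beta> w :: "((nat \<Rightarrow> real) \<Rightarrow> 'a) \<Rightarrow> 'r"
    let ?c = "\<lambda>\<sigma>. cup 0 n (\<lambda>\<sigma>. s (simplex_map 0 snd \<sigma>)) (\<lambda>\<sigma>. \<beta> (simplex_map n fst \<sigma>)) \<sigma> - w (simplex_map (0 + n) fst \<sigma>)"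
    assume "coboundary_on (0 + n) (prod_topology X (nsphere 0)) ?c"
    then obtain g where g: "coboundary_by n (prod_topology X (nsphere 0)) ?c g"
      by auto
    have restrict: "coboundary_on n X (\<lambda>\<sigma>. (if y 0 > 0 then \<beta> \<sigma> else 0) - w \<sigma>)" if "y \<in> topspace (nsphere 0)" for y
    proof -
      have "continuous_map X (prod_topology X (nsphere 0)) (\<lambda>x. (x, y))"
        using that by (simp add: continuous_map_pairwise o_def)
      from coboundary_by_pullback[OF this g]
      have "coboundary_on n X (\<lambda>\<sigma>. ?c (simplex_map n (\<lambda>x. (x, y)) \<sigma>))"
        by blast
      moreover have "?c (simplex_map n (\<lambda>x. (x, y)) \<sigma>) = (if y 0 > 0 then \<beta> \<sigma> else 0) - w \<sigma>"
        if \<sigma>: "singular_simplex n X \<sigma>" for \<sigma>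
      proof -
        have "simplex_map n fst (simplex_map n (\<lambda>x. (x, y)) \<sigma>) = \<sigma>"
          using simplex_map_id_gen[OF \<sigma>, of "fst \<circ> (\<lambda>x. (x, y))"] by (simp add: simplex_map_compose)
        moreover have "back_face 0 n (simplex_map n (\<lambda>x. (x, y)) \<sigma>) = simplex_map n (\<lambda>x. (x, y)) \<sigma>"
          by (auto simp: back_face_def simplex_map_def)
        moreover have "s (simplex_map 0 snd (front_face 0 (simplex_map n (\<lambda>x. (x, y)) \<sigma>))) = (if y 0 > 0 then 1 else 0)"
          using e standard_simplex_mono[of 0 n] by (auto simp: s_def simplex_map_def front_face_def)
        ultimately show ?thesis
          by (simp add: cup_def)
      qed
      then have "coboundary_by n X (\<lambda>\<sigma>. ?c (simplex_map n (\<lambda>x. (x, y)) \<sigma>)) h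
          \<longleftrightarrow> coboundary_by n X (\<lambda>\<sigma>. (if y 0 > 0 then \<beta> \<sigma> else 0) - w \<sigma>) h" for h
        by (rule coboundary_by_cong)
      ultimately show ?thesis
        by simp
    qed
    obtain a b where "coboundary_by n X (\<lambda>\<sigma>. \<beta> \<sigma> - w \<sigma>) a" "coboundary_by n X (\<lambda>\<sigma>. 0 - w \<sigma>) b"
      using restrict[OF pole_in_nsphere[of 1 0]] restrict[OF pole_in_nsphere[of "-1" 0]] by (auto simp: pole_def)
    from coboundary_by_diff[OF this] show "coboundary_on n X \<beta>"
      by auto
  qed
  ultimately show ?thesis by (rule that)
qed

text \<open>The new class is the image of \<open>s'\<close> under the Mayer-Vietoris connecting map
  for the two punctured spheres: pull \<open>s'\<close> back to the overlap, take its coboundary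
  over \<open>A\<close> and zero over \<open>B\<close>, and extend from small simplices. The two
  prescriptions agree on the overlap because the pullback is a cocycle there.\<close>

lemma mult_injective_sphere_Suc:
  fixes s' :: "((nat \<Rightarrow> real) \<Rightarrow> (nat \<Rightarrow> real)) \<Rightarrow> 'r::comm_ring_1"
  assumes s': "cocycle_on m (nsphere m) s'" "mult_injective X m (nsphere m) s'"
  obtains s :: "((nat \<Rightarrow> real) \<Rightarrow> (nat \<Rightarrow> real)) \<Rightarrow> 'r" where "cocycle_on (Suc m) (nsphere (Suc m)) s" "mult_injective X (Suc m) (nsphere (Suc m)) s"
proof -
  let ?Y = "nsphere (Suc m)"
  \<comment> \<open>The factors 1 and -1 match the form of
    \<open>contractible_punctured_sphere\<close>; each set omits one pole.\<close>
  define A where "A = {x::nat \<Rightarrow> real. 1 * x (Suc m) > -1}"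
  define B where "B = {x::nat \<Rightarrow> real. -1 * x (Suc m) > -1}"
  have open_AB: "openin ?Y (topspace ?Y \<inter> A)" "openin ?Y (topspace ?Y \<inter> B)"
    using openin_continuous_map_preimage[OF continuous_map_nsphere_projection[of "Suc m" "Suc m"], of "{-1<..}"]
      openin_continuous_map_preimage[OF continuous_map_nsphere_projection[of "Suc m" "Suc m"], of "{..<1}"]
    by (auto simp: A_def B_def Int_def)
  let ?\<C> = "{topspace ?Y \<inter> A, topspace ?Y \<inter> B}"
  have \<C>: "\<And>U. U \<in> ?\<C> \<Longrightarrow> openin ?Y U" "topspace ?Y \<subseteq> \<Union>?\<C>"
    using open_AB by (auto simp: A_def B_def)
  have sub: "subtopology ?Y (topspace ?Y \<inter> S) = subtopology ?Y S" for S
    by (metis subtopology_restrict)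
  have small: "small_simplex ?\<C> p ?Y \<sigma> \<longleftrightarrow> singular_simplex p (subtopology ?Y A) \<sigma> \<or> singular_simplex p (subtopology ?Y B) \<sigma>" for p \<sigma>
    by (simp add: small_simplex_def sub)
  \<comment> \<open>This is the retraction of the sphere without its poles onto the equator: drop
    the last coordinate and normalize. The square root is the norm of the remaining
    coordinates.\<close>
  define r where "r x i = (if i \<le> m then x i / sqrt (1 - (x (Suc m))\<^sup>2) else (0::real))" for x :: "nat \<Rightarrow> real" and i
  let ?E = "subtopology ?Y (A \<inter> B)"
  have pos: "1 - (x (Suc m))\<^sup>2 > 0" if "x \<in> topspace ?E" for x
    using that abs_square_less_1[of "x (Suc m)"] by (simp add: A_def B_def abs_less_iff)
  have r: "continuous_map ?E (nsphere m) r"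
  proof -
    have coord: "continuous_map ?E euclideanreal (\<lambda>x. x i)" for i
      by (intro continuous_map_from_subtopology continuous_map_nsphere_projection)
    have "continuous_map ?E euclideanreal (\<lambda>x. r x i)" for i
    proof (cases "i \<le> m")
      case True
      have "continuous_map ?E euclideanreal (\<lambda>x. x i / sqrt (1 - (x (Suc m))\<^sup>2))"
        by (intro continuous_map_real_divide continuous_map_sqrt continuous_map_diff continuous_map_real_pow coord
            continuous_map_const[THEN iffD2]) (use pos in force)+
      then show ?thesis using True by (simp add: r_def)
    qed (simp add: r_def)
    moreover have "r x \<in> topspace (nsphere m)" if x: "x \<in> topspace ?E" for x
    proof -
      have "(\<Sum>i\<le>m. (r x i)\<^sup>2) = (\<Sum>i\<le>m. (x i)\<^sup>2) / (1 - (x (Suc m))\<^sup>2)"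
        using pos[OF x] by (simp add: r_def power_divide sum_divide_distrib)
      also have "(\<Sum>i\<le>m. (x i)\<^sup>2) = 1 - (x (Suc m))\<^sup>2"
        using x by (simp add: topspace_nsphere_iff)
      finally show ?thesis
        using pos[OF x] by (simp add: topspace_nsphere_iff r_def)
    qed
    ultimately show ?thesis
      by (auto simp: nsphere[of m] continuous_map_in_subtopology continuous_map_componentwise_UNIV topspace_nsphere_iff)
  qed
  have incl: "continuous_map (nsphere m) ?E id"
  proof -
    have "nsphere m = subtopology ?E {x. x (Suc m) = 0}"
      using subtopology_nsphere_equator[of m] by (simp add: subtopology_subtopology A_def B_def Int_def conj_commute cong: conj_cong)
    then show ?thesis
      by (metis continuous_map_id continuous_map_in_subtopology)
  qed
  \<comment> \<open>The value 0 off the overlap extends the pulled-back cocycle to a cochain on all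
    of \<open>A\<close>. In general it is no cocycle there, so its coboundary can carry a nontrivial
    class.\<close>
  define a where "a \<tau> = (if singular_simplex m ?E \<tau> then s' (simplex_map m r \<tau>) else 0)" for \<tau>
  define f where "f \<sigma> = (if singular_simplex (Suc m) (subtopology ?Y A) \<sigma>
    then cochain_eval a (chain_boundary (Suc m) (frag_of \<sigma>)) else 0)" for \<sigma>
  have E_iff: "singular_simplex p ?E \<sigma> \<longleftrightarrow> singular_simplex p (subtopology ?Y A) \<sigma> \<and> singular_simplex p (subtopology ?Y B) \<sigma>" for p \<sigma>
    by (auto simp: singular_simplex_subtopology)
  have a: "cocycle_on m ?E a"
    using cocycle_on_pullback[OF r s'(1)] cocycle_on_cong[of m ?E a "\<lambda>\<tau>. s' (simplex_map m r \<tau>)"] by (simp add: a_def)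
  have fB: "f \<sigma> = 0" if "singular_simplex (Suc m) (subtopology ?Y B) \<sigma>" for \<sigma>
    using that cocycle_on_simplex[OF a, of \<sigma>] by (simp add: f_def E_iff)
  have fA: "coboundary_by (Suc m) (subtopology ?Y A) f a"
    by (simp add: coboundary_by_iff_simplex f_def)
  have "cocycle_on (Suc m) (subtopology ?Y B) f"
    using fB coboundary_imp_cocycle[OF coboundary_by_zero] cocycle_on_cong[of "Suc m" "subtopology ?Y B" f "\<lambda>_. 0"] by simp
  then have "cochain_eval f (chain_boundary (Suc (Suc m)) (frag_of \<sigma>)) = 0" if "small_simplex ?\<C> (Suc (Suc m)) ?Y \<sigma>" for \<sigma>
    using that coboundary_imp_cocycle[OF fA] cocycle_on_simplex unfolding small by blast
  then obtain s where s: "cocycle_on (Suc m) ?Y s" "\<And>\<sigma>. small_simplex ?\<C> (Suc m) ?Y \<sigma> \<Longrightarrow> s \<sigma> = f \<sigma>"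
    using cocycle_extend_from_small_simplices[OF \<C>] by metis
  have "mult_injective X (Suc m) ?Y s"
  proof (rule mult_injective_suspension)
    show "contractible_space (subtopology ?Y A)" "contractible_space (subtopology ?Y B)"
      unfolding A_def B_def by (rule contractible_punctured_sphere; simp)+
    show "pole (Suc m) 1 \<in> topspace ?Y \<inter> A" "pole (Suc m) (-1) \<in> topspace ?Y \<inter> B"
      using pole_in_nsphere[of 1 "Suc m"] pole_in_nsphere[of "-1" "Suc m"] by (simp_all add: A_def B_def pole_def)
    show "coboundary_by (Suc m) (subtopology ?Y A) s a"
      using fA s(2) coboundary_by_cong[of "Suc m" "subtopology ?Y A" s f a] by (simp add: small)
    show "s \<sigma> = 0" if "singular_simplex (Suc m) (subtopology ?Y B) \<sigma>" for \<sigma>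
      using that s(2) fB by (simp add: small)
    show "continuous_map (nsphere m) ?E id"
      by (rule incl)
    \<comment> \<open>The retraction fixes the equator, so restricting \<open>a\<close> to the
      equator gives back \<open>s'\<close> and the induction hypothesis applies.\<close>
    have "a (simplex_map m id \<tau>) = s' \<tau>" if \<tau>: "singular_simplex m (nsphere m) \<tau>" for \<tau>
    proof -
      have "simplex_map m r (simplex_map m id \<tau>) = simplex_map m (r \<circ> id) \<tau>"
        by (simp only: simplex_map_compose o_apply)
      also have "\<dots> = \<tau>"
        by (rule simplex_map_id_gen[OF \<tau>]) (auto simp: r_def topspace_nsphere_iff fun_eq_iff)
      finally show ?thesis
        using singular_simplex_simplex_map[OF \<tau> incl] by (simp add: a_def)
    qed
    then show "mult_injective X m (nsphere m) (\<lambda>\<sigma>. a (simplex_map m id \<sigma>))"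
      using s'(2) by (rule mult_injective_cong)
  qed
  with s(1) show ?thesis by (rule that)
qed

theorem mult_injective_sphere:
  obtains s :: "((nat \<Rightarrow> real) \<Rightarrow> (nat \<Rightarrow> real)) \<Rightarrow> 'r::comm_ring_1"
  where "cocycle_on k (nsphere k) s" "mult_injective X k (nsphere k) s"
proof (induction k arbitrary: thesis)
  case 0
  then show ?case using mult_injective_sphere_0 by blast
next
  case (Suc m)
  show ?case
    by (rule Suc.IH, erule (1) mult_injective_sphere_Suc, rule Suc.prems)
qed

section \<open>Iterated cup products\<close>

text \<open>Nested to the right, like the \<open>foldr\<close> in
  \<open>cohomological_length\<close>. The empty product is the unit cochain, of degree 0.\<close>

fun cup_list :: "(nat \<times> (((nat \<Rightarrow> real) \<Rightarrow> 'a) \<Rightarrow> 'r::comm_ring_1)) list \<Rightarrow> ((nat \<Rightarrow> real) \<Rightarrow> 'a) \<Rightarrow> 'r"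
  where
    "cup_list [] = (\<lambda>\<sigma>. 1)"
  | "cup_list (a # l) = cup (fst a) (sum_list (map fst l)) (snd a) (cup_list l)"

abbreviation cup_degree :: "(nat \<times> 'b) list \<Rightarrow> nat"
  where "cup_degree l \<equiv> sum_list (map fst l)"

definition pullback_list :: "('b \<Rightarrow> 'a) \<Rightarrow> (nat \<times> (((nat \<Rightarrow> real) \<Rightarrow> 'a) \<Rightarrow> 'r)) list \<Rightarrow> (nat \<times> (((nat \<Rightarrow> real) \<Rightarrow> 'b) \<Rightarrow> 'r)) list"
  where "pullback_list \<phi> l = map (\<lambda>(p, f). (p, \<lambda>\<sigma>. f (simplex_map p \<phi> \<sigma>))) l"

lemma cup_degree_pullback [simp]: "cup_degree (pullback_list \<phi> l) = cup_degree l"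
  by (induction l) (auto simp: pullback_list_def)

lemma cup_list_pullback:
  "cup_list (pullback_list \<phi> l) = (\<lambda>\<sigma>. cup_list l (simplex_map (cup_degree l) \<phi> \<sigma>))"
proof (induction l)
  case (Cons a l)
  have "cup_list (pullback_list \<phi> (a # l))
    = cup (fst a) (cup_degree l) (\<lambda>\<sigma>. snd a (simplex_map (fst a) \<phi> \<sigma>)) (cup_list (pullback_list \<phi> l))"
    using cup_degree_pullback[of \<phi> l] by (simp add: pullback_list_def case_prod_unfold)
  also have "\<dots> = (\<lambda>\<sigma>. cup_list (a # l) (simplex_map (cup_degree (a # l)) \<phi> \<sigma>))"
    by (simp add: Cons.IH cup_pullback fun_eq_iff)
  finally show ?case .
qed (simp add: pullback_list_def)

section \<open>Constant cochains and contractible spaces\<close>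

lemma sum_alternating: "(\<Sum>k\<le>n. (- 1) ^ k) = (if even n then 1 else 0 :: 'r::comm_ring_1)"
  by (induction n) auto

lemma cochain_eval_const_boundary:
  "cochain_eval (\<lambda>_. v) (chain_boundary (Suc n) (frag_of \<sigma>)) = (if odd n then v else 0)"
  unfolding cochain_eval_boundary_of[OF zero_less_Suc] sum_distrib_right[symmetric] sum_alternating
  by simp

lemma cocycle_on_const_0: "cocycle_on 0 X (\<lambda>\<sigma>. v)"
  by (simp add: cocycle_on_iff_simplex cochain_eval_const_boundary)

lemma cocycle_on_cup_list:
  "(\<And>a. a \<in> set l \<Longrightarrow> cocycle_on (fst a) X (snd a)) \<Longrightarrow> cocycle_on (cup_degree l) X (cup_list l)"
  by (induction l) (auto intro: cocycle_on_cup cocycle_on_const_0)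

lemma singular_simplex_const:
  "x \<in> topspace X \<Longrightarrow> singular_simplex n X (restrict (\<lambda>_. x) (standard_simplex n))"
  by (auto simp: singular_simplex_def intro: continuous_map_eq[of _ _ "\<lambda>_. x"])

text \<open>The signs of the faces of an n-simplex add up to 1 for even n > 0, and the constant is
  then its own primitive. For odd n the same count one dimension higher turns the cocycle condition,
  tested on a constant simplex, into v = 0.\<close>

lemma coboundary_on_const:
  assumes "cocycle_on n X (\<lambda>_. v)" "n > 0"
  shows "coboundary_on n X (\<lambda>_. v)"
proof -
  obtain m where m: "n = Suc m"
    using assms(2) gr0_implies_Suc by blast
  have "v = 0" if odd: "odd n" and \<sigma>: "singular_simplex n X \<sigma>" for \<sigma>
  proof -
    obtain e where "e \<in> standard_simplex n"
      using nonempty_standard_simplex by blast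
    then have "\<sigma> e \<in> topspace X"
      using \<sigma> by (auto simp: singular_simplex_def continuous_map_def Pi_iff)
    then show ?thesis
      using cocycle_on_simplex[OF assms(1) singular_simplex_const[of "\<sigma> e"]] odd
      by (simp add: cochain_eval_const_boundary)
  qed
  then have "coboundary_by n X (\<lambda>_. v) (\<lambda>_. v)"
    by (auto simp: coboundary_by_iff_simplex m cochain_eval_const_boundary)
  then show ?thesis by blast
qed

text \<open>A contraction makes \<open>f\<close> cohomologous to its pullback under a constant map,
  which takes the same value \<open>v\<close> on every simplex.\<close>

lemma contractible_space_cocycle_coboundary:
  assumes "contractible_space X" "cocycle_on n X f" "n > 0"
  shows "coboundary_on n X f"
proof -
  obtain a where hom: "homotopic_with (\<lambda>_. True) X X id (\<lambda>_. a)"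
    using assms(1) by (auto simp: contractible_space_def)
  define v where "v = f (restrict (\<lambda>_. a) (standard_simplex n))"
  have const: "f (simplex_map n (\<lambda>_. a) \<sigma>) = v" for \<sigma> :: "(nat \<Rightarrow> real) \<Rightarrow> 'a"
    by (simp add: v_def simplex_map_def o_def)
  have "continuous_map X X (\<lambda>_. a)"
    using homotopic_with_imp_continuous_maps[OF hom] by simp
  from cocycle_on_pullback[OF this assms(2)] have "cocycle_on n X (\<lambda>_. v)"
    by (simp add: const)
  from coboundary_on_const[OF this assms(3)] obtain g where g: "coboundary_by n X (\<lambda>_. v) g"
    by blast
  obtain h where h: "coboundary_by n X (\<lambda>\<sigma>. v - f (simplex_map n id \<sigma>)) h"
    using homotopic_imp_cohomologous[OF hom assms(2)] unfolding const by blast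
  have "simplex_map n id \<sigma> = \<sigma>" if "singular_simplex n X \<sigma>" for \<sigma>
    by (rule simplex_map_id_gen[OF that]) simp
  then have "coboundary_by n X (\<lambda>\<sigma>. v - (v - f (simplex_map n id \<sigma>))) (\<lambda>\<sigma>. g \<sigma> - h \<sigma>)
      \<longleftrightarrow> coboundary_by n X f (\<lambda>\<sigma>. g \<sigma> - h \<sigma>)"
    by (intro coboundary_by_cong) simp
  then show ?thesis
    using coboundary_by_diff[OF g h] by blast
qed

section \<open>The cup length and open covers\<close>

text \<open>A simplex is connected, so it lies in a single member of the family and the separate
  primitives can be combined into one.\<close>

lemma coboundary_on_disjoint_Union:
  assumes open_W: "\<And>W. W \<in> \<W> \<Longrightarrow> openin X W" and disj: "pairwise disjnt \<W>"
    and f: "\<And>W. W \<in> \<W> \<Longrightarrow> coboundary_on p (subtopology X W) f"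
  shows "coboundary_on p (subtopology X (\<Union>\<W>)) f"
proof -
  obtain g where g: "\<And>W. W \<in> \<W> \<Longrightarrow> coboundary_by p (subtopology X W) f (g W)"
    using f by metis
  define e where "e = (\<lambda>j::nat. if j = 0 then 1 else (0::real))"
  have e: "e \<in> standard_simplex n" for n
    by (simp add: e_def)
  \<comment> \<open>The member is read off from the image of the vertex \<open>e\<close>, which
    belongs to the standard simplex of every dimension. All faces of a simplex in \<open>W\<close>
    thus select the same primitive \<open>g W\<close>.\<close>
  define h where "h \<tau> = g (THE W. W \<in> \<W> \<and> \<tau> e \<in> W) \<tau>" for \<tau>
  have the_W: "(THE W. W \<in> \<W> \<and> x \<in> W) = W" if "W \<in> \<W>" "x \<in> W" for W x
    using that disj by (intro the_equality) (auto simp: pairwise_def disjnt_iff)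
  have "f \<sigma> = cochain_eval h (chain_boundary p (frag_of \<sigma>))"
    if \<sigma>: "singular_simplex p (subtopology X (\<Union>\<W>)) \<sigma>" for \<sigma>
  proof -
    have im: "\<sigma> ` standard_simplex p \<subseteq> \<Union>\<W>" and \<sigma>X: "singular_simplex p X \<sigma>"
      using \<sigma> by (auto simp: singular_simplex_subtopology)
    then obtain W where W: "W \<in> \<W>" "\<sigma> e \<in> W"
      using e[of p] by blast
    have "\<sigma> ` standard_simplex p \<subseteq> W \<or> \<sigma> ` standard_simplex p \<subseteq> \<Union>(\<W> - {W})"
    proof (rule singular_simplex_disjoint_open[OF \<sigma>X])
      show "openin X W" "openin X (\<Union>(\<W> - {W}))"
        using W open_W by auto
      show "W \<inter> \<Union>(\<W> - {W}) = {}"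
        using W disj by (fastforce simp: pairwise_def disjnt_iff)
      show "\<sigma> ` standard_simplex p \<subseteq> W \<union> \<Union>(\<W> - {W})"
        using im by blast
    qed
    moreover have "\<not> \<sigma> ` standard_simplex p \<subseteq> \<Union>(\<W> - {W})"
      using W disj e[of p] by (fastforce simp: pairwise_def disjnt_iff image_subset_iff)
    ultimately have \<sigma>W: "singular_simplex p (subtopology X W) \<sigma>"
      using \<sigma>X by (simp add: singular_simplex_subtopology)
    have "h \<tau> = g W \<tau>" if "singular_simplex (p - Suc 0) (subtopology X W) \<tau>" for \<tau>
      using that e[of "p - Suc 0"] the_W[OF W(1)] by (auto simp: h_def singular_simplex_subtopology)
    then have "cochain_eval h (chain_boundary p (frag_of \<sigma>)) = cochain_eval (g W) (chain_boundary p (frag_of \<sigma>))"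
      using singular_chain_boundary[of p "subtopology X W" "frag_of \<sigma>"] \<sigma>W
      by (intro cochain_eval_cong[of "p - Suc 0" "subtopology X W"]) (simp_all add: singular_chain_of)
    then show ?thesis
      using coboundary_by_simplex[OF g[OF W(1)] \<sigma>W] by simp
  qed
  then have "coboundary_by p (subtopology X (\<Union>\<W>)) f h"
    by (simp add: coboundary_by_iff_simplex)
  then show ?thesis by blast
qed

text \<open>Factor number i is changed by a coboundary so that it vanishes on simplices in
  \<open>V i\<close>. Front and back faces of a simplex in \<open>V i\<close> stay in
  \<open>V i\<close>, so the whole product vanishes there. The induction varies \<open>V\<close>
  because the tail of the list uses the cover shifted by one.\<close>

lemma cup_list_normalize:
  fixes l :: "(nat \<times> (((nat \<Rightarrow> real) \<Rightarrow> 'a) \<Rightarrow> 'r::comm_ring_1)) list"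
  assumes V: "\<And>i p (f :: ((nat \<Rightarrow> real) \<Rightarrow> 'a) \<Rightarrow> 'r). p > 0 \<Longrightarrow> cocycle_on p X f \<Longrightarrow> coboundary_on p (subtopology X (V i)) f"
    and l: "\<And>a. a \<in> set l \<Longrightarrow> fst a > 0 \<and> cocycle_on (fst a) X (snd a)"
  shows "\<exists>c. cocycle_on (cup_degree l) X c \<and> coboundary_on (cup_degree l) X (\<lambda>\<sigma>. cup_list l \<sigma> - c \<sigma>) \<and>
    (\<forall>i<length l. \<forall>\<sigma>. singular_simplex (cup_degree l) (subtopology X (V i)) \<sigma> \<longrightarrow> c \<sigma> = 0)"
  using assms
proof (induction l arbitrary: V)
  case Nil
  show ?case
    by (rule exI[of _ "\<lambda>_. 1"]) (auto simp: cocycle_on_const_0 intro: exI[of _ "\<lambda>_. 0"] coboundary_by_zero)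
next
  case (Cons a l)
  let ?p = "fst a" and ?f = "snd a" and ?q = "cup_degree l"
  have a: "?p > 0" "cocycle_on ?p X ?f"
    using Cons.prems(2) by auto
  have "\<exists>c. cocycle_on ?q X c \<and> coboundary_on ?q X (\<lambda>\<sigma>. cup_list l \<sigma> - c \<sigma>) \<and>
    (\<forall>i<length l. \<forall>\<sigma>. singular_simplex ?q (subtopology X (V (Suc i))) \<sigma> \<longrightarrow> c \<sigma> = 0)"
    by (rule Cons.IH) (use Cons.prems in auto)
  then obtain c where c: "cocycle_on ?q X c" "coboundary_on ?q X (\<lambda>\<sigma>. cup_list l \<sigma> - c \<sigma>)"
    "\<forall>i<length l. \<forall>\<sigma>. singular_simplex ?q (subtopology X (V (Suc i))) \<sigma> \<longrightarrow> c \<sigma> = 0"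
    by blast
  obtain g where g: "coboundary_by ?p (subtopology X (V 0)) ?f g"
    using Cons.prems(1)[OF a] by blast
  \<comment> \<open>The primitive \<open>g\<close> comes from \<open>V 0\<close> but is a total
    function, so its coboundary makes sense on all of \<open>X\<close>. Hence \<open>f'\<close>
    differs from the factor by a coboundary on \<open>X\<close> and still vanishes on simplices in
    \<open>V 0\<close>.\<close>
  define f' where "f' \<sigma> = ?f \<sigma> - cochain_eval g (chain_boundary ?p (frag_of \<sigma>))" for \<sigma>
  have f': "cocycle_on ?p X f'"
    unfolding f'_def by (rule cocycle_modify_coboundary[OF a(2)])
  have l_cocycle: "cocycle_on ?q X (cup_list l)"
    using Cons.prems(2) by (intro cocycle_on_cup_list) auto
  show ?case
  proof (rule exI[of _ "cup ?p ?q f' c"], intro conjI allI impI)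
    show "cocycle_on (cup_degree (a # l)) X (cup ?p ?q f' c)"
      using cocycle_on_cup[OF f' c(1)] by simp
    have "coboundary_by ?p X (\<lambda>\<sigma>. ?f \<sigma> - f' \<sigma>) g"
      by (simp add: coboundary_by_iff_simplex f'_def)
    then obtain u where u: "coboundary_by (?p + ?q) X (cup ?p ?q (\<lambda>\<sigma>. ?f \<sigma> - f' \<sigma>) (cup_list l)) u"
      using coboundary_on_cup_left[OF _ l_cocycle] by blast
    obtain v where v: "coboundary_by (?p + ?q) X (cup ?p ?q f' (\<lambda>\<sigma>. cup_list l \<sigma> - c \<sigma>)) v"
      using coboundary_on_cup_right[OF f' c(2)] by blast
    have "(\<lambda>\<sigma>. cup_list (a # l) \<sigma> - cup ?p ?q f' c \<sigma>)
        = (\<lambda>\<sigma>. cup ?p ?q (\<lambda>\<sigma>. ?f \<sigma> - f' \<sigma>) (cup_list l) \<sigma> + cup ?p ?q f' (\<lambda>\<sigma>. cup_list l \<sigma> - c \<sigma>) \<sigma>)"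
      by (simp add: cup_def algebra_simps fun_eq_iff)
    then show "coboundary_on (cup_degree (a # l)) X (\<lambda>\<sigma>. cup_list (a # l) \<sigma> - cup ?p ?q f' c \<sigma>)"
      using coboundary_by_add[OF u v] by auto
    fix i \<sigma> assume i: "i < length (a # l)" and \<sigma>: "singular_simplex (cup_degree (a # l)) (subtopology X (V i)) \<sigma>"
    show "cup ?p ?q f' c \<sigma> = 0"
    proof (cases i)
      case 0
      then have "singular_simplex ?p (subtopology X (V 0)) (front_face ?p \<sigma>)"
        using singular_simplex_front_face[OF \<sigma>, of ?p] by simp
      then show ?thesis
        using coboundary_by_simplex[OF g] by (simp add: cup_def f'_def)
    next
      case (Suc j)
      then have "singular_simplex ?q (subtopology X (V (Suc j))) (back_face ?p ?q \<sigma>)"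
        using singular_simplex_back_face[of ?p ?q "subtopology X (V i)" \<sigma>] \<sigma> by simp
      then show ?thesis
        using c(3) i Suc by (simp add: cup_def)
    qed
  qed
qed

theorem cup_list_coboundary_of_cover:
  fixes l :: "(nat \<times> (((nat \<Rightarrow> real) \<Rightarrow> 'a) \<Rightarrow> 'r::comm_ring_1)) list"
  assumes V: "\<And>i. openin X (V i)" "topspace X \<subseteq> (\<Union>i<length l. V i)"
      "\<And>i p (f :: ((nat \<Rightarrow> real) \<Rightarrow> 'a) \<Rightarrow> 'r). p > 0 \<Longrightarrow> cocycle_on p X f \<Longrightarrow> coboundary_on p (subtopology X (V i)) f"
    and l: "\<And>a. a \<in> set l \<Longrightarrow> fst a > 0 \<and> cocycle_on (fst a) X (snd a)"
  shows "coboundary_on (cup_degree l) X (cup_list l)"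
proof -
  have "\<exists>c. cocycle_on (cup_degree l) X c \<and> coboundary_on (cup_degree l) X (\<lambda>\<sigma>. cup_list l \<sigma> - c \<sigma>) \<and>
    (\<forall>i<length l. \<forall>\<sigma>. singular_simplex (cup_degree l) (subtopology X (V i)) \<sigma> \<longrightarrow> c \<sigma> = 0)"
    using V(3) l by (rule cup_list_normalize)
  then obtain c where c: "cocycle_on (cup_degree l) X c" "coboundary_on (cup_degree l) X (\<lambda>\<sigma>. cup_list l \<sigma> - c \<sigma>)"
    "\<forall>i<length l. \<forall>\<sigma>. singular_simplex (cup_degree l) (subtopology X (V i)) \<sigma> \<longrightarrow> c \<sigma> = 0"
    by blast
  have "coboundary_on (cup_degree l) X c"
  proof (rule cocycle_vanishing_on_small_simplices[OF _ _ c(1)])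
    show "openin X U" if "U \<in> V ` {..<length l}" for U
      using that V(1) by auto
    show "topspace X \<subseteq> \<Union>(V ` {..<length l})"
      using V(2) by simp
    show "c \<sigma> = 0" if "small_simplex (V ` {..<length l}) (cup_degree l) X \<sigma>" for \<sigma>
      using that c(3) by (auto simp: small_simplex_def)
  qed
  then obtain u v where "coboundary_by (cup_degree l) X (\<lambda>\<sigma>. cup_list l \<sigma> - c \<sigma>) u" "coboundary_by (cup_degree l) X c v"
    using c(2) by blast
  from coboundary_by_add[OF this] show ?thesis
    by auto
qed

section \<open>Products of spheres\<close>

abbreviation sphere_product :: "(nat \<Rightarrow> nat) \<Rightarrow> nat \<Rightarrow> (nat \<Rightarrow> nat \<Rightarrow> real) topology"
  where "sphere_product k r \<equiv> product_topology (\<lambda>i. nsphere (k i)) {1..r}"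

text \<open>Each new sphere contributes its class, pulled back by the projection, at the head of the
  list. Pulling the product back along \<open>h\<close> to a binary product exhibits it as the
  sphere class times the previous product, and \<open>mult_injective\<close> shows that it can bound
  only if the previous product does. The start is the one-point product, where the unit does not
  vanish.\<close>

theorem sphere_product_cup_list_nontrivial:
  assumes "\<And>i. i \<in> {1..r} \<Longrightarrow> k i \<ge> 1"
  shows "\<exists>l :: (nat \<times> (((nat \<Rightarrow> real) \<Rightarrow> nat \<Rightarrow> nat \<Rightarrow> real) \<Rightarrow> 'r::comm_ring_1)) list.
    length l = r \<and> (\<forall>a\<in>set l. fst a > 0 \<and> cocycle_on (fst a) (sphere_product k r) (snd a)) \<and>
    \<not> coboundary_on (cup_degree l) (sphere_product k r) (cup_list l)"
  using assms
proof (induction r)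
  case 0
  have "(\<lambda>_. undefined) \<in> topspace (sphere_product k 0)"
    by simp
  from singular_simplex_const[OF this] show ?case
    by (intro exI[of _ "[]"]) (auto simp: coboundary_by_zero_iff)
next
  case (Suc r)
  let ?M = "sphere_product k r" and ?M' = "sphere_product k (Suc r)" and ?k = "k (Suc r)"
  obtain l :: "(nat \<times> (((nat \<Rightarrow> real) \<Rightarrow> nat \<Rightarrow> nat \<Rightarrow> real) \<Rightarrow> 'r)) list" where l: "length l = r"
      "\<And>a. a \<in> set l \<Longrightarrow> fst a > 0 \<and> cocycle_on (fst a) ?M (snd a)" "\<not> coboundary_on (cup_degree l) ?M (cup_list l)"
    using Suc.IH Suc.prems by fastforce
  obtain s :: "((nat \<Rightarrow> real) \<Rightarrow> nat \<Rightarrow> real) \<Rightarrow> 'r" where s: "cocycle_on ?k (nsphere ?k) s" "mult_injective ?M ?k (nsphere ?k) s"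
    using mult_injective_sphere by blast
  define \<pi> where "\<pi> x = x (Suc r)" for x :: "nat \<Rightarrow> nat \<Rightarrow> real"
  define \<rho> where "\<rho> x = restrict x {1..r}" for x :: "nat \<Rightarrow> nat \<Rightarrow> real"
  define h where "h z = (fst z)(Suc r := snd z)" for z :: "(nat \<Rightarrow> nat \<Rightarrow> real) \<times> (nat \<Rightarrow> real)"
  have \<pi>: "continuous_map ?M' (nsphere ?k) \<pi>"
    unfolding \<pi>_def by (rule continuous_map_product_projection) simp
  have \<rho>: "continuous_map ?M' ?M \<rho>"
    unfolding \<rho>_def continuous_map_componentwise
    by (auto intro!: continuous_map_product_projection)
  have "continuous_map (prod_topology ?M (nsphere ?k)) (nsphere (k i)) (\<lambda>z. h z i)" if "i \<in> {1..Suc r}" for i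
  proof (cases "i = Suc r")
    case False
    then have "continuous_map ?M (nsphere (k i)) (\<lambda>x. x i)"
      using that by (intro continuous_map_product_projection) auto
    then show ?thesis
      using False continuous_map_compose[OF continuous_map_fst] by (fastforce simp: h_def o_def)
  qed (simp add: h_def continuous_map_snd)
  then have h: "continuous_map (prod_topology ?M (nsphere ?k)) ?M' h"
    unfolding continuous_map_componentwise
    by (auto simp: h_def PiE_def extensional_def)
  let ?l = "(?k, \<lambda>\<sigma>. s (simplex_map ?k \<pi> \<sigma>)) # pullback_list \<rho> l"
  have "fst a > 0 \<and> cocycle_on (fst a) ?M' (snd a)" if a: "a \<in> set ?l" for a
  proof (cases "a = hd ?l")
    case True
    then show ?thesis
      using Suc.prems[of "Suc r"] cocycle_on_pullback[OF \<pi> s(1)] by simp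
  next
    case False
    then have "a \<in> set (pullback_list \<rho> l)"
      using a by simp
    then obtain b where "b \<in> set l" "a = (fst b, \<lambda>\<sigma>. snd b (simplex_map (fst b) \<rho> \<sigma>))"
      unfolding pullback_list_def case_prod_unfold set_map by blast
    then show ?thesis
      using l(2)[of b] cocycle_on_pullback[OF \<rho>, of "fst b" "snd b"] by simp
  qed
  moreover have "\<not> coboundary_on (cup_degree ?l) ?M' (cup_list ?l)"
  proof
    let ?d = "cup_degree l" and ?Z = "prod_topology ?M (nsphere ?k)"
    let ?c = "cup ?k ?d (\<lambda>\<sigma>. s (simplex_map ?k snd \<sigma>)) (\<lambda>\<sigma>. cup_list l (simplex_map ?d fst \<sigma>))"
    assume "coboundary_on (cup_degree ?l) ?M' (cup_list ?l)"
    then obtain g where "coboundary_by (?k + ?d) ?M' (cup_list ?l) g"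
      by auto
    note coboundary_by_pullback[OF h this]
    \<comment> \<open>The subtracted 0 stands for the term \<open>w\<close> of
      \<open>mult_injective\<close>, which is taken to be zero.\<close>
    moreover have "cup_list ?l (simplex_map (?k + ?d) h \<sigma>) = ?c \<sigma> - 0" if \<sigma>: "singular_simplex (?k + ?d) ?Z \<sigma>" for \<sigma>
    proof -
      have "cup_list ?l (simplex_map (?k + ?d) h \<sigma>)
          = cup ?k ?d (\<lambda>\<sigma>. s (simplex_map ?k (\<pi> \<circ> h) \<sigma>)) (\<lambda>\<sigma>. cup_list l (simplex_map ?d (\<rho> \<circ> h) \<sigma>)) \<sigma>"
        by (simp add: cup_list_pullback pullback_compose flip: cup_pullback)
      also have "\<pi> \<circ> h = snd"
        by (auto simp: \<pi>_def h_def)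
      also have "simplex_map ?d (\<rho> \<circ> h) \<tau> = simplex_map ?d fst \<tau>" if "singular_simplex ?d ?Z \<tau>" for \<tau>
        using that
      proof (rule simplex_map_eq)
        fix z assume "z \<in> topspace ?Z"
        then show "(\<rho> \<circ> h) z = fst z"
          by (auto simp: \<rho>_def h_def PiE_def extensional_def fun_eq_iff)
      qed
      then have "cup ?k ?d (\<lambda>\<sigma>. s (simplex_map ?k snd \<sigma>)) (\<lambda>\<sigma>. cup_list l (simplex_map ?d (\<rho> \<circ> h) \<sigma>)) \<sigma> = ?c \<sigma> - 0"
        using singular_simplex_back_face[OF \<sigma>] by (simp add: cup_def)
      finally show ?thesis .
    qed
    then have "coboundary_by (?k + ?d) ?Z (\<lambda>\<sigma>. cup_list ?l (simplex_map (?k + ?d) h \<sigma>)) g'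
        \<longleftrightarrow> coboundary_by (?k + ?d) ?Z (\<lambda>\<sigma>. ?c \<sigma> - 0) g'" for g'
      by (rule coboundary_by_cong)
    ultimately have "coboundary_on (?k + ?d) ?Z (\<lambda>\<sigma>. ?c \<sigma> - 0)"
      by blast
    moreover have "cocycle_on ?d ?M (cup_list l)"
      using l(2) by (intro cocycle_on_cup_list) auto
    moreover have "cocycle_on (?k + ?d) ?M (\<lambda>_. 0 :: 'r)"
      by (rule coboundary_imp_cocycle[OF coboundary_by_zero])
    ultimately have "coboundary_on ?d ?M (cup_list l)"
      using s(2)[unfolded mult_injective_def, rule_format, of ?d "cup_list l" "\<lambda>_. 0"] by simp
    with l(3) show False ..
  qed
  moreover have "length ?l = Suc r"
    using l(1) by (simp add: pullback_list_def)
  ultimately show ?case by blast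
qed

section \<open>A cover of the product by r + 1 open sets\<close>

text \<open>The comparison of the last coordinates makes the charts of distinct sets of the same size
  disjoint; the bounds keep one pole of each factor out of the chart, which therefore lies in a
  contractible product.\<close>

definition sphere_chart :: "(nat \<Rightarrow> nat) \<Rightarrow> nat \<Rightarrow> nat set \<Rightarrow> (nat \<Rightarrow> nat \<Rightarrow> real) set"
  where "sphere_chart k r J = {x \<in> topspace (sphere_product k r).
    (\<forall>i\<in>J. x i (k i) < 1) \<and> (\<forall>j\<in>{1..r} - J. -1 < x j (k j)) \<and> (\<forall>i\<in>J. \<forall>j\<in>{1..r} - J. x i (k i) < x j (k j))}"

lemma openin_sphere_chart:
  assumes J: "J \<subseteq> {1..r}"
  shows "openin (sphere_product k r) (sphere_chart k r J)"
proof -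
  let ?M = "sphere_product k r"
  have d: "continuous_map ?M euclideanreal (\<lambda>x. x i (k i))" if "i \<in> {1..r}" for i
    using continuous_map_compose[OF continuous_map_product_projection[OF that, of "\<lambda>i. nsphere (k i)"] continuous_map_nsphere_projection[of "k i" "k i"]]
    by (simp add: o_def)
  have less: "openin ?M {x \<in> topspace ?M. f x < g x}"
    if "continuous_map ?M euclideanreal f" "continuous_map ?M euclideanreal g" for f g :: "_ \<Rightarrow> real"
    using openin_continuous_map_preimage[OF continuous_map_diff[OF that(2,1)], of "{0<..}"] by simp
  have const: "continuous_map ?M euclideanreal (\<lambda>_. c)" for c :: real
    by simp
  have "finite J"
    using J finite_subset by blast
  have "sphere_chart k r J = topspace ?M \<inter> \<Inter>((\<lambda>i. {x \<in> topspace ?M. x i (k i) < 1}) ` J)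
      \<inter> \<Inter>((\<lambda>j. {x \<in> topspace ?M. -1 < x j (k j)}) ` ({1..r} - J))
      \<inter> \<Inter>((\<lambda>(i, j). {x \<in> topspace ?M. x i (k i) < x j (k j)}) ` (J \<times> ({1..r} - J)))"
    by (auto simp: sphere_chart_def)
  also have "openin ?M \<dots>"
  proof -
    have inter: "openin ?M (S \<inter> \<Inter>(F ` K))" if "openin ?M S" "finite K" "\<And>i. i \<in> K \<Longrightarrow> openin ?M (F i)" for S K and F :: "'x \<Rightarrow> _"
      using that(2,1,3)
    proof (induction K rule: finite_induct)
      case (insert i K)
      have "S \<inter> \<Inter>(F ` insert i K) = F i \<inter> (S \<inter> \<Inter>(F ` K))"
        by auto
      then show ?case
        using insert by (simp add: openin_Int)
    qed simp
    show ?thesis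
    proof (intro inter)
      show "openin ?M {x \<in> topspace ?M. x i (k i) < 1}" if "i \<in> J" for i
        using that J by (intro less const d) auto
      show "openin ?M {x \<in> topspace ?M. -1 < x j (k j)}" if "j \<in> {1..r} - J" for j
        using that J by (intro less const d) auto
      show "openin ?M (case ij of (i, j) \<Rightarrow> {x \<in> topspace ?M. x i (k i) < x j (k j)})" if "ij \<in> J \<times> ({1..r} - J)" for ij
      proof -
        have "fst ij \<in> {1..r}" "snd ij \<in> {1..r}"
          using that J by auto
        then show ?thesis
          unfolding case_prod_unfold by (intro less d)
      qed
    qed (simp_all add: \<open>finite J\<close> del: topspace_product_topology)
  qed
  finally show ?thesis .
qed

text \<open>Two different sets of equal size each contain an index that the other lacks. The two
  charts order the coordinates at these indices in opposite ways.\<close>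

lemma disjoint_sphere_charts:
  assumes "J \<subseteq> {1..r}" "J' \<subseteq> {1..r}" "card J = card J'" "J \<noteq> J'"
  shows "sphere_chart k r J \<inter> sphere_chart k r J' = {}"
proof -
  have fin: "finite J" "finite J'"
    using assms finite_subset by blast+
  obtain i where i: "i \<in> J - J'"
    using assms(3,4) fin card_subset_eq[of J' J] by blast
  obtain j where j: "j \<in> J' - J"
    using assms(3,4) fin card_subset_eq[of J J'] by (metis DiffI subsetI)
  have "x i (k i) < x j (k j)" "x j (k j) < x i (k i)" if "x \<in> sphere_chart k r J \<inter> sphere_chart k r J'" for x
    using that i j assms(1,2) by (auto simp: sphere_chart_def)
  then show ?thesis
    by (meson disjoint_iff IntI less_asym)
qed

lemma sphere_chart_coboundary:
  assumes f: "cocycle_on p (sphere_product k r) f" "p > 0"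
  shows "coboundary_on p (subtopology (sphere_product k r) (sphere_chart k r J)) f"
proof -
  let ?M = "sphere_product k r"
  \<comment> \<open>The sign turns the bound by 1 for the factors in \<open>J\<close> into the form
    of \<open>contractible_punctured_sphere\<close>, so each \<open>S i\<close> omits one
    pole.\<close>
  define S where "S i = {x. (if i \<in> J then -1 else 1) * x (k i) > (-1::real)}" for i
  have "contractible_space (product_topology (\<lambda>i. subtopology (nsphere (k i)) (S i)) {1..r})"
    unfolding contractible_space_product_topology S_def
    by (intro disjI2 ballI contractible_punctured_sphere) simp
  then have contr: "contractible_space (subtopology ?M (PiE {1..r} S))"
    by (simp add: subtopology_product_topology)
  have "sphere_chart k r J \<subseteq> PiE {1..r} S"
    by (auto simp: sphere_chart_def S_def PiE_iff extensional_def)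
  then have eq: "subtopology ?M (sphere_chart k r J) = subtopology (subtopology ?M (PiE {1..r} S)) (sphere_chart k r J)"
    by (simp add: subtopology_subtopology inf.absorb2)
  show ?thesis
    using contractible_space_cocycle_coboundary[OF contr cocycle_on_subtopology[OF f(1)] f(2)]
    unfolding eq by (blast intro: coboundary_by_subtopology)
qed

text \<open>Any level \<open>t\<close> between \<open>-1\<close> and \<open>1\<close> that is not the last coordinate of a factor separates
  the factors into a chart.\<close>

lemma sphere_charts_cover:
  assumes x: "x \<in> topspace (sphere_product k r)"
  obtains J where "J \<subseteq> {1..r}" "x \<in> sphere_chart k r J"
proof -
  have "infinite ({-1<..<1::real} - (\<lambda>i. x i (k i)) ` {1..r})"
    by (intro Diff_infinite_finite) auto
  then obtain t where t: "-1 < t" "t < 1" "t \<notin> (\<lambda>i. x i (k i)) ` {1..r}"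
    by (metis Diff_iff ex_in_conv finite.emptyI greaterThanLessThan_iff)
  define J where "J = {i \<in> {1..r}. x i (k i) < t}"
  have "t < x j (k j)" if "j \<in> {1..r} - J" for j
    using that t(3) by (force simp: J_def)
  then have "x \<in> sphere_chart k r J"
    using x t(1,2) unfolding sphere_chart_def J_def
    by (auto simp del: topspace_product_topology)
  moreover have "J \<subseteq> {1..r}"
    by (auto simp: J_def)
  ultimately show ?thesis
    by (rule that[rotated])
qed

text \<open>Collecting the charts by the size of \<open>J\<close> gives disjoint unions on which
  primitives combine. The possible sizes 0, ..., r are all below the length of the list, so each
  member of the cover has a factor of its own.\<close>

theorem sphere_product_cup_list_trivial:
  fixes l :: "(nat \<times> (((nat \<Rightarrow> real) \<Rightarrow> nat \<Rightarrow> nat \<Rightarrow> real) \<Rightarrow> 'r::comm_ring_1)) list"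
  assumes "length l > r" and l: "\<And>a. a \<in> set l \<Longrightarrow> fst a > 0 \<and> cocycle_on (fst a) (sphere_product k r) (snd a)"
  shows "coboundary_on (cup_degree l) (sphere_product k r) (cup_list l)"
proof -
  let ?M = "sphere_product k r"
  define \<W> where "\<W> j = sphere_chart k r ` {J. J \<subseteq> {1..r} \<and> card J = j}" for j
  have open_W: "openin ?M W" if "W \<in> \<W> j" for W j
    using that openin_sphere_chart by (auto simp: \<W>_def)
  show ?thesis
  proof (rule cup_list_coboundary_of_cover[where V = "\<lambda>j. \<Union>(\<W> j)", OF _ _ _ l])
    show "openin ?M (\<Union>(\<W> j))" for j
      using open_W by blast
    show "topspace ?M \<subseteq> (\<Union>j<length l. \<Union>(\<W> j))"
    proof
      fix x assume "x \<in> topspace ?M"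
      then obtain J where J: "J \<subseteq> {1..r}" "x \<in> sphere_chart k r J"
        by (rule sphere_charts_cover)
      then have "card J < length l"
        using card_mono[of "{1..r}" J] assms(1) by simp
      then show "x \<in> (\<Union>j<length l. \<Union>(\<W> j))"
        using J by (auto simp: \<W>_def)
    qed
    show "coboundary_on p (subtopology ?M (\<Union>(\<W> j))) f"
      if "p > 0" "cocycle_on p ?M f" for j p and f :: "((nat \<Rightarrow> real) \<Rightarrow> nat \<Rightarrow> nat \<Rightarrow> real) \<Rightarrow> 'r"
    proof (rule coboundary_on_disjoint_Union)
      show "pairwise disjnt (\<W> j)"
      proof (rule pairwiseI)
        fix A B assume "A \<in> \<W> j" "B \<in> \<W> j" "A \<noteq> B"
        then obtain J J' where "J \<in> {J. J \<subseteq> {1..r} \<and> card J = j}" "J' \<in> {J. J \<subseteq> {1..r} \<and> card J = j}"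
            and AB: "A = sphere_chart k r J" "B = sphere_chart k r J'"
          unfolding \<W>_def by blast
        moreover have "J \<noteq> J'"
          using AB \<open>A \<noteq> B\<close> by blast
        ultimately show "disjnt A B"
          by (simp add: disjnt_def disjoint_sphere_charts)
      qed
      show "openin ?M W" if "W \<in> \<W> j" for W
        using that by (rule open_W)
      show "coboundary_on p (subtopology ?M W) f" if W: "W \<in> \<W> j" for W
      proof -
        obtain J where "W = sphere_chart k r J"
          using W by (auto simp: \<W>_def)
        then show ?thesis
          using sphere_chart_coboundary[OF \<open>cocycle_on p ?M f\<close> \<open>p > 0\<close>] by simp
      qed
    qed
  qed
qed

section \<open>The cohomology ring\<close>

lemma cochain_eval_fun_sum: "cochain_eval (\<lambda>\<sigma>. \<Sum>i\<in>I. f i \<sigma>) c = (\<Sum>i\<in>I. cochain_eval (f i) c)"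
  by (induction I rule: infinite_finite_induct) (simp_all add: cochain_eval_fun_add)

abbreviation cochain_mult :: "'a topology \<Rightarrow> ('a, 'r::comm_ring_1) graded_cochain \<Rightarrow> ('a, 'r) graded_cochain \<Rightarrow> ('a, 'r) graded_cochain"
  where "cochain_mult X \<equiv> mult (cochain_ring X)"

lemma cochain_mult_apply:
  "cochain_mult X F G n \<sigma> = (if singular_simplex n X \<sigma> then \<Sum>p\<le>n. cup p (n - p) (F p) (G (n - p)) \<sigma> else 0)"
  by (simp add: cochain_ring_def cup_def)

text \<open>Carries the sign of the graded Leibniz rule, so that the rule becomes an identity
  between products in \<open>cochain_ring\<close>.\<close>

definition sign_twist :: "('a, 'r::comm_ring_1) graded_cochain \<Rightarrow> ('a, 'r) graded_cochain"
  where "sign_twist F n \<sigma> = (- 1) ^ n * F n \<sigma>"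

lemma cochain_diff_0: "cochain_diff X F 0 \<sigma> = 0"
  by (simp add: cochain_diff_def chain_boundary_def)

lemma cochain_diff_Suc:
  "singular_simplex (Suc n) X \<sigma> \<Longrightarrow> cochain_diff X F (Suc n) \<sigma> = cochain_eval (F n) (chain_boundary (Suc n) (frag_of \<sigma>))"
  by (simp add: cochain_diff_def)

text \<open>Sum of \<open>cup_Leibniz\<close> over all ways to split the degree. Each product on the
  right has one more summand than the left-hand side, and that summand vanishes because
  \<open>cochain_diff\<close> is zero in degree 0.\<close>

lemma cochain_diff_mult:
  "cochain_diff X (cochain_mult X F G)
    = (\<lambda>n \<sigma>. cochain_mult X (cochain_diff X F) G n \<sigma> + cochain_mult X (sign_twist F) (cochain_diff X G) n \<sigma>)"
proof (intro ext)
  fix n \<sigma>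
  show "cochain_diff X (cochain_mult X F G) n \<sigma>
    = cochain_mult X (cochain_diff X F) G n \<sigma> + cochain_mult X (sign_twist F) (cochain_diff X G) n \<sigma>"
  proof (cases "singular_simplex n X \<sigma>")
    case \<sigma>: True
    show ?thesis
    proof (cases n)
      case 0
      then show ?thesis by (simp add: cochain_mult_apply cup_def cochain_diff_0)
    next
      case (Suc m)
      let ?b = "chain_boundary (Suc m) (frag_of \<sigma>)"
      define L where "L p = cochain_eval (F p) (chain_boundary (Suc p) (frag_of (front_face (Suc p) \<sigma>))) * G (m - p) (back_face (Suc p) (m - p) \<sigma>)" for p
      define R where "R p = (- 1) ^ p * (F p (front_face p \<sigma>) * cochain_eval (G (m - p)) (chain_boundary (Suc (m - p)) (frag_of (back_face p (Suc (m - p)) \<sigma>))))" for p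
      have "cochain_diff X (cochain_mult X F G) n \<sigma> = cochain_eval (cochain_mult X F G m) ?b"
        using \<sigma> Suc by (simp add: cochain_diff_Suc)
      also have "\<dots> = cochain_eval (\<lambda>\<tau>. \<Sum>p\<le>m. cup p (m - p) (F p) (G (m - p)) \<tau>) ?b"
        using singular_chain_boundary_alt[of m X "frag_of \<sigma>"] \<sigma> Suc
        by (intro cochain_eval_cong[of m X]) (simp_all add: cochain_mult_apply singular_chain_of)
      also have "\<dots> = (\<Sum>p\<le>m. cochain_eval (cup p (m - p) (F p) (G (m - p))) ?b)"
        by (rule cochain_eval_fun_sum)
      also have "\<dots> = (\<Sum>p\<le>m. L p + R p)"
      proof (rule sum.cong)
        fix p assume "p \<in> {..m}"
        then show "cochain_eval (cup p (m - p) (F p) (G (m - p))) ?b = L p + R p"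
          using cup_Leibniz[of p "m - p" "F p" "G (m - p)" \<sigma>] by (simp add: L_def R_def)
      qed simp
      finally have lhs: "cochain_diff X (cochain_mult X F G) n \<sigma> = (\<Sum>p\<le>m. L p) + (\<Sum>p\<le>m. R p)"
        by (simp add: sum.distrib)
      have "cochain_mult X (cochain_diff X F) G n \<sigma>
          = (\<Sum>p\<le>Suc m. cochain_diff X F p (front_face p \<sigma>) * G (Suc m - p) (back_face p (Suc m - p) \<sigma>))"
        using \<sigma> Suc by (simp add: cochain_mult_apply cup_def)
      also have "\<dots> = (\<Sum>p\<le>m. cochain_diff X F (Suc p) (front_face (Suc p) \<sigma>) * G (m - p) (back_face (Suc p) (m - p) \<sigma>))"
        by (subst sum.atMost_Suc_shift) (simp add: cochain_diff_0)
      also have "\<dots> = (\<Sum>p\<le>m. L p)"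
        using singular_simplex_front_face[OF \<sigma>] Suc by (intro sum.cong) (simp_all add: L_def cochain_diff_Suc)
      finally have 1: "cochain_mult X (cochain_diff X F) G n \<sigma> = (\<Sum>p\<le>m. L p)" .
      have "cochain_mult X (sign_twist F) (cochain_diff X G) n \<sigma>
          = (\<Sum>p\<le>Suc m. sign_twist F p (front_face p \<sigma>) * cochain_diff X G (Suc m - p) (back_face p (Suc m - p) \<sigma>))"
        using \<sigma> Suc by (simp add: cochain_mult_apply cup_def)
      also have "\<dots> = (\<Sum>p\<le>m. sign_twist F p (front_face p \<sigma>) * cochain_diff X G (Suc m - p) (back_face p (Suc m - p) \<sigma>))"
        by (simp add: cochain_diff_0)
      also have "\<dots> = (\<Sum>p\<le>m. R p)"
      proof (rule sum.cong)
        fix p assume "p \<in> {..m}"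
        then have "Suc m - p = Suc (m - p)" "p + Suc (m - p) = Suc m"
          by auto
        then show "sign_twist F p (front_face p \<sigma>) * cochain_diff X G (Suc m - p) (back_face p (Suc m - p) \<sigma>) = R p"
          using singular_simplex_back_face[of p "Suc (m - p)" X \<sigma>] \<sigma> Suc
          by (simp add: R_def sign_twist_def cochain_diff_Suc mult.assoc)
      qed simp
      finally have 2: "cochain_mult X (sign_twist F) (cochain_diff X G) n \<sigma> = (\<Sum>p\<le>m. R p)" .
      show ?thesis
        unfolding lhs 1 2 ..
    qed
  qed (simp add: cochain_mult_apply cochain_diff_def)
qed

section \<open>Closure properties of cochains, cocycles and coboundaries\<close>

lemma cochain_diff_add: "cochain_diff X (\<lambda>n \<sigma>. F n \<sigma> + G n \<sigma>) = (\<lambda>n \<sigma>. cochain_diff X F n \<sigma> + cochain_diff X G n \<sigma>)"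
  by (auto simp: cochain_diff_def cochain_eval_fun_add fun_eq_iff)

lemma cochain_diff_minus: "cochain_diff X (\<lambda>n \<sigma>. - F n \<sigma>) = (\<lambda>n \<sigma>. - cochain_diff X F n \<sigma>)"
  using cochain_eval_fun_cmul[of "-1"] by (auto simp: cochain_diff_def fun_eq_iff)

lemma cochain_diff_zero: "cochain_diff X (\<lambda>n \<sigma>. 0) = (\<lambda>n \<sigma>. 0)"
  by (intro ext) (simp add: cochain_diff_def)

lemma cochain_diff_sign_twist: "cochain_diff X F = (\<lambda>n \<sigma>. 0) \<Longrightarrow> cochain_diff X (sign_twist F) = (\<lambda>n \<sigma>. 0)"
proof -
  assume F: "cochain_diff X F = (\<lambda>n \<sigma>. 0)"
  have "cochain_diff X (sign_twist F) n \<sigma> = (- 1) ^ (n - 1) * cochain_diff X F n \<sigma>" for n \<sigma>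
    by (simp add: cochain_diff_def sign_twist_def[abs_def] cochain_eval_fun_cmul)
  then show ?thesis
    by (simp add: F fun_eq_iff)
qed

lemma cochain_diff_diff: "cochain_diff X (cochain_diff X F) = (\<lambda>n \<sigma>. 0)"
proof (intro ext)
  fix n \<sigma>
  show "cochain_diff X (cochain_diff X F) n \<sigma> = 0"
  proof (cases "n \<ge> 2 \<and> singular_simplex n X \<sigma>")
    case True
    then obtain m where m: "n = Suc (Suc m)"
      by (metis One_nat_def Suc_1 Suc_le_D Suc_le_mono)
    have "coboundary_by (Suc m) X (cochain_diff X F (Suc m)) (F m)"
      by (simp add: coboundary_by_iff_simplex cochain_diff_Suc)
    then have "cocycle_on (Suc m) X (cochain_diff X F (Suc m))"
      by (rule coboundary_imp_cocycle)
    then show ?thesis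
      using True cocycle_on_simplex m by (simp add: cochain_diff_Suc)
  next
    case False
    then consider "n = 0" | "n = 1" | "\<not> singular_simplex n X \<sigma>"
      by linarith
    then show ?thesis
    proof cases
      case 1
      then show ?thesis by (simp only: cochain_diff_0)
    next
      case 2
      have "cochain_diff X F 0 = (\<lambda>\<sigma>. 0)"
        by (simp add: cochain_diff_0 fun_eq_iff)
      then show ?thesis using 2 by (simp add: cochain_diff_def)
    qed (simp add: cochain_diff_def)
  qed
qed

lemma mem_cochain_ring:
  "F \<in> carrier (cochain_ring X) \<longleftrightarrow> (\<forall>p \<sigma>. \<not> singular_simplex p X \<sigma> \<longrightarrow> F p \<sigma> = 0) \<and> finite {p. F p \<noteq> (\<lambda>\<sigma>. 0)}"
  by (auto simp: cochain_ring_def singular_cochain_def)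

lemma cochain_add_closed:
  assumes "F \<in> carrier (cochain_ring X)" "G \<in> carrier (cochain_ring X)"
  shows "(\<lambda>n \<sigma>. F n \<sigma> + G n \<sigma>) \<in> carrier (cochain_ring X)"
proof -
  have "{p. (\<lambda>\<sigma>. F p \<sigma> + G p \<sigma>) \<noteq> (\<lambda>\<sigma>. 0)} \<subseteq> {p. F p \<noteq> (\<lambda>\<sigma>. 0)} \<union> {p. G p \<noteq> (\<lambda>\<sigma>. 0)}"
    by auto
  with assms show ?thesis
    unfolding mem_cochain_ring using finite_subset by fastforce
qed

lemma cochain_minus_closed: "F \<in> carrier (cochain_ring X) \<Longrightarrow> (\<lambda>n \<sigma>. - F n \<sigma>) \<in> carrier (cochain_ring X)"
  by (simp add: mem_cochain_ring fun_eq_iff)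

lemma sign_twist_closed:
  assumes "F \<in> carrier (cochain_ring X)"
  shows "sign_twist F \<in> carrier (cochain_ring X)"
proof -
  have "{p. sign_twist F p \<noteq> (\<lambda>\<sigma>. 0)} \<subseteq> {p. F p \<noteq> (\<lambda>\<sigma>. 0)}"
    by (auto simp: sign_twist_def)
  with assms show ?thesis
    by (auto simp: mem_cochain_ring sign_twist_def intro: finite_subset)
qed

lemma cochain_mult_closed:
  assumes F: "F \<in> carrier (cochain_ring X)" and G: "G \<in> carrier (cochain_ring X)"
  shows "cochain_mult X F G \<in> carrier (cochain_ring X)"
proof -
  let ?A = "{p. F p \<noteq> (\<lambda>\<sigma>. 0)}" and ?B = "{p. G p \<noteq> (\<lambda>\<sigma>. 0)}"
  have "{n. cochain_mult X F G n \<noteq> (\<lambda>\<sigma>. 0)} \<subseteq> (\<lambda>(p, q). p + q) ` (?A \<times> ?B)"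
  proof clarify
    fix n \<sigma> assume "cochain_mult X F G n \<noteq> (\<lambda>\<sigma>. 0)"
    then obtain \<sigma> where "cochain_mult X F G n \<sigma> \<noteq> 0"
      by auto
    then obtain p where p: "p \<le> n" "cup p (n - p) (F p) (G (n - p)) \<sigma> \<noteq> 0"
      by (auto simp: cochain_mult_apply split: if_splits elim: sum.not_neutral_contains_not_neutral)
    then have "(p, n - p) \<in> ?A \<times> ?B"
      by (auto simp: cup_def)
    then show "n \<in> (\<lambda>(p, q). p + q) ` (?A \<times> ?B)"
      using p(1) by (intro rev_image_eqI[of "(p, n - p)"]) auto
  qed
  moreover have "finite ((\<lambda>(p, q). p + q) ` (?A \<times> ?B))"
    using F G by (intro finite_imageI finite_cartesian_product) (simp_all add: mem_cochain_ring)
  ultimately have "finite {n. cochain_mult X F G n \<noteq> (\<lambda>\<sigma>. 0)}"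
    by (rule finite_subset)
  then show ?thesis
    unfolding mem_cochain_ring by (simp add: cochain_mult_apply)
qed

lemma cochain_mult_add_left:
  "cochain_mult X (\<lambda>n \<sigma>. F n \<sigma> + F' n \<sigma>) G = (\<lambda>n \<sigma>. cochain_mult X F G n \<sigma> + cochain_mult X F' G n \<sigma>)"
  by (auto simp: cochain_mult_apply cup_def fun_eq_iff algebra_simps sum.distrib)

lemma cochain_mult_add_right:
  "cochain_mult X F (\<lambda>n \<sigma>. G n \<sigma> + G' n \<sigma>) = (\<lambda>n \<sigma>. cochain_mult X F G n \<sigma> + cochain_mult X F G' n \<sigma>)"
  by (auto simp: cochain_mult_apply cup_def fun_eq_iff algebra_simps sum.distrib)

lemma mem_cocycle_ring:
  "F \<in> carrier (cocycle_ring X) \<longleftrightarrow> F \<in> carrier (cochain_ring X) \<and> cochain_diff X F = (\<lambda>n \<sigma>. 0)"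
  by (simp add: cocycle_ring_def)

lemma cochain_zero_closed: "(\<lambda>n \<sigma>. 0) \<in> carrier (cochain_ring X)"
  by (simp add: mem_cochain_ring)

lemma cochain_diff_closed:
  assumes F: "F \<in> carrier (cochain_ring X)"
  shows "cochain_diff X F \<in> carrier (cochain_ring X)"
proof -
  have "{n. cochain_diff X F n \<noteq> (\<lambda>\<sigma>. 0)} \<subseteq> Suc ` {p. F p \<noteq> (\<lambda>\<sigma>. 0)}"
  proof clarify
    fix n assume n: "cochain_diff X F n \<noteq> (\<lambda>\<sigma>. 0)"
    then obtain \<sigma> where \<sigma>: "cochain_diff X F n \<sigma> \<noteq> 0"
      by auto
    then have "n \<noteq> 0"
      using cochain_diff_0 by metis
    moreover have "F (n - 1) \<noteq> (\<lambda>\<sigma>. 0)"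
      using \<sigma> by (auto simp: cochain_diff_def split: if_splits)
    ultimately show "n \<in> Suc ` {p. F p \<noteq> (\<lambda>\<sigma>. 0)}"
      by (intro rev_image_eqI[of "n - 1"]) auto
  qed
  moreover have "finite (Suc ` {p. F p \<noteq> (\<lambda>\<sigma>. 0)})"
    using F by (simp add: mem_cochain_ring)
  ultimately have "finite {n. cochain_diff X F n \<noteq> (\<lambda>\<sigma>. 0)}"
    by (rule finite_subset)
  then show ?thesis
    unfolding mem_cochain_ring by (simp add: cochain_diff_def)
qed

lemma coboundaries_subset: "F \<in> coboundaries X \<Longrightarrow> F \<in> carrier (cocycle_ring X)"
  by (auto simp: coboundaries_def mem_cocycle_ring cochain_diff_closed cochain_diff_diff)

lemma coboundaries_add: "F \<in> coboundaries X \<Longrightarrow> G \<in> coboundaries X \<Longrightarrow> (\<lambda>n \<sigma>. F n \<sigma> + G n \<sigma>) \<in> coboundaries X"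
  unfolding coboundaries_def
  by clarify (rule rev_image_eqI[OF cochain_add_closed], auto simp: cochain_diff_add)

lemma coboundaries_minus: "F \<in> coboundaries X \<Longrightarrow> (\<lambda>n \<sigma>. - F n \<sigma>) \<in> coboundaries X"
  unfolding coboundaries_def
  by clarify (rule rev_image_eqI[OF cochain_minus_closed], auto simp: cochain_diff_minus)

lemma coboundaries_zero: "(\<lambda>n \<sigma>. 0) \<in> coboundaries X"
  unfolding coboundaries_def
  by (rule rev_image_eqI[OF cochain_zero_closed]) (simp add: cochain_diff_zero)

lemma coboundaries_mult_right:
  assumes "F \<in> coboundaries X" "G \<in> carrier (cocycle_ring X)"
  shows "cochain_mult X F G \<in> coboundaries X"
proof -
  obtain A where A: "A \<in> carrier (cochain_ring X)" "F = cochain_diff X A"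
    using assms(1) by (auto simp: coboundaries_def)
  have "cochain_mult X (sign_twist A) (\<lambda>n \<sigma>. 0) = (\<lambda>n \<sigma>. 0)"
    by (simp add: cochain_mult_apply cup_def fun_eq_iff)
  then have "cochain_diff X (cochain_mult X A G) = cochain_mult X F G"
    using assms(2) by (simp add: cochain_diff_mult A(2) mem_cocycle_ring)
  then show ?thesis
    using cochain_mult_closed[OF A(1), of G] assms(2) unfolding coboundaries_def mem_cocycle_ring by (metis imageI)
qed

text \<open>If \<open>B\<close> is a primitive of \<open>G\<close>, then the twist of
  \<open>F\<close> times \<open>B\<close> is one of the product: the Leibniz rule twists the first
  factor again, and the two twists cancel.\<close>

lemma coboundaries_mult_left:
  assumes "F \<in> carrier (cocycle_ring X)" "G \<in> coboundaries X"
  shows "cochain_mult X F G \<in> coboundaries X"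
proof -
  obtain B where B: "B \<in> carrier (cochain_ring X)" "G = cochain_diff X B"
    using assms(2) by (auto simp: coboundaries_def)
  have "cochain_mult X (\<lambda>n \<sigma>. 0) B = (\<lambda>n \<sigma>. 0)"
    by (simp add: cochain_mult_apply cup_def fun_eq_iff)
  moreover have "sign_twist (sign_twist F) = F"
    by (simp add: sign_twist_def fun_eq_iff flip: mult.assoc power_add)
  ultimately have "cochain_diff X (cochain_mult X (sign_twist F) B) = cochain_mult X F G"
    using assms(1) by (simp add: cochain_diff_mult B(2) mem_cocycle_ring cochain_diff_sign_twist)
  then show ?thesis
    using cochain_mult_closed[OF sign_twist_closed B(1), of F] assms(1)
    unfolding coboundaries_def mem_cocycle_ring by (metis imageI)
qed

section \<open>Multiplication of cohomology classes\<close>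

definition cohomology_class :: "'a topology \<Rightarrow> ('a, 'r::comm_ring_1) graded_cochain \<Rightarrow> ('a, 'r) graded_cochain set"
  where "cohomology_class X F = coboundaries X +>\<^bsub>cocycle_ring X\<^esub> F"

lemma cohomology_class_eq: "cohomology_class X F = (\<lambda>H n \<sigma>. H n \<sigma> + F n \<sigma>) ` coboundaries X"
  by (auto simp: cohomology_class_def a_r_coset_def r_coset_def cocycle_ring_def cochain_ring_def)

lemma cohomology_class_add_coboundary:
  assumes "H \<in> coboundaries X"
  shows "cohomology_class X (\<lambda>n \<sigma>. H n \<sigma> + F n \<sigma>) = cohomology_class X F"
proof -
  have "(\<lambda>n \<sigma>. K n \<sigma> + (H n \<sigma> + F n \<sigma>)) \<in> cohomology_class X F" if "K \<in> coboundaries X" for K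
    using coboundaries_add[OF that assms]
    by (auto simp: cohomology_class_eq add.assoc intro: rev_image_eqI)
  moreover have "(\<lambda>n \<sigma>. K n \<sigma> + F n \<sigma>) \<in> cohomology_class X (\<lambda>n \<sigma>. H n \<sigma> + F n \<sigma>)" if "K \<in> coboundaries X" for K
    using coboundaries_add[OF that coboundaries_minus[OF assms]]
    by (auto simp: cohomology_class_eq intro: rev_image_eqI)
  ultimately show ?thesis
    by (auto simp: cohomology_class_eq)
qed

lemma cohomology_class_zero: "zero (cohomology_ring X) = coboundaries X"
  by (simp add: cohomology_ring_def FactRing_def)

lemma cohomology_class_eq_zero_iff: "cohomology_class X F = coboundaries X \<longleftrightarrow> F \<in> coboundaries X"
proof
  assume "cohomology_class X F = coboundaries X"
  then show "F \<in> coboundaries X"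
    using coboundaries_zero[of X] by (force simp: cohomology_class_eq)
next
  assume "F \<in> coboundaries X"
  from cohomology_class_add_coboundary[OF this, of "\<lambda>n \<sigma>. 0"] show "cohomology_class X F = coboundaries X"
    by (simp add: cohomology_class_eq)
qed

lemma mult_cohomology_ring:
  fixes X :: "'a topology" and A B :: "('a, 'r::comm_ring_1) graded_cochain set"
  shows "mult (cohomology_ring X) A B = (\<Union>a\<in>A. \<Union>b\<in>B. cohomology_class X (cochain_mult X a b))"
proof -
  have "mult (cocycle_ring X :: ('a, 'r) graded_cochain ring) = cochain_mult X"
    by (simp add: cocycle_ring_def)
  then show ?thesis
    by (simp add: cohomology_ring_def FactRing_def rcoset_mult_def cohomology_class_def)
qed

text \<open>The product of cosets is a union over all pairs of representatives. Here (a + F)(b + G)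
  = a (b + G) + F b + F G, and the first two terms are coboundaries, so every pair yields the same
  coset.\<close>

lemma cohomology_class_mult:
  assumes F: "F \<in> carrier (cocycle_ring X)" and G: "G \<in> carrier (cocycle_ring X)"
  shows "mult (cohomology_ring X) (cohomology_class X F) (cohomology_class X G) = cohomology_class X (cochain_mult X F G)"
proof -
  have "cohomology_class X (cochain_mult X (\<lambda>n \<sigma>. a n \<sigma> + F n \<sigma>) (\<lambda>n \<sigma>. b n \<sigma> + G n \<sigma>)) = cohomology_class X (cochain_mult X F G)"
    if a: "a \<in> coboundaries X" and b: "b \<in> coboundaries X" for a b
  proof -
    let ?K = "\<lambda>n \<sigma>. b n \<sigma> + G n \<sigma>"
    have "?K \<in> carrier (cocycle_ring X)"
      using G coboundaries_subset[OF b] by (simp add: mem_cocycle_ring cochain_add_closed cochain_diff_add)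
    then have "(\<lambda>n \<sigma>. cochain_mult X a ?K n \<sigma> + cochain_mult X F b n \<sigma>) \<in> coboundaries X"
      by (intro coboundaries_add coboundaries_mult_left coboundaries_mult_right a b F)
    from cohomology_class_add_coboundary[OF this, of "cochain_mult X F G"] show ?thesis
      by (simp add: cochain_mult_add_left cochain_mult_add_right[of X F] add.assoc)
  qed
  moreover have "mult (cohomology_ring X) (cohomology_class X F) (cohomology_class X G)
      = (\<Union>a\<in>coboundaries X. \<Union>b\<in>coboundaries X.
          cohomology_class X (cochain_mult X (\<lambda>n \<sigma>. a n \<sigma> + F n \<sigma>) (\<lambda>n \<sigma>. b n \<sigma> + G n \<sigma>)))"
    unfolding mult_cohomology_ring by (simp add: cohomology_class_eq[of X F] cohomology_class_eq[of X G])
  ultimately show ?thesis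
    \<comment> \<open>The zero cochain makes the index set of both unions nonempty, so that they
      reduce to the common value.\<close>
    using coboundaries_zero[of X] by auto
qed

text \<open>The link between the degreewise cochains used so far and \<open>cochain_ring\<close>. It
  sets to 0 the values off the singular simplices of \<open>X\<close>, as membership in that ring
  demands.\<close>

definition homogeneous :: "'a topology \<Rightarrow> nat \<Rightarrow> (((nat \<Rightarrow> real) \<Rightarrow> 'a) \<Rightarrow> 'r::comm_ring_1) \<Rightarrow> ('a, 'r) graded_cochain"
  where "homogeneous X p f = (\<lambda>n \<sigma>. if n = p \<and> singular_simplex p X \<sigma> then f \<sigma> else 0)"

lemma homogeneous_in_cochain_ring: "homogeneous X p f \<in> carrier (cochain_ring X)"
proof -
  have "{n. homogeneous X p f n \<noteq> (\<lambda>\<sigma>. 0)} \<subseteq> {p}"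
    by (auto simp: homogeneous_def)
  then have "finite {n. homogeneous X p f n \<noteq> (\<lambda>\<sigma>. 0)}"
    by (rule finite_subset) simp
  then show ?thesis
    by (simp add: mem_cochain_ring) (simp add: homogeneous_def)
qed

lemma cochain_diff_homogeneous:
  "cochain_diff X (homogeneous X p f) = homogeneous X (Suc p) (\<lambda>\<sigma>. cochain_eval f (chain_boundary (Suc p) (frag_of \<sigma>)))"
proof (intro ext)
  fix n \<sigma>
  show "cochain_diff X (homogeneous X p f) n \<sigma> = homogeneous X (Suc p) (\<lambda>\<sigma>. cochain_eval f (chain_boundary (Suc p) (frag_of \<sigma>))) n \<sigma>"
  proof (cases "n = Suc p \<and> singular_simplex n X \<sigma>")
    case True
    then have n: "n = Suc p" and \<sigma>: "singular_simplex (Suc p) X \<sigma>"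
      by auto
    have "cochain_eval (homogeneous X p f p) (chain_boundary (Suc p) (frag_of \<sigma>)) = cochain_eval f (chain_boundary (Suc p) (frag_of \<sigma>))"
      using singular_chain_boundary_alt[of p X "frag_of \<sigma>"] \<sigma>
      by (intro cochain_eval_cong[of p X]) (simp_all add: singular_chain_of homogeneous_def)
    with n \<sigma> show ?thesis
      by (simp add: cochain_diff_Suc) (simp add: homogeneous_def)
  next
    case False
    show ?thesis
    proof (cases n)
      case 0
      then show ?thesis by (simp add: cochain_diff_0 homogeneous_def)
    next
      case (Suc m)
      then have "singular_simplex n X \<sigma> \<Longrightarrow> homogeneous X p f m = (\<lambda>\<sigma>. 0)"
        using False by (auto simp: homogeneous_def)
      then show ?thesis
        using False Suc by (auto simp: cochain_diff_def homogeneous_def[of X "Suc p"])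
    qed
  qed
qed

lemma homogeneous_cong: "(\<And>\<sigma>. singular_simplex p X \<sigma> \<Longrightarrow> f \<sigma> = g \<sigma>) \<Longrightarrow> homogeneous X p f = homogeneous X p g"
  by (auto simp: homogeneous_def fun_eq_iff)

lemma homogeneous_eq_zero_iff: "homogeneous X p f = (\<lambda>n \<sigma>. 0) \<longleftrightarrow> (\<forall>\<sigma>. singular_simplex p X \<sigma> \<longrightarrow> f \<sigma> = 0)"
  by (auto simp: homogeneous_def fun_eq_iff)

lemma homogeneous_in_cocycle_ring_iff: "homogeneous X p f \<in> carrier (cocycle_ring X) \<longleftrightarrow> cocycle_on p X f"
  by (simp add: mem_cocycle_ring homogeneous_in_cochain_ring cochain_diff_homogeneous homogeneous_eq_zero_iff cocycle_on_iff_simplex)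

text \<open>A primitive in \<open>cochain_ring\<close> may have components in many degrees, but only
  the one of degree p - 1 acts on p-simplices. Degree 0 is separate in the converse, since p - 1 is
  then no lower degree and coboundaries vanish.\<close>

lemma homogeneous_in_coboundaries_iff: "homogeneous X p f \<in> coboundaries X \<longleftrightarrow> coboundary_on p X f"
proof
  assume "homogeneous X p f \<in> coboundaries X"
  then obtain G where G: "homogeneous X p f = cochain_diff X G"
    by (auto simp: coboundaries_def)
  have "f \<sigma> = cochain_eval (G (p - 1)) (chain_boundary p (frag_of \<sigma>))" if "singular_simplex p X \<sigma>" for \<sigma>
    using that fun_cong[OF fun_cong[OF G, of p], of \<sigma>] by (simp add: homogeneous_def cochain_diff_def)
  then show "coboundary_on p X f"
    by (auto simp: coboundary_by_iff_simplex)
next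
  assume "coboundary_on p X f"
  then obtain g where g: "coboundary_by p X f g" by blast
  show "homogeneous X p f \<in> coboundaries X"
  proof (cases p)
    case 0
    then have "homogeneous X p f = (\<lambda>n \<sigma>. 0)"
      using g by (simp add: homogeneous_eq_zero_iff coboundary_by_zero_iff)
    then show ?thesis by (simp add: coboundaries_zero)
  next
    case (Suc m)
    have "homogeneous X p f = cochain_diff X (homogeneous X m g)"
      unfolding cochain_diff_homogeneous Suc
      by (rule homogeneous_cong) (use coboundary_by_simplex[OF g] Suc in simp)
    then show ?thesis
      using homogeneous_in_cochain_ring by (auto simp: coboundaries_def)
  qed
qed

lemma homogeneous_mult: "cochain_mult X (homogeneous X p f) (homogeneous X q g) = homogeneous X (p + q) (cup p q f g)"
proof (intro ext)
  fix n \<sigma>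
  show "cochain_mult X (homogeneous X p f) (homogeneous X q g) n \<sigma> = homogeneous X (p + q) (cup p q f g) n \<sigma>"
  proof (cases "singular_simplex n X \<sigma>")
    case \<sigma>: True
    have "(\<Sum>i\<le>n. cup i (n - i) (homogeneous X p f i) (homogeneous X q g (n - i)) \<sigma>)
        = (\<Sum>i\<le>n. if i = p then (if n = p + q then cup p q f g \<sigma> else 0) else 0)"
    proof (rule sum.cong)
      fix i assume "i \<in> {..n}"
      then show "cup i (n - i) (homogeneous X p f i) (homogeneous X q g (n - i)) \<sigma>
          = (if i = p then (if n = p + q then cup p q f g \<sigma> else 0) else 0)"
        using singular_simplex_front_face[OF \<sigma>, of i] singular_simplex_back_face[of i "n - i" X \<sigma>] \<sigma>
        by (auto simp: cup_def homogeneous_def)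
    qed simp
    then show ?thesis
      using \<sigma> by (auto simp: cochain_mult_apply homogeneous_def[of X "p + q"])
  qed (auto simp: cochain_mult_apply homogeneous_def[of X "p + q"])
qed

lemma cochain_one_eq: "one (cochain_ring X) = homogeneous X 0 (\<lambda>_. 1)"
  by (auto simp: cochain_ring_def homogeneous_def fun_eq_iff)

lemma cohomology_part_eq:
  fixes X :: "'a topology"
  shows "cohomology_part p X
    = (\<lambda>f. cohomology_class X (homogeneous X p f)) ` {f :: ((nat \<Rightarrow> real) \<Rightarrow> 'a) \<Rightarrow> 'r::comm_ring_1. cocycle_on p X f}"
    (is "?L = ?R")
proof (intro subset_antisym subsetI)
  fix c :: "('a, 'r) graded_cochain set" assume "c \<in> ?L"
  then obtain F where F: "c = cohomology_class X F" "F \<in> carrier (cocycle_ring X)" "\<forall>n. n \<noteq> p \<longrightarrow> F n = (\<lambda>\<sigma>. 0)"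
    by (auto simp: cohomology_part_def cohomology_class_def)
  have eq: "F = homogeneous X p (F p)"
  proof (intro ext)
    fix n \<sigma>
    show "F n \<sigma> = homogeneous X p (F p) n \<sigma>"
      using F(2,3) by (cases "n = p") (simp_all add: mem_cocycle_ring mem_cochain_ring homogeneous_def)
  qed
  with F(2) have "cocycle_on p X (F p)"
    using homogeneous_in_cocycle_ring_iff by metis
  with F(1) eq show "c \<in> ?R"
    by (intro rev_image_eqI[of "F p"]) simp_all
next
  fix c :: "('a, 'r) graded_cochain set" assume "c \<in> ?R"
  then obtain f where f: "cocycle_on p X f" "c = cohomology_class X (homogeneous X p f)"
    by blast
  moreover have "\<forall>n. n \<noteq> p \<longrightarrow> homogeneous X p f n = (\<lambda>\<sigma>. 0)"
    by (simp add: homogeneous_def)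
  ultimately show "c \<in> ?L"
    using homogeneous_in_cocycle_ring_iff[of X p f] unfolding cohomology_part_def cohomology_class_def by blast
qed

lemma foldr_cohomology_class:
  assumes "\<And>a. a \<in> set l \<Longrightarrow> cocycle_on (fst a) X (snd a)"
  shows "foldr (mult (cohomology_ring X)) (map (\<lambda>a. cohomology_class X (homogeneous X (fst a) (snd a))) l) (one (cohomology_ring X))
    = cohomology_class X (homogeneous X (cup_degree l) (cup_list l))"
  using assms
proof (induction l)
  case Nil
  have "one (cohomology_ring X) = cohomology_class X (one (cochain_ring X))"
    by (simp add: cohomology_ring_def FactRing_def cohomology_class_def) (simp add: cocycle_ring_def)
  then show ?case by (simp add: cochain_one_eq)
next
  case (Cons a l)
  have "homogeneous X (cup_degree l) (cup_list l) \<in> carrier (cocycle_ring X)"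
    using Cons.prems by (simp add: homogeneous_in_cocycle_ring_iff cocycle_on_cup_list)
  then show ?case
    using Cons by (simp add: cohomology_class_mult homogeneous_in_cocycle_ring_iff homogeneous_mult)
qed

text \<open>Reduces the supremum over lists of classes to lists of cocycles with their degrees.
  Every list of homogeneous classes of positive degree is represented by such a list, and its
  product is nonzero exactly when \<open>cup_list\<close> of the representatives is not a
  coboundary.\<close>

theorem cohomological_length_eqI:
  fixes X :: "'a topology" and T :: "'r::comm_ring_1 itself"
  assumes nontrivial: "\<exists>l :: (nat \<times> (((nat \<Rightarrow> real) \<Rightarrow> 'a) \<Rightarrow> 'r)) list. length l = r \<and>
      (\<forall>a\<in>set l. fst a > 0 \<and> cocycle_on (fst a) X (snd a)) \<and> \<not> coboundary_on (cup_degree l) X (cup_list l)"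
    and trivial: "\<And>l :: (nat \<times> (((nat \<Rightarrow> real) \<Rightarrow> 'a) \<Rightarrow> 'r)) list. length l > r \<Longrightarrow>
      (\<And>a. a \<in> set l \<Longrightarrow> fst a > 0 \<and> cocycle_on (fst a) X (snd a)) \<Longrightarrow> coboundary_on (cup_degree l) X (cup_list l)"
  shows "cohomological_length TYPE('r) X = enat r"
proof -
  let ?class = "\<lambda>a :: nat \<times> (((nat \<Rightarrow> real) \<Rightarrow> 'a) \<Rightarrow> 'r). cohomology_class X (homogeneous X (fst a) (snd a))"
  let ?prod = "\<lambda>as :: ('a, 'r) graded_cochain set list. foldr (mult (cohomology_ring X)) as (one (cohomology_ring X))"
  let ?S = "{enat (length as) | as :: ('a, 'r) graded_cochain set list.
      (\<forall>a\<in>set as. \<exists>p>0. a \<in> cohomology_part p X) \<and> ?prod as \<noteq> zero (cohomology_ring X)}"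
  have prod: "?prod (map ?class l) \<noteq> zero (cohomology_ring X) \<longleftrightarrow> \<not> coboundary_on (cup_degree l) X (cup_list l)"
    if "\<And>a. a \<in> set l \<Longrightarrow> fst a > 0 \<and> cocycle_on (fst a) X (snd a)" for l
    using that by (simp add: foldr_cohomology_class cohomology_class_zero cohomology_class_eq_zero_iff homogeneous_in_coboundaries_iff)
  have "enat r \<in> ?S"
  proof -
    obtain l :: "(nat \<times> (((nat \<Rightarrow> real) \<Rightarrow> 'a) \<Rightarrow> 'r)) list" where l: "length l = r"
        "\<And>a. a \<in> set l \<Longrightarrow> fst a > 0 \<and> cocycle_on (fst a) X (snd a)" "\<not> coboundary_on (cup_degree l) X (cup_list l)"
      using nontrivial by blast
    have "\<forall>a\<in>set (map ?class l). \<exists>p>0. a \<in> cohomology_part p X"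
      using l(2) by (auto simp: cohomology_part_eq)
    moreover have "?prod (map ?class l) \<noteq> zero (cohomology_ring X)"
      using l(3) prod[OF l(2)] by blast
    ultimately show ?thesis
      using l(1) by (intro CollectI exI[of _ "map ?class l"]) simp
  qed
  moreover have "n \<le> enat r" if "n \<in> ?S" for n
  proof -
    obtain as :: "('a, 'r) graded_cochain set list" where as: "n = enat (length as)"
        "\<forall>a\<in>set as. \<exists>p>0. a \<in> cohomology_part p X" "?prod as \<noteq> zero (cohomology_ring X)"
      using \<open>n \<in> ?S\<close> by blast
    have "\<exists>l. as = map ?class l \<and> (\<forall>a\<in>set l. fst a > 0 \<and> cocycle_on (fst a) X (snd a))"
      using as(2)
    proof (induction as)
      case (Cons a as)
      then obtain l p f where "as = map ?class l" "\<forall>a\<in>set l. fst a > 0 \<and> cocycle_on (fst a) X (snd a)"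
        "p > 0" "cocycle_on p X f" "a = cohomology_class X (homogeneous X p f)"
        by (auto simp: cohomology_part_eq)
      then show ?case
        by (intro exI[of _ "(p, f) # l"]) simp
    qed simp
    then obtain l where l: "as = map ?class l" "\<And>a. a \<in> set l \<Longrightarrow> fst a > 0 \<and> cocycle_on (fst a) X (snd a)"
      by blast
    have "\<not> coboundary_on (cup_degree l) X (cup_list l)"
      using as(3) prod[OF l(2)] by (simp add: l(1))
    with trivial[of l] l(2) have "length l \<le> r"
      by (meson not_le)
    then show ?thesis
      by (simp add: as(1) l(1))
  qed
  ultimately show ?thesis
    unfolding cohomological_length_def by (intro antisym Sup_least Sup_upper) auto
qed

lemma cohomological_length_sphere_product:
  assumes "\<And>i. i \<in> {1..r} \<Longrightarrow> k i \<ge> 1"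
  shows "cohomological_length TYPE('r::comm_ring_1) (sphere_product k r) = enat r"
  by (rule cohomological_length_eqI[OF sphere_product_cup_list_nontrivial[OF assms] sphere_product_cup_list_trivial])

theorem corollary1p8:
  fixes k :: "nat \<Rightarrow> nat" and r :: nat
  assumes "\<And>i. i \<in> {1..r} \<Longrightarrow> k i \<ge> 1"
  defines "M \<equiv> product_topology (\<lambda>i. nsphere (k i)) {1..r}"
  shows "cohomological_length TYPE(int) M = enat r \<and>
         cohomological_length TYPE(real) M = enat r"
  unfolding M_def by (intro conjI cohomological_length_sphere_product assms)

end
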